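(* Let $(\mathcal{M},\nabla)$ be a locally symmetric affine connection space, let $m\in\mathcal{M}$, let $U_m$ be a symmetric normal neighborhood of $m$ with geodesic symmetry $s_m:U_m\to U_m$, let $p\in U_m$ and $q=s_m(p)$, and let $\Pi_p^q:T_p\mathcal{M}\to T_q\mathcal{M}$ be the parallel transport along the geodesic segment $[p,q]$ in $U_m$ through $m$. Let $u_p\in T_p\mathcal{M}$. Then for every sufficiently small time $t>0$, setting $p'=\exp_p(t u_p)$, the points $s_q(s_m(p'))$ and $s_m(s_p(p'))$ are well defined, and both versions of the pole ladder procedure realize exactly the parallel transport along $[p,q]$: $$\log_q\big(s_q(s_m(p'))\big)=\Pi_p^q(t u_p)\qquad\text{and}\qquad \log_q\big(s_m(s_p(p'))\big)=\Pi_p^q(t u_p).$$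
   Context: An affine connection space is a smooth manifold with a smooth affine connection $\nabla$. It is locally symmetric if $\nabla$ is torsion-free and its curvature tensor is covariantly constant, $\nabla R=0$. A symmetric normal neighborhood of a point $x$ is a set $U_x=\exp_x(V_x)$ where $V_x\subset T_x\mathcal{M}$ is an open neighborhood of $0$, star-shaped with respect to $0$ and satisfying $-V_x=V_x$, on which $\exp_x$ is a diffeomorphism onto its image; $\log_x:U_x\to V_x$ denotes the inverse of $\exp_x|_{V_x}$. The geodesic symmetry at $x$ is $s_x:U_x\to U_x$, $s_x(y)=\exp_x(-\log_x(y))$. For $q=s_m(p)$, the geodesic segment $[p,q]$ is $\tau\mapsto\exp_m(-\tau\log_m(p))$, $\tau\in[-1,1]$, with midpoint $m$. The maps $s_p$, $s_q$ and $\log_q$ are taken with respect to (arbitrary) symmetric normal neighborhoods of $p$ and $q$. Pole ladder transports the vector represented by the geodesic segment $[p,p']$ to the vector at $q$ represented by the geodesic segment from $q$ to $s_q(s_m(p'))$, or alternatively to $s_m(s_p(p'))$. *)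

theory Defs
  imports "HOL-Analysis.Analysis"
begin

section \<open>Smooth functions\<close>

text \<open>
  \<open>Ck_on k f S\<close>: all iterated directional derivatives of \<open>f\<close> of order at most \<open>k\<close> exist (as
  values of Frechet derivatives) and are continuous.  Only used for open \<open>S\<close> in a
  finite-dimensional space, where this is \<open>k\<close>-fold continuous differentiability.
\<close>

primrec Ck_on :: "nat \<Rightarrow> ('a::real_normed_vector \<Rightarrow> 'b::real_normed_vector) \<Rightarrow> 'a set \<Rightarrow> bool" where
  "Ck_on 0 f S \<longleftrightarrow> continuous_on S f"
| "Ck_on (Suc k) f S \<longleftrightarrow>
     (\<forall>x\<in>S. f differentiable (at x)) \<and> (\<forall>v. Ck_on k (\<lambda>x. frechet_derivative f (at x) v) S)"

definition smooth_on :: "'a set \<Rightarrow> ('a::real_normed_vector \<Rightarrow> 'b::real_normed_vector) \<Rightarrow> bool" where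
  "smooth_on S f \<longleftrightarrow> (\<forall>k. Ck_on k f S)"


section \<open>Smooth manifolds\<close>

text \<open>
  The underlying space of the manifold is the whole type \<open>'m\<close>, and \<open>'e\<close> is the model space.  The
  atlas is a family of charts \<open>cmap M i\<close> with domains \<open>cdom M i\<close>, indexed by \<open>i \<in> charts M\<close>.
\<close>

record ('m, 'c, 'e) mfd =
  charts :: "'c set"
  cdom :: "'c \<Rightarrow> 'm set"
  cmap :: "'c \<Rightarrow> 'm \<Rightarrow> 'e"

definition cinv :: "('m, 'c, 'e, 'z) mfd_scheme \<Rightarrow> 'c \<Rightarrow> 'e \<Rightarrow> 'm" where
  "cinv M i = inv_into (cdom M i) (cmap M i)"

definition charts_at :: "('m, 'c, 'e, 'z) mfd_scheme \<Rightarrow> 'm \<Rightarrow> 'c set" where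
  "charts_at M x = {i \<in> charts M. x \<in> cdom M i}"

definition smooth_manifold ::
  "('m::{t2_space,second_countable_topology}, 'c, 'e::euclidean_space, 'z) mfd_scheme \<Rightarrow> bool" where
  "smooth_manifold M \<longleftrightarrow>
     (\<Union>i\<in>charts M. cdom M i) = UNIV \<and>
     (\<forall>i\<in>charts M. open (cdom M i) \<and> open (cmap M i ` cdom M i) \<and>
        homeomorphism (cdom M i) (cmap M i ` cdom M i) (cmap M i) (cinv M i)) \<and>
     (\<forall>i\<in>charts M. \<forall>j\<in>charts M.
        smooth_on (cmap M i ` (cdom M i \<inter> cdom M j)) (cmap M j \<circ> cinv M i))"

text \<open>Smooth maps from an open subset of a normed space into \<open>M\<close>, and from an open subset of \<open>M\<close>
  into a normed space.\<close>

definition smooth_into ::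
  "('m::topological_space, 'c, 'e::real_normed_vector, 'z) mfd_scheme \<Rightarrow>
     'a::real_normed_vector set \<Rightarrow> ('a \<Rightarrow> 'm) \<Rightarrow> bool" where
  "smooth_into M S g \<longleftrightarrow> continuous_on S g \<and>
     (\<forall>i\<in>charts M. smooth_on {s \<in> S. g s \<in> cdom M i} (cmap M i \<circ> g))"

definition smooth_from ::
  "('m, 'c, 'e::real_normed_vector, 'z) mfd_scheme \<Rightarrow>
     'm set \<Rightarrow> ('m \<Rightarrow> 'b::real_normed_vector) \<Rightarrow> bool" where
  "smooth_from M U f \<longleftrightarrow> (\<forall>i\<in>charts M. smooth_on (cmap M i ` (U \<inter> cdom M i)) (f \<circ> cinv M i))"


section \<open>Tangent vectors and vector fields\<close>

text \<open>
  A tangent vector at \<open>x\<close> is the family of its coordinate expressions in all charts around \<open>x\<close>,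
  related by the derivatives of the transition maps (and \<open>0\<close> at all other indices, so that the
  family is determined by the vector).  The vector space operations are pointwise.
\<close>

type_synonym ('c, 'e) tvec = "'c \<Rightarrow> 'e"
type_synonym ('m, 'c, 'e) vfield = "'m \<Rightarrow> ('c, 'e) tvec"

definition tangent_space ::
  "('m, 'c, 'e::real_normed_vector, 'z) mfd_scheme \<Rightarrow> 'm \<Rightarrow> ('c, 'e) tvec set" where
  "tangent_space M x =
     {v. (\<forall>i\<in>charts_at M x. \<forall>j\<in>charts_at M x.
            v j = frechet_derivative (cmap M j \<circ> cinv M i) (at (cmap M i x)) (v i)) \<and>
         (\<forall>i. i \<notin> charts_at M x \<longrightarrow> v i = 0)}"

definition tzero :: "('c, 'e::real_vector) tvec" where
  "tzero = (\<lambda>i. 0)"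

definition tadd :: "('c, 'e::real_vector) tvec \<Rightarrow> ('c, 'e) tvec \<Rightarrow> ('c, 'e) tvec" where
  "tadd v w = (\<lambda>i. v i + w i)"

definition tdiff :: "('c, 'e::real_vector) tvec \<Rightarrow> ('c, 'e) tvec \<Rightarrow> ('c, 'e) tvec" where
  "tdiff v w = (\<lambda>i. v i - w i)"

definition tneg :: "('c, 'e::real_vector) tvec \<Rightarrow> ('c, 'e) tvec" where
  "tneg v = (\<lambda>i. - v i)"

definition tscale :: "real \<Rightarrow> ('c, 'e::real_vector) tvec \<Rightarrow> ('c, 'e) tvec" where
  "tscale a v = (\<lambda>i. a *\<^sub>R v i)"

text \<open>Vector fields are total functions; only their values on the open set \<open>U\<close> matter.\<close>

definition smooth_vfield ::
  "('m, 'c, 'e::real_normed_vector, 'z) mfd_scheme \<Rightarrow> 'm set \<Rightarrow> ('m, 'c, 'e) vfield \<Rightarrow> bool" where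
  "smooth_vfield M U X \<longleftrightarrow> (\<forall>x\<in>U. X x \<in> tangent_space M x) \<and>
     (\<forall>i\<in>charts M. smooth_on (cmap M i ` (U \<inter> cdom M i)) (\<lambda>y. X (cinv M i y) i))"

text \<open>
  The vector field with constant coordinate expression \<open>u\<close> in the chart \<open>i\<close>, extended by \<open>0\<close> to
  the complement of \<open>cdom M i\<close>.  In particular, \<open>coord_field M i u x\<close> is the tangent vector at
  \<open>x \<in> cdom M i\<close> with coordinate expression \<open>u\<close> in the chart \<open>i\<close>.
\<close>

definition coord_field ::
  "('m, 'c, 'e::real_normed_vector, 'z) mfd_scheme \<Rightarrow> 'c \<Rightarrow> 'e \<Rightarrow> ('m, 'c, 'e) vfield" where
  "coord_field M i u = (\<lambda>x j. if x \<in> cdom M i \<and> j \<in> charts_at M x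
     then frechet_derivative (cmap M j \<circ> cinv M i) (at (cmap M i x)) u else 0)"

text \<open>The derivative of \<open>f\<close> at \<open>x\<close> in the direction of the tangent vector \<open>v\<close>, computed in the
  chart \<open>i\<close> around \<open>x\<close>.\<close>

definition dir_deriv ::
  "('m, 'c, 'e::real_normed_vector, 'z) mfd_scheme \<Rightarrow>
     'c \<Rightarrow> 'm \<Rightarrow> ('c, 'e) tvec \<Rightarrow> ('m \<Rightarrow> 'b::real_normed_vector) \<Rightarrow> 'b" where
  "dir_deriv M i x v f = frechet_derivative (f \<circ> cinv M i) (at (cmap M i x)) (v i)"

definition lie_bracket ::
  "('m, 'c, 'e::real_normed_vector, 'z) mfd_scheme \<Rightarrow>
     ('m, 'c, 'e) vfield \<Rightarrow> ('m, 'c, 'e) vfield \<Rightarrow> ('m, 'c, 'e) vfield" where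
  "lie_bracket M X Y = (\<lambda>x i. if i \<in> charts_at M x
     then dir_deriv M i x (X x) (\<lambda>z. Y z i) - dir_deriv M i x (Y x) (\<lambda>z. X z i) else 0)"


section \<open>Affine connections\<close>

record ('m, 'c, 'e) acs = "('m, 'c, 'e) mfd" +
  nabla :: "('m, 'c, 'e) vfield \<Rightarrow> ('m, 'c, 'e) vfield \<Rightarrow> ('m, 'c, 'e) vfield"

text \<open>
  \<open>nabla M X Y\<close> is the covariant derivative of \<open>Y\<close> along \<open>X\<close>.  It acts on smooth vector fields on
  arbitrary open sets \<open>U\<close>, compatibly with restriction (third conjunct), and satisfies the usual
  axioms.  A connection given only on global vector fields is a local operator, hence extends
  uniquely to such a family.
\<close>

definition affine_connection_space ::
  "('m::{t2_space,second_countable_topology}, 'c, 'e::euclidean_space) acs \<Rightarrow> bool" where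
  "affine_connection_space M \<longleftrightarrow> smooth_manifold M \<and>
     (\<forall>U X Y. open U \<and> smooth_vfield M U X \<and> smooth_vfield M U Y \<longrightarrow>
        smooth_vfield M U (nabla M X Y)) \<and>
     (\<forall>U X Y X' Y'. open U \<and> smooth_vfield M U X \<and> smooth_vfield M U Y \<and>
        (\<forall>x\<in>U. X' x = X x) \<and> (\<forall>x\<in>U. Y' x = Y x) \<longrightarrow>
        (\<forall>x\<in>U. nabla M X' Y' x = nabla M X Y x)) \<and>
     (\<forall>U X Z Y. open U \<and> smooth_vfield M U X \<and> smooth_vfield M U Z \<and> smooth_vfield M U Y \<longrightarrow>
        (\<forall>x\<in>U. nabla M (\<lambda>x. tadd (X x) (Z x)) Y x = tadd (nabla M X Y x) (nabla M Z Y x))) \<and>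
     (\<forall>U f X Y. open U \<and> smooth_from M U f \<and> smooth_vfield M U X \<and> smooth_vfield M U Y \<longrightarrow>
        (\<forall>x\<in>U. nabla M (\<lambda>x. tscale (f x) (X x)) Y x = tscale (f x) (nabla M X Y x))) \<and>
     (\<forall>U X Y Z. open U \<and> smooth_vfield M U X \<and> smooth_vfield M U Y \<and> smooth_vfield M U Z \<longrightarrow>
        (\<forall>x\<in>U. nabla M X (\<lambda>x. tadd (Y x) (Z x)) x = tadd (nabla M X Y x) (nabla M X Z x))) \<and>
     (\<forall>U f X Y. open U \<and> smooth_from M U f \<and> smooth_vfield M U X \<and> smooth_vfield M U Y \<longrightarrow>
        (\<forall>x\<in>U. \<forall>i\<in>charts_at M x. nabla M X (\<lambda>x. tscale (f x) (Y x)) x =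
           tadd (tscale (dir_deriv M i x (X x) f) (Y x)) (tscale (f x) (nabla M X Y x))))"

definition torsion ::
  "('m, 'c, 'e::real_normed_vector) acs \<Rightarrow>
     ('m, 'c, 'e) vfield \<Rightarrow> ('m, 'c, 'e) vfield \<Rightarrow> ('m, 'c, 'e) vfield" where
  "torsion M X Y = (\<lambda>x. tdiff (tdiff (nabla M X Y x) (nabla M Y X x)) (lie_bracket M X Y x))"

definition curvature ::
  "('m, 'c, 'e::real_normed_vector) acs \<Rightarrow>
     ('m, 'c, 'e) vfield \<Rightarrow> ('m, 'c, 'e) vfield \<Rightarrow> ('m, 'c, 'e) vfield \<Rightarrow> ('m, 'c, 'e) vfield" where
  "curvature M X Y Z = (\<lambda>x.
     tdiff (tdiff (nabla M X (nabla M Y Z) x) (nabla M Y (nabla M X Z) x))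
       (nabla M (lie_bracket M X Y) Z x))"

text \<open>\<open>nabla_curvature M W X Y Z\<close> is the covariant derivative of the curvature tensor along \<open>W\<close>,
  evaluated on \<open>X\<close>, \<open>Y\<close>, \<open>Z\<close>.\<close>

definition nabla_curvature ::
  "('m, 'c, 'e::real_normed_vector) acs \<Rightarrow> ('m, 'c, 'e) vfield \<Rightarrow>
     ('m, 'c, 'e) vfield \<Rightarrow> ('m, 'c, 'e) vfield \<Rightarrow> ('m, 'c, 'e) vfield \<Rightarrow> ('m, 'c, 'e) vfield" where
  "nabla_curvature M W X Y Z = (\<lambda>x.
     tdiff (tdiff (tdiff (nabla M W (curvature M X Y Z) x) (curvature M (nabla M W X) Y Z x))
       (curvature M X (nabla M W Y) Z x)) (curvature M X Y (nabla M W Z) x))"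

definition locally_symmetric ::
  "('m::{t2_space,second_countable_topology}, 'c, 'e::euclidean_space) acs \<Rightarrow> bool" where
  "locally_symmetric M \<longleftrightarrow> affine_connection_space M \<and>
     (\<forall>U X Y. open U \<and> smooth_vfield M U X \<and> smooth_vfield M U Y \<longrightarrow>
        (\<forall>x\<in>U. torsion M X Y x = tzero)) \<and>
     (\<forall>U W X Y Z. open U \<and> smooth_vfield M U W \<and> smooth_vfield M U X \<and> smooth_vfield M U Y \<and>
        smooth_vfield M U Z \<longrightarrow> (\<forall>x\<in>U. nabla_curvature M W X Y Z x = tzero))"


section \<open>Geodesics and parallel transport\<close>

definition christoffel ::
  "('m, 'c, 'e::real_normed_vector) acs \<Rightarrow> 'c \<Rightarrow> 'm \<Rightarrow> 'e \<Rightarrow> 'e \<Rightarrow> 'e" where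
  "christoffel M i x u v = nabla M (coord_field M i u) (coord_field M i v) x i"

definition velocity ::
  "('m, 'c, 'e::real_normed_vector, 'z) mfd_scheme \<Rightarrow> (real \<Rightarrow> 'm) \<Rightarrow> real \<Rightarrow> ('c, 'e) tvec" where
  "velocity M \<gamma> t = (\<lambda>i. if i \<in> charts_at M (\<gamma> t)
     then vector_derivative (cmap M i \<circ> \<gamma>) (at t) else 0)"

definition cov_deriv_along ::
  "('m, 'c, 'e::real_normed_vector) acs \<Rightarrow>
     (real \<Rightarrow> 'm) \<Rightarrow> (real \<Rightarrow> ('c, 'e) tvec) \<Rightarrow> real \<Rightarrow> ('c, 'e) tvec" where
  "cov_deriv_along M \<gamma> V t = (\<lambda>i. if i \<in> charts_at M (\<gamma> t)
     then vector_derivative (\<lambda>s. V s i) (at t) + christoffel M i (\<gamma> t) (velocity M \<gamma> t i) (V t i)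
     else 0)"

definition smooth_curve ::
  "('m::topological_space, 'c, 'e::real_normed_vector) acs \<Rightarrow> real set \<Rightarrow> (real \<Rightarrow> 'm) \<Rightarrow> bool" where
  "smooth_curve M J \<gamma> \<longleftrightarrow> open J \<and> is_interval J \<and> smooth_into M J \<gamma>"

definition smooth_vfield_along ::
  "('m::topological_space, 'c, 'e::real_normed_vector) acs \<Rightarrow>
     real set \<Rightarrow> (real \<Rightarrow> 'm) \<Rightarrow> (real \<Rightarrow> ('c, 'e) tvec) \<Rightarrow> bool" where
  "smooth_vfield_along M J \<gamma> V \<longleftrightarrow> (\<forall>t\<in>J. V t \<in> tangent_space M (\<gamma> t)) \<and>
     (\<forall>i\<in>charts M. smooth_on {t \<in> J. \<gamma> t \<in> cdom M i} (\<lambda>t. V t i))"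

definition geodesic ::
  "('m::topological_space, 'c, 'e::real_normed_vector) acs \<Rightarrow> real set \<Rightarrow> (real \<Rightarrow> 'm) \<Rightarrow> bool" where
  "geodesic M J \<gamma> \<longleftrightarrow> smooth_curve M J \<gamma> \<and>
     (\<forall>t\<in>J. cov_deriv_along M \<gamma> (velocity M \<gamma>) t = tzero)"

definition parallel_along ::
  "('m::topological_space, 'c, 'e::real_normed_vector) acs \<Rightarrow>
     real set \<Rightarrow> (real \<Rightarrow> 'm) \<Rightarrow> (real \<Rightarrow> ('c, 'e) tvec) \<Rightarrow> bool" where
  "parallel_along M J \<gamma> V \<longleftrightarrow> smooth_curve M J \<gamma> \<and> smooth_vfield_along M J \<gamma> V \<and>
     (\<forall>t\<in>J. cov_deriv_along M \<gamma> V t = tzero)"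

text \<open>Parallel transport along the segment of \<open>\<gamma>\<close> from parameter \<open>a\<close> to parameter \<open>b \<ge> a\<close>; smoothness
  on the closed interval means smoothness on an open interval containing it.\<close>

definition parallel_transport ::
  "('m::topological_space, 'c, 'e::real_normed_vector) acs \<Rightarrow>
     (real \<Rightarrow> 'm) \<Rightarrow> real \<Rightarrow> real \<Rightarrow> ('c, 'e) tvec \<Rightarrow> ('c, 'e) tvec" where
  "parallel_transport M \<gamma> a b v =
     (THE w. \<exists>J V. {a..b} \<subseteq> J \<and> parallel_along M J \<gamma> V \<and> V a = v \<and> V b = w)"


section \<open>Exponential map, symmetric normal neighborhoods, geodesic symmetries\<close>

definition exp_domain ::
  "('m::topological_space, 'c, 'e::real_normed_vector) acs \<Rightarrow> 'm \<Rightarrow> ('c, 'e) tvec set" where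
  "exp_domain M x = {v \<in> tangent_space M x.
     \<exists>J \<gamma>. geodesic M J \<gamma> \<and> {0..1} \<subseteq> J \<and> \<gamma> 0 = x \<and> velocity M \<gamma> 0 = v}"

text \<open>Meaningful for \<open>v \<in> exp_domain M x\<close> only.\<close>

definition exp_map ::
  "('m::topological_space, 'c, 'e::real_normed_vector) acs \<Rightarrow> 'm \<Rightarrow> ('c, 'e) tvec \<Rightarrow> 'm" where
  "exp_map M x v = (THE y. \<exists>J \<gamma>. geodesic M J \<gamma> \<and> {0..1} \<subseteq> J \<and>
     \<gamma> 0 = x \<and> velocity M \<gamma> 0 = v \<and> \<gamma> 1 = y)"

text \<open>The inverse of the exponential map at \<open>x\<close> restricted to \<open>V\<close>, and the geodesic symmetry at \<open>x\<close>
  on \<open>exp_map M x ` V\<close>.\<close>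

definition log_map ::
  "('m::topological_space, 'c, 'e::real_normed_vector) acs \<Rightarrow>
     'm \<Rightarrow> ('c, 'e) tvec set \<Rightarrow> 'm \<Rightarrow> ('c, 'e) tvec" where
  "log_map M x V = inv_into V (exp_map M x)"

definition geodesic_symmetry ::
  "('m::topological_space, 'c, 'e::real_normed_vector) acs \<Rightarrow>
     'm \<Rightarrow> ('c, 'e) tvec set \<Rightarrow> 'm \<Rightarrow> 'm" where
  "geodesic_symmetry M x V y = exp_map M x (tneg (log_map M x V y))"

text \<open>
  \<open>exp_map M x ` V\<close> is a symmetric normal neighborhood of \<open>x\<close>.  The topology and smooth structure of
  the tangent space at \<open>x\<close> are expressed through the linear isomorphism \<open>\<lambda>v. v i\<close> onto the model
  space, whose inverse is \<open>\<lambda>u. coord_field M i u x\<close>.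
\<close>

definition symmetric_normal ::
  "('m::{t2_space,second_countable_topology}, 'c, 'e::euclidean_space) acs \<Rightarrow>
     'm \<Rightarrow> ('c, 'e) tvec set \<Rightarrow> bool" where
  "symmetric_normal M x V \<longleftrightarrow>
     V \<subseteq> exp_domain M x \<and>
     tzero \<in> V \<and>
     (\<forall>i\<in>charts_at M x. open ((\<lambda>v. v i) ` V)) \<and>
     (\<forall>v\<in>V. \<forall>a\<in>{0..1}. tscale a v \<in> V) \<and>
     (\<forall>v\<in>V. tneg v \<in> V) \<and>
     inj_on (exp_map M x) V \<and>
     open (exp_map M x ` V) \<and>
     (\<forall>i\<in>charts_at M x.
        smooth_into M ((\<lambda>v. v i) ` V) (\<lambda>u. exp_map M x (coord_field M i u x)) \<and>
        smooth_from M (exp_map M x ` V) (\<lambda>y. log_map M x V y i))"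

text \<open>The geodesic through \<open>m\<close> which, on the parameter interval from \<open>-1\<close> to \<open>1\<close>, is the segment from
  \<open>p\<close> to its image under the geodesic symmetry at \<open>m\<close>.\<close>

definition geodesic_segment ::
  "('m::topological_space, 'c, 'e::real_normed_vector) acs \<Rightarrow>
     'm \<Rightarrow> ('c, 'e) tvec set \<Rightarrow> 'm \<Rightarrow> real \<Rightarrow> 'm" where
  "geodesic_segment M m V p \<tau> = exp_map M m (tscale (- \<tau>) (log_map M m V p))"

end

theory Submission
  imports Defs
begin

text \<open>
  In normal coordinates at \<open>m\<close> the geodesic symmetry \<open>s\<^sub>m\<close> is \<open>x \<mapsto> - x\<close>, so it is affine iff the Christoffel
  symbols \<open>\<Gamma>\<close> are odd.  Since \<open>\<nabla>R = 0\<close>, along a ray \<open>t \<mapsto> t x\<close> the operators \<open>A = \<Gamma>(t x)(x, _)\<close> and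
  \<open>\<rho> = R(x, _)x\<close> satisfy the singular Riccati system \<open>(t\<^sup>2 A)' = t\<^sup>2 (\<rho> - A\<^sup>2)\<close>, \<open>\<rho>' = \<rho> A - A \<rho>\<close>, which is the same
  for \<open>x\<close> and \<open>- x\<close>; uniqueness gives \<open>\<Gamma>(- x)(x, _) = - \<Gamma>(x)(x, _)\<close>.  Consequently \<open>R(x, _)_\<close> has the
  expected parity, and \<open>H = \<Gamma>(t x) + \<Gamma>(- t x)\<close>, evaluated on parallel fields, solves \<open>(t H)' = - t A H\<close>, hence vanishes.

  So \<open>s\<^sub>m\<close> maps the geodesic \<open>exp\<^sub>p(t u)\<close> to the geodesic \<open>exp\<^sub>q(t w)\<close> with \<open>w = ds\<^sub>m(u)\<close>, and both versions of the
  pole ladder return \<open>- t w\<close>.  In these coordinates a parallel field along \<open>[p, q]\<close> is an even function of the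
  parameter, because its equation has an odd coefficient; hence the parallel transport of \<open>u\<close> is \<open>- w\<close> as well.
\<close>

section \<open>Calculus of smooth functions\<close>

text \<open>The equations along a ray are singular because of the derivatives transversal to it.
  Differentiating the radial identity \<open>\<Gamma>(y)(y, y) = 0\<close> at \<open>y = t x\<close>
  expresses the transversal derivative of \<open>\<Gamma>(x, x)\<close> through
  \<open>- 2 A / t\<close>, a pole at the centre. Inserted into the curvature, it produces the
  weight \<open>t^2\<close>, and in the last step the weight \<open>t\<close>. Uniqueness therefore
  rests on continuity of the unknown up to 0 instead of an initial value. Oddness of
  \<open>\<Gamma>(x)(x, _)\<close> does not directly give oddness of
  \<open>\<Gamma>(x)(v, w)\<close> for all \<open>v\<close>. The curvature \<open>R(x, v)w\<close>
  links the transversal derivative of the former with the radial derivative of the latter, so its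
  parity has to be settled in between, by parallel fields that exist on the whole ray. The
  connection is specified in charts while the argument lives in normal coordinates; all coordinate
  formulas are therefore proved for arbitrary parametrizations. The neighborhoods of
  \<open>p\<close> and \<open>q\<close> are unrelated to that of \<open>m\<close>; they enter
  through short geodesics at \<open>p\<close> and \<open>q\<close>, which uniqueness of geodesics
  identifies with curves in the coordinates at \<open>m\<close>.\<close>

abbreviation fd :: "('a::real_normed_vector \<Rightarrow> 'b::real_normed_vector) \<Rightarrow> 'a \<Rightarrow> 'a \<Rightarrow> 'b"
  where "fd f x \<equiv> frechet_derivative f (at x)"

section \<open>Finite orders of differentiability\<close>

lemma Ck_on_cong:
  assumes "open S" "\<And>x. x \<in> S \<Longrightarrow> f x = g x" "Ck_on k f S"
  shows "Ck_on k g S"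
  using assms(2,3)
proof (induction k arbitrary: f g)
  case 0
  then show ?case by (auto cong: continuous_on_cong)
next
  case (Suc k)
  have d: "g differentiable (at x)" "fd f x = fd g x" if "x \<in> S" for x
  proof -
    have "f differentiable (at x)" using Suc that by auto
    then show "g differentiable (at x)" "fd f x = fd g x"
      using that Suc(2) \<open>open S\<close> frechet_derivative_transform_within_open[of f x S g]
      by (auto simp: differentiable_def intro: has_derivative_transform_within_open)
  qed
  have "Ck_on k (\<lambda>x. fd g x v) S" for v
    by (rule Suc.IH[of "\<lambda>x. fd f x v"]) (use Suc d in auto)
  then show ?case using d by auto
qed

lemma Ck_on_subset: "Ck_on k f S \<Longrightarrow> T \<subseteq> S \<Longrightarrow> Ck_on k f T"
  by (induction k arbitrary: f) (auto intro: continuous_on_subset)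

lemma Ck_on_local:
  assumes "open S" "\<And>x. x \<in> S \<Longrightarrow> \<exists>T. open T \<and> x \<in> T \<and> Ck_on k f T"
  shows "Ck_on k f S"
  using assms(2)
proof (induction k arbitrary: f)
  case 0
  have "isCont f x" if "x \<in> S" for x
    using 0[OF that] continuous_on_eq_continuous_at by force
  then show ?case by (simp add: continuous_at_imp_continuous_on)
next
  case (Suc k)
  have "Ck_on k (\<lambda>x. fd f x v) S" for v
    by (rule Suc.IH) (use Suc.prems in fastforce)
  moreover have "f differentiable (at x)" if "x \<in> S" for x
    using Suc.prems[OF that] by auto
  ultimately show ?case by auto
qed

text \<open>At positive order the recursion of \<open>Ck_on\<close> asks only for differentiability
  and for properties of the derivatives; continuity of the function is recovered at the bottom of
  the induction.\<close>

lemma Ck_on_Suc_imp: "Ck_on (Suc k) f S \<Longrightarrow> Ck_on k f S"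
proof (induction k arbitrary: f)
  case 0
  then show ?case
    by (auto intro!: continuous_at_imp_continuous_on differentiable_imp_continuous_within)
next
  case (Suc k)
  have "\<forall>x\<in>S. f differentiable (at x)" using Suc.prems by auto
  moreover have "Ck_on k (\<lambda>x. fd f x v) S" for v
    by (rule Suc.IH) (use Suc.prems in auto)
  ultimately show ?case by auto
qed

lemma Ck_on_const: "Ck_on k (\<lambda>x. c) S"
  by (induction k arbitrary: c) auto

lemma fd_bounded_linear: "bounded_linear L \<Longrightarrow> fd L x = L"
  by (metis bounded_linear_imp_has_derivative frechet_derivative_at)

lemma Ck_on_bounded_linear: "bounded_linear L \<Longrightarrow> Ck_on k L S"
  by (cases k) (auto simp: fd_bounded_linear Ck_on_const linear_continuous_on
      bounded_linear_imp_differentiable)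

lemma Ck_on_bounded_linear_comp:
  assumes "bounded_linear L" "open S" "Ck_on k f S"
  shows "Ck_on k (\<lambda>x. L (f x)) S"
  using assms(3)
proof (induction k arbitrary: f)
  case 0
  then show ?case using assms(1) by (auto intro: bounded_linear.continuous_on)
next
  case (Suc k)
  have d: "((\<lambda>x. L (f x)) has_derivative (\<lambda>v. L (fd f x v))) (at x)" if "x \<in> S" for x
    using Suc.prems that
    by (auto intro!: bounded_linear.has_derivative[OF assms(1)] simp: frechet_derivative_works)
  have "Ck_on k (\<lambda>x. fd (\<lambda>x. L (f x)) x v) S" for v
    by (rule Ck_on_cong[OF \<open>open S\<close> _ Suc.IH[of "\<lambda>x. fd f x v"]])
      (use Suc.prems frechet_derivative_at[OF d] in \<open>auto simp: fun_eq_iff\<close>)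
  then show ?case using d by (auto simp: differentiable_def)
qed

lemma Ck_on_add:
  assumes "open S" "Ck_on k f S" "Ck_on k g S"
  shows "Ck_on k (\<lambda>x. f x + g x) S"
  using assms(2,3)
proof (induction k arbitrary: f g)
  case 0
  then show ?case by (auto intro: continuous_on_add)
next
  case (Suc k)
  have d: "((\<lambda>x. f x + g x) has_derivative (\<lambda>v. fd f x v + fd g x v)) (at x)" if "x \<in> S" for x
    using Suc.prems that by (auto intro!: has_derivative_add simp: frechet_derivative_works)
  have "Ck_on k (\<lambda>x. fd (\<lambda>x. f x + g x) x v) S" for v
    by (rule Ck_on_cong[OF \<open>open S\<close> _ Suc.IH[of "\<lambda>x. fd f x v" "\<lambda>x. fd g x v"]])
      (use Suc.prems frechet_derivative_at[OF d] in \<open>auto simp: fun_eq_iff\<close>)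
  then show ?case using d by (auto simp: differentiable_def)
qed

lemma Ck_on_sum:
  assumes "open S" "finite A" "\<And>a. a \<in> A \<Longrightarrow> Ck_on k (f a) S"
  shows "Ck_on k (\<lambda>x. \<Sum>a\<in>A. f a x) S"
  using assms(2,3)
  by (induction rule: finite_induct) (auto simp: Ck_on_const intro!: Ck_on_add assms(1))

text \<open>The product rule leaves one factor undifferentiated in each of its two terms. That
  factor is used at the lower order, so the induction closes with \<open>f\<close> and
  \<open>g\<close> varying together.\<close>

lemma Ck_on_bilinear:
  assumes B: "bounded_bilinear B" and "open S" "Ck_on k f S" "Ck_on k g S"
  shows "Ck_on k (\<lambda>x. B (f x) (g x)) S"
  using assms(3,4)
proof (induction k arbitrary: f g)
  case 0
  then show ?case using bounded_bilinear.continuous_on[OF B] by auto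
next
  case (Suc k)
  have d: "((\<lambda>x. B (f x) (g x)) has_derivative (\<lambda>v. B (f x) (fd g x v) + B (fd f x v) (g x))) (at x)"
    if "x \<in> S" for x
    using Suc.prems that by (auto intro!: bounded_bilinear.FDERIV[OF B] simp: frechet_derivative_works)
  have "Ck_on k (\<lambda>x. fd (\<lambda>x. B (f x) (g x)) x v) S" for v
  proof (rule Ck_on_cong[OF \<open>open S\<close>])
    show "Ck_on k (\<lambda>x. B (f x) (fd g x v) + B (fd f x v) (g x)) S"
      using Suc.prems by (intro Ck_on_add[OF \<open>open S\<close>] Suc.IH) (auto intro: Ck_on_Suc_imp[of k f] Ck_on_Suc_imp[of k g])
  qed (use frechet_derivative_at[OF d] in \<open>auto simp: fun_eq_iff\<close>)
  then show ?case using d by (auto simp: differentiable_def)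
qed

lemma linear_sum_Basis:
  fixes L :: "'a::euclidean_space \<Rightarrow> 'b::real_vector"
  assumes "linear L"
  shows "L v = (\<Sum>b\<in>Basis. (v \<bullet> b) *\<^sub>R L b)"
proof -
  have "L v = L (\<Sum>b\<in>Basis. (v \<bullet> b) *\<^sub>R b)" by (simp add: euclidean_representation)
  then show ?thesis using assms by (simp add: linear_sum linear_cmul)
qed

lemma linear_fd: "f differentiable (at x) \<Longrightarrow> linear (fd f x)"
  using has_derivative_linear frechet_derivative_works by blast

text \<open>\<open>Ck_on\<close> differentiates in fixed directions, whereas the chain rule produces
  the moving direction \<open>fd f x v\<close>. Expanding it in the basis of the intermediate space
  gives a finite sum of scalar coefficients times derivatives of \<open>g\<close> in fixed
  directions; hence the Euclidean type there.\<close>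

lemma Ck_on_compose:
  fixes f :: "'a::real_normed_vector \<Rightarrow> 'b::euclidean_space" and g :: "'b \<Rightarrow> 'c::real_normed_vector"
  assumes "open S" "open T" "Ck_on k f S" "Ck_on k g T" "f ` S \<subseteq> T"
  shows "Ck_on k (\<lambda>x. g (f x)) S"
  using assms(3,4)
proof (induction k arbitrary: g)
  case 0
  then show ?case using assms(5) by (auto intro: continuous_on_compose2)
next
  case (Suc k)
  have df: "(f has_derivative fd f x) (at x)" and dg: "g differentiable (at (f x))" if "x \<in> S" for x
    using Suc.prems that assms(5) by (auto simp: frechet_derivative_works)
  have d: "((\<lambda>x. g (f x)) has_derivative (\<lambda>v. fd g (f x) (fd f x v))) (at x)" if "x \<in> S" for x
    using diff_chain_at[OF df[OF that]] dg[OF that] by (auto simp: frechet_derivative_works o_def)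
  have "Ck_on k (\<lambda>x. fd (\<lambda>x. g (f x)) x v) S" for v
  proof (rule Ck_on_cong[OF \<open>open S\<close>])
    show "Ck_on k (\<lambda>x. \<Sum>b\<in>Basis. (fd f x v \<bullet> b) *\<^sub>R fd g (f x) b) S"
    proof (intro Ck_on_sum[OF \<open>open S\<close>] Ck_on_bilinear[OF bounded_bilinear_scaleR \<open>open S\<close>])
      fix b :: 'b
      show "Ck_on k (\<lambda>x. fd f x v \<bullet> b) S"
        using Suc.prems by (intro Ck_on_bounded_linear_comp[OF bounded_linear_inner_left \<open>open S\<close>]) auto
      show "Ck_on k (\<lambda>x. fd g (f x) b) S"
        using Suc.prems Ck_on_Suc_imp by (intro Suc.IH[of "\<lambda>y. fd g y b"]) auto
    qed auto
    fix x assume "x \<in> S"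
    then show "(\<Sum>b\<in>Basis. (fd f x v \<bullet> b) *\<^sub>R fd g (f x) b) = fd (\<lambda>x. g (f x)) x v"
      using linear_sum_Basis[OF linear_fd[OF dg], of x "fd f x v"] by (simp flip: frechet_derivative_at[OF d])
  qed
  then show ?case using d by (auto simp: differentiable_def)
qed

section \<open>Closure properties of smooth functions\<close>

lemma smooth_on_cong: "open S \<Longrightarrow> (\<And>x. x \<in> S \<Longrightarrow> f x = g x) \<Longrightarrow> smooth_on S f \<Longrightarrow> smooth_on S g"
  unfolding smooth_on_def using Ck_on_cong by blast

lemma smooth_on_subset: "smooth_on S f \<Longrightarrow> T \<subseteq> S \<Longrightarrow> smooth_on T f"
  unfolding smooth_on_def using Ck_on_subset by blast

lemma smooth_on_local:
  assumes "open S" "\<And>x. x \<in> S \<Longrightarrow> \<exists>T. open T \<and> x \<in> T \<and> smooth_on T f"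
  shows "smooth_on S f"
  unfolding smooth_on_def
  by (intro allI Ck_on_local[OF assms(1)]) (use assms(2) in \<open>auto simp: smooth_on_def\<close>)

lemma smooth_on_const: "smooth_on S (\<lambda>x. c)"
  by (simp add: smooth_on_def Ck_on_const)

lemma smooth_on_bounded_linear: "bounded_linear L \<Longrightarrow> smooth_on S L"
  by (simp add: smooth_on_def Ck_on_bounded_linear)

lemma smooth_on_bounded_linear_comp:
  "bounded_linear L \<Longrightarrow> open S \<Longrightarrow> smooth_on S f \<Longrightarrow> smooth_on S (\<lambda>x. L (f x))"
  by (simp add: smooth_on_def Ck_on_bounded_linear_comp)

lemma smooth_on_add:
  "open S \<Longrightarrow> smooth_on S f \<Longrightarrow> smooth_on S g \<Longrightarrow> smooth_on S (\<lambda>x. f x + g x)"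
  by (simp add: smooth_on_def Ck_on_add)

lemma smooth_on_minus: "open S \<Longrightarrow> smooth_on S f \<Longrightarrow> smooth_on S (\<lambda>x. - f x)"
  using smooth_on_bounded_linear_comp[OF bounded_linear_minus[OF bounded_linear_ident]] .

lemma smooth_on_diff:
  "open S \<Longrightarrow> smooth_on S f \<Longrightarrow> smooth_on S g \<Longrightarrow> smooth_on S (\<lambda>x. f x - g x)"
  using smooth_on_add[OF _ _ smooth_on_minus, of S f g] by simp

lemma smooth_on_sum:
  "open S \<Longrightarrow> finite A \<Longrightarrow> (\<And>a. a \<in> A \<Longrightarrow> smooth_on S (f a)) \<Longrightarrow> smooth_on S (\<lambda>x. \<Sum>a\<in>A. f a x)"
  by (simp add: smooth_on_def Ck_on_sum)

lemma smooth_on_bilinear: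
  "bounded_bilinear B \<Longrightarrow> open S \<Longrightarrow> smooth_on S f \<Longrightarrow> smooth_on S g \<Longrightarrow> smooth_on S (\<lambda>x. B (f x) (g x))"
  by (simp add: smooth_on_def Ck_on_bilinear)

lemmas smooth_on_scaleR = smooth_on_bilinear[OF bounded_bilinear_scaleR]
  and smooth_on_blinfun_apply = smooth_on_bilinear[OF bounded_bilinear_blinfun_apply]

lemma smooth_on_compose:
  fixes f :: "'a::real_normed_vector \<Rightarrow> 'b::euclidean_space" and g :: "'b \<Rightarrow> 'c::real_normed_vector"
  assumes "open S" "open T" "smooth_on S f" "smooth_on T g" "\<And>x. x \<in> S \<Longrightarrow> f x \<in> T"
  shows "smooth_on S (\<lambda>x. g (f x))"
  using Ck_on_compose[OF assms(1,2), of _ f g] assms(3-5) by (auto simp: smooth_on_def image_subset_iff)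

lemma smooth_on_Pair:
  assumes "open S" "smooth_on S f" "smooth_on S g"
  shows "smooth_on S (\<lambda>x. (f x, g x))"
proof -
  have "smooth_on S (\<lambda>x. (f x, 0) + (0, g x))"
    using assms by (intro smooth_on_add
        smooth_on_bounded_linear_comp[where L="\<lambda>y. (y, 0)"] smooth_on_bounded_linear_comp[where L="Pair 0"])
      (auto intro!: bounded_linear_Pair bounded_linear_ident bounded_linear_zero)
  then show ?thesis by simp
qed

lemma smooth_on_continuous_on: "smooth_on S f \<Longrightarrow> continuous_on S f"
  unfolding smooth_on_def by (metis Ck_on.simps(1))

lemma smooth_on_differentiable: "smooth_on S f \<Longrightarrow> x \<in> S \<Longrightarrow> f differentiable (at x)"
  unfolding smooth_on_def by (metis Ck_on.simps(2))

lemma smooth_on_has_derivative: "smooth_on S f \<Longrightarrow> x \<in> S \<Longrightarrow> (f has_derivative fd f x) (at x)"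
  using smooth_on_differentiable frechet_derivative_works by blast

lemma smooth_on_fd: "smooth_on S f \<Longrightarrow> smooth_on S (\<lambda>x. fd f x v)"
  unfolding smooth_on_def by (metis Ck_on.simps(2))

lemma linear_fd_smooth: "smooth_on S f \<Longrightarrow> x \<in> S \<Longrightarrow> linear (fd f x)"
  using smooth_on_differentiable linear_fd by blast

text \<open>Base point and direction vary together in the chart components of a vector field; the
  expansion in basis directions reduces this to derivatives in fixed directions.\<close>

lemma smooth_on_fd_joint:
  fixes f :: "'a::euclidean_space \<Rightarrow> 'b::real_normed_vector"
  assumes "open S" "smooth_on S f" "smooth_on S h"
  shows "smooth_on S (\<lambda>x. fd f x (h x))"
proof (rule smooth_on_cong[OF \<open>open S\<close>])
  show "smooth_on S (\<lambda>x. \<Sum>b\<in>Basis. (h x \<bullet> b) *\<^sub>R fd f x b)"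
    by (intro smooth_on_sum smooth_on_scaleR smooth_on_fd assms finite_Basis
        smooth_on_bounded_linear_comp[OF bounded_linear_inner_left])
  show "(\<Sum>b\<in>Basis. (h x \<bullet> b) *\<^sub>R fd f x b) = fd f x (h x)" if "x \<in> S" for x
    using linear_sum_Basis[OF linear_fd_smooth[OF assms(2) that]] by metis
qed

lemma fd_eq: "(f has_derivative f') (at x) \<Longrightarrow> fd f x = f'"
  using frechet_derivative_at by metis

lemma fd_cong: "open S \<Longrightarrow> x \<in> S \<Longrightarrow> (\<And>y. y \<in> S \<Longrightarrow> f y = g y) \<Longrightarrow> fd f x = fd g x"
  unfolding frechet_derivative_def
  by (metis has_derivative_transform_within_open)

lemma fd_compose_smooth:
  assumes "smooth_on S f" "x \<in> S" "smooth_on T g" "f x \<in> T"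
  shows "fd (\<lambda>x. g (f x)) x v = fd g (f x) (fd f x v)"
  using fd_eq[OF diff_chain_at[OF smooth_on_has_derivative[OF assms(1,2)] smooth_on_has_derivative[OF assms(3,4)]]]
  by (simp add: o_def)

lemma smooth_on_has_derivative_along:
  assumes "smooth_on T g" "c t \<in> T" "(c has_vector_derivative c') (at t within S)"
  shows "((\<lambda>t. g (c t)) has_vector_derivative fd g (c t) c') (at t within S)"
  using has_derivative_compose[OF assms(3)[unfolded has_vector_derivative_def]
      smooth_on_has_derivative[OF assms(1,2)]]
    linear_cmul[OF linear_fd_smooth[OF assms(1,2)]]
  by (simp add: has_vector_derivative_def)

lemma vector_derivative_bound:
  fixes f :: "real \<Rightarrow> 'a::real_normed_vector"
  assumes "a \<le> b" "\<And>t. t \<in> {a..b} \<Longrightarrow> (f has_vector_derivative f' t) (at t within {a..b})"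
    and "\<And>t. t \<in> {a..b} \<Longrightarrow> norm (f' t) \<le> B"
  shows "norm (f b - f a) \<le> B * (b - a)"
proof -
  have "norm (f b - f a) \<le> B * norm (b - a)"
  proof (rule differentiable_bound[of "{a..b}"])
    show "onorm (\<lambda>h. h *\<^sub>R f' t) \<le> B" if "t \<in> {a..b}" for t
      using assms(3)[OF that] onorm_scaleR_left[OF bounded_linear_ident, of "f' t"]
      by (simp add: onorm_id)
  qed (use assms in \<open>auto simp: has_vector_derivative_def\<close>)
  then show ?thesis using assms(1) by simp
qed

text \<open>The mean value inequality is applied twice: in direction \<open>v\<close> to the
  derivative along \<open>u\<close>, then in direction \<open>u\<close> to a first difference of
  \<open>f\<close>. The second difference on the left is symmetric in \<open>u\<close> and
  \<open>v\<close>, although the limit term is not visibly so.\<close>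

lemma second_difference_estimate:
  fixes f :: "'a::real_normed_vector \<Rightarrow> 'b::real_normed_vector"
  assumes "open S" "x \<in> S" "smooth_on S f" "e > 0"
  obtains d where "d > 0" and "\<And>h. 0 < h \<Longrightarrow> h < d \<Longrightarrow>
    norm (f (x + h *\<^sub>R u + h *\<^sub>R v) - f (x + h *\<^sub>R u) - f (x + h *\<^sub>R v) + f x
      - (h * h) *\<^sub>R fd (\<lambda>y. fd f y u) x v) \<le> h * h * e"
proof -
  define F where "F y = fd f y u" for y
  define G where "G y = fd F y v" for y
  have smF: "smooth_on S F" unfolding F_def by (rule smooth_on_fd) fact
  have smG: "smooth_on S G" unfolding G_def by (rule smooth_on_fd) fact
  have "isCont G x"
    using smooth_on_continuous_on[OF smG] assms(1,2) continuous_on_eq_continuous_at by blast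
  then obtain d1 where d1: "d1 > 0" "\<And>y. dist y x < d1 \<Longrightarrow> dist (G y) (G x) < e"
    using \<open>e > 0\<close> by (auto simp: continuous_at_eps_delta)
  obtain d2 where d2: "d2 > 0" "ball x d2 \<subseteq> S" using assms(1,2) openE by blast
  define r where "r = min d1 d2"
  \<comment> \<open>Sides shorter than \<open>d\<close> keep the parallelogram spanned by
    \<open>h *\<^sub>R u\<close> and \<open>h *\<^sub>R v\<close> within distance \<open>r\<close>
    of \<open>x\<close>; the summand 1 keeps the denominator positive.\<close>
  define d where "d = r / (norm u + norm v + 1)"
  have "r > 0" using d1 d2 by (auto simp: r_def)
  then have "d > 0" by (auto simp: d_def add_nonneg_pos)
  moreover have "norm (f (x + h *\<^sub>R u + h *\<^sub>R v) - f (x + h *\<^sub>R u) - f (x + h *\<^sub>R v) + f x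
      - (h * h) *\<^sub>R fd (\<lambda>y. fd f y u) x v) \<le> h * h * e" if h: "0 < h" "h < d" for h
  proof -
    have near: "x + s *\<^sub>R u + t *\<^sub>R v \<in> S" "dist (G (x + s *\<^sub>R u + t *\<^sub>R v)) (G x) < e"
      if "s \<in> {0..h}" "t \<in> {0..h}" for s t
    proof -
      have "norm (s *\<^sub>R u + t *\<^sub>R v) \<le> h * norm u + h * norm v"
        using that by (intro norm_triangle_le add_mono) (auto intro!: mult_right_mono)
      also have "\<dots> \<le> h * (norm u + norm v + 1)" using h by (simp add: algebra_simps)
      also have "\<dots> < r"
        using h(2) by (simp add: d_def pos_less_divide_eq add_nonneg_pos)
      finally have "dist (x + s *\<^sub>R u + t *\<^sub>R v) x < r" by (simp add: dist_norm add.assoc)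
      then show "x + s *\<^sub>R u + t *\<^sub>R v \<in> S" "dist (G (x + s *\<^sub>R u + t *\<^sub>R v)) (G x) < e"
        using d1(2)[of "x + s *\<^sub>R u + t *\<^sub>R v"] d2 by (auto simp: r_def dist_commute)
    qed
    have step1: "norm (F (x + s *\<^sub>R u + h *\<^sub>R v) - F (x + s *\<^sub>R u) - h *\<^sub>R G x) \<le> e * h"
      if s: "s \<in> {0..h}" for s
    proof -
      have "((\<lambda>t. F (x + s *\<^sub>R u + t *\<^sub>R v) - t *\<^sub>R G x) has_vector_derivative
          G (x + s *\<^sub>R u + t *\<^sub>R v) - G x) (at t within {0..h})" if t: "t \<in> {0..h}" for t
      proof -
        have "((\<lambda>t. x + s *\<^sub>R u + t *\<^sub>R v) has_vector_derivative v) (at t within {0..h})"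
          by (auto intro!: derivative_eq_intros)
        from smooth_on_has_derivative_along[OF smF near(1)[OF s t] this]
        show ?thesis unfolding G_def by (auto intro!: derivative_eq_intros)
      qed
      from vector_derivative_bound[OF _ this, of e] near(2)[OF s] h
      show ?thesis by (auto simp: dist_norm less_imp_le algebra_simps)
    qed
    have d2: "((\<lambda>s. f (x + s *\<^sub>R u + h *\<^sub>R v) - f (x + s *\<^sub>R u) - (s * h) *\<^sub>R G x) has_vector_derivative
          F (x + s *\<^sub>R u + h *\<^sub>R v) - F (x + s *\<^sub>R u) - h *\<^sub>R G x) (at s within {0..h})"
      if s: "s \<in> {0..h}" for s
    proof -
      have "x + s *\<^sub>R u + h *\<^sub>R v \<in> S" "x + s *\<^sub>R u \<in> S" using near(1)[OF s, of h] near(1)[OF s, of 0] h by auto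
      moreover have "((\<lambda>s. x + s *\<^sub>R u + h *\<^sub>R v) has_vector_derivative u) (at s within {0..h})"
        "((\<lambda>s. x + s *\<^sub>R u) has_vector_derivative u) (at s within {0..h})"
        by (auto intro!: derivative_eq_intros)
      ultimately show ?thesis unfolding F_def
        by (auto intro!: derivative_eq_intros smooth_on_has_derivative_along[OF assms(3)])
    qed
    have "norm ((f (x + h *\<^sub>R u + h *\<^sub>R v) - f (x + h *\<^sub>R u) - (h * h) *\<^sub>R G x)
        - (f (x + 0 *\<^sub>R u + h *\<^sub>R v) - f (x + 0 *\<^sub>R u) - (0 * h) *\<^sub>R G x)) \<le> (e * h) * (h - 0)"
      by (rule vector_derivative_bound[OF _ d2 step1]) (use h in auto)
    moreover have "F = (\<lambda>y. fd f y u)" by (simp add: F_def fun_eq_iff)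
    ultimately show ?thesis by (simp add: algebra_simps G_def)
  qed
  ultimately show ?thesis using that by blast
qed

text \<open>Both mixed derivatives approximate one and the same second difference, up to an
  arbitrarily small multiple of \<open>h * h\<close>.\<close>

lemma fd_fd_commute:
  assumes "open S" "x \<in> S" "smooth_on S f"
  shows "fd (\<lambda>y. fd f y u) x v = fd (\<lambda>y. fd f y v) x u"
proof -
  define a where "a = fd (\<lambda>y. fd f y u) x v - fd (\<lambda>y. fd f y v) x u"
  have "norm a \<le> 2 * e" if "e > 0" for e
  proof -
    obtain d1 where d1: "d1 > 0" and
      1: "\<And>h. 0 < h \<Longrightarrow> h < d1 \<Longrightarrow> norm (f (x + h *\<^sub>R u + h *\<^sub>R v) - f (x + h *\<^sub>R u) - f (x + h *\<^sub>R v) + f x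
        - (h * h) *\<^sub>R fd (\<lambda>y. fd f y u) x v) \<le> h * h * e"
      using second_difference_estimate[OF assms \<open>e > 0\<close>, of u v] by blast
    obtain d2 where d2: "d2 > 0" and
      2: "\<And>h. 0 < h \<Longrightarrow> h < d2 \<Longrightarrow> norm (f (x + h *\<^sub>R v + h *\<^sub>R u) - f (x + h *\<^sub>R v) - f (x + h *\<^sub>R u) + f x
        - (h * h) *\<^sub>R fd (\<lambda>y. fd f y v) x u) \<le> h * h * e"
      using second_difference_estimate[OF assms \<open>e > 0\<close>, of v u] by blast
    define h where "h = min d1 d2 / 2"
    have h: "0 < h" "h < d1" "h < d2" using d1 d2 by (auto simp: h_def)
    define X where "X = f (x + h *\<^sub>R u + h *\<^sub>R v) - f (x + h *\<^sub>R u) - f (x + h *\<^sub>R v) + f x"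
    have eq: "f (x + h *\<^sub>R v + h *\<^sub>R u) - f (x + h *\<^sub>R v) - f (x + h *\<^sub>R u) + f x = X"
      by (simp add: X_def algebra_simps)
    note 2[OF h(1,3), unfolded eq] 1[OF h(1,2), folded X_def]
    from norm_triangle_le_diff[OF add_mono[OF this]]
    have "norm ((h * h) *\<^sub>R a) \<le> h * h * e + h * h * e" by (simp add: a_def algebra_simps)
    then have "(h * h) * norm a \<le> (h * h) * (2 * e)" by (simp add: algebra_simps)
    then show ?thesis using h by (metis mult_le_cancel_left_pos mult_pos_pos)
  qed
  from this[of "norm a / 4"] have "norm a \<le> 0" by (cases "a = 0") auto
  then show ?thesis by (simp add: a_def)
qed

section \<open>Ordinary differential equations\<close>

text \<open>
  The weight \<open>t ^ n\<close> admits equations for \<open>f\<close> with a first-order pole \<open>- n f / t\<close> at \<open>0\<close>; in that case no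
  initial value of \<open>f\<close> is prescribed.
\<close>

lemma singular_gronwall:
  fixes f :: "real \<Rightarrow> 'a::real_normed_vector" and g :: "real \<Rightarrow> 'b::real_normed_vector"
  assumes "n > 0" "K \<ge> 0"
    and df: "\<And>t. t \<in> {0..T} \<Longrightarrow> ((\<lambda>t. t ^ n *\<^sub>R f t) has_vector_derivative t ^ n *\<^sub>R f' t) (at t within {0..T})"
    and dg: "\<And>t. t \<in> {0..T} \<Longrightarrow> (g has_vector_derivative g' t) (at t within {0..T})"
    and bf: "\<And>t. t \<in> {0..T} \<Longrightarrow> norm (f' t) \<le> K * (norm (f t) + norm (g t))"
    and bg: "\<And>t. t \<in> {0..T} \<Longrightarrow> norm (g' t) \<le> K * (norm (f t) + norm (g t))"
    and cf: "continuous_on {0..T} f" and "g 0 = 0"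
    and t: "0 < t" "t \<le> T"
  shows "f t = 0 \<and> g t = 0"
proof -
  define N where "N t = norm (f t) + norm (g t)" for t
  have cN: "continuous_on {0..T} N"
    unfolding N_def by (intro continuous_intros cf)
      (simp add: continuous_on_eq_continuous_within has_vector_derivative_continuous[OF dg])
  \<comment> \<open>Steps of this length satisfy \<open>d * K \<le> 1 / 4\<close>. If
    \<open>N\<close> has maximum \<open>m\<close> on such a step, then \<open>f\<close> and
    \<open>g\<close> are each bounded by \<open>m / 4\<close>, so
    \<open>m \<le> m / 2\<close>.\<close>
  define d where "d = 1 / (4 * K + 1)"
  have d: "d > 0" "d * K \<le> 1 / 4" using \<open>K \<ge> 0\<close> by (auto simp: d_def field_simps)
  have main: "N t = 0" if "0 < t" "t \<le> T" "t \<le> real k * d" for k t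
    using that
  proof (induction k arbitrary: t)
    case 0
    then show ?case by simp
  next
    case (Suc k)
    define t0 where "t0 = real k * d"
    define t1 where "t1 = min T (real (Suc k) * d)"
    show ?case
    proof (cases "t \<le> t0")
      case True
      then show ?thesis using Suc t0_def by auto
    next
      case False
      have t01: "0 \<le> t0" "t0 < t1" "t1 \<le> T" "t \<in> {t0..t1}" "t1 - t0 \<le> d"
        using False Suc.prems d by (auto simp: t0_def t1_def algebra_simps)
      \<comment> \<open>At the first step the weight alone makes the initial value vanish, whatever
        \<open>f 0\<close> is; at later steps the induction hypothesis supplies it.\<close>
      have "t0 ^ n *\<^sub>R f t0 = 0 \<and> g t0 = 0"
      proof (cases "t0 = 0")
        case True
        then show ?thesis using \<open>n > 0\<close> \<open>g 0 = 0\<close> by simp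
      next
        case False
        then have "N t0 = 0" using Suc.IH[of t0] t01 by (simp add: t0_def)
        then show ?thesis by (simp add: N_def add_nonneg_eq_0_iff)
      qed
      then have start: "t0 ^ n *\<^sub>R f t0 = 0" "g t0 = 0" by auto
      have c01: "continuous_on {t0..t1} N" using cN by (rule continuous_on_subset) (use t01 in auto)
      obtain s where s: "s \<in> {t0..t1}" "\<And>r. r \<in> {t0..t1} \<Longrightarrow> N r \<le> N s"
        using continuous_attains_sup[OF compact_Icc _ c01] t01 by force
      define m where "m = N s"
      have m: "m \<ge> 0" by (simp add: m_def N_def)
      \<comment> \<open>On the open interval \<open>r > 0\<close>, so the weight
        \<open>r ^ n\<close> can be cancelled; it dominates \<open>x ^ n\<close> for all earlier
        \<open>x\<close>. The end points follow by continuity.\<close>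
      have "N r \<le> m / 2" if r: "r \<in> {t0<..<t1}" for r
      proof -
        have sub: "{t0..r} \<subseteq> {0..T}" using r t01 by auto
        have "norm (r ^ n *\<^sub>R f r - t0 ^ n *\<^sub>R f t0) \<le> (r ^ n * (K * m)) * (r - t0)"
        proof (rule vector_derivative_bound)
          fix x assume x: "x \<in> {t0..r}"
          then show "((\<lambda>t. t ^ n *\<^sub>R f t) has_vector_derivative x ^ n *\<^sub>R f' x) (at x within {t0..r})"
            using df sub has_vector_derivative_within_subset by blast
          have "norm (f' x) \<le> K * m"
            using bf[of x] s(2)[of x] x sub r \<open>K \<ge> 0\<close>
            by (auto simp: m_def N_def intro: order.trans mult_left_mono)
          then show "norm (x ^ n *\<^sub>R f' x) \<le> r ^ n * (K * m)"
            using x t01 by (auto intro!: mult_mono power_mono)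
        qed (use r in auto)
        then have "r ^ n * norm (f r) \<le> r ^ n * ((K * m) * (r - t0))"
          using start r t01 by (simp add: mult.assoc)
        then have "norm (f r) \<le> (K * m) * (r - t0)"
          using r t01 by (simp add: mult_le_cancel_left_pos)
        moreover have "norm (g r - g t0) \<le> (K * m) * (r - t0)"
        proof (rule vector_derivative_bound)
          fix x assume x: "x \<in> {t0..r}"
          then show "(g has_vector_derivative g' x) (at x within {t0..r})"
            using dg sub has_vector_derivative_within_subset by blast
          show "norm (g' x) \<le> K * m"
            using bg[of x] s(2)[of x] x sub r \<open>K \<ge> 0\<close>
            by (auto simp: m_def N_def intro: order.trans mult_left_mono)
        qed (use r in auto)
        moreover have "(K * m) * (r - t0) \<le> (K * m) * d"
          using r t01 m \<open>K \<ge> 0\<close> by (intro mult_left_mono) auto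
        moreover have "(K * m) * d \<le> m / 4"
          using mult_left_mono[OF d(2) m] by (simp add: algebra_simps)
        ultimately show ?thesis using start by (simp add: N_def)
      qed
      then have "N s \<le> m / 2"
        using continuous_le_on_closure[where S="{t0<..<t1}" and f=N and x=s and a="m / 2"] c01 s t01
        by (simp add: closure_greaterThanLessThan)
      then have "m \<le> 0" by (simp add: m_def)
      then have "N t \<le> 0" using s(2)[OF t01(4)] by (simp add: m_def)
      then show ?thesis by (simp add: N_def add_nonneg_nonneg order.antisym)
    qed
  qed
  obtain k where "t \<le> real k * d" using reals_Archimedean3[OF d(1)] less_imp_le by blast
  from main[OF t this] show ?thesis by (simp add: N_def add_nonneg_eq_0_iff)
qed

text \<open>The regular case is the singular estimate with vanishing first component. Running away
  from \<open>t0\<close> with sign \<open>\<sigma>\<close> treats earlier and later times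
  alike.\<close>

lemma gronwall_zero:
  fixes g :: "real \<Rightarrow> 'a::real_normed_vector"
  assumes dg: "\<And>t. t \<in> {a..b} \<Longrightarrow> (g has_vector_derivative g' t) (at t within {a..b})"
    and bg: "\<And>t. t \<in> {a..b} \<Longrightarrow> norm (g' t) \<le> K * norm (g t)"
    and "K \<ge> 0" "t0 \<in> {a..b}" "g t0 = 0" "t \<in> {a..b}"
  shows "g t = 0"
proof (cases "t = t0")
  case False
  define \<sigma> where "\<sigma> = sgn (t - t0)"
  define T where "T = \<bar>t - t0\<bar>"
  have \<sigma>: "\<bar>\<sigma>\<bar> = 1" "t0 + \<sigma> * T = t" "T > 0"
    using False by (auto simp: \<sigma>_def T_def sgn_if)
  have mem: "t0 + \<sigma> * r \<in> {a..b}" if "r \<in> {0..T}" for r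
    using that assms(4,6) False by (auto simp: \<sigma>_def T_def sgn_if split: if_splits)
  have dc: "((\<lambda>r. g (t0 + \<sigma> * r)) has_vector_derivative \<sigma> *\<^sub>R g' (t0 + \<sigma> * r)) (at r within {0..T})"
    if "r \<in> {0..T}" for r
  proof -
    have "((\<lambda>r. t0 + \<sigma> * r) has_vector_derivative \<sigma>) (at r within {0..T})"
      by (auto intro!: derivative_eq_intros simp: has_real_derivative_iff_has_vector_derivative[symmetric])
    moreover have "(g has_vector_derivative g' (t0 + \<sigma> * r)) (at (t0 + \<sigma> * r) within (\<lambda>r. t0 + \<sigma> * r) ` {0..T})"
      using dg[OF mem[OF that]] by (rule has_vector_derivative_within_subset) (use mem in auto)
    ultimately show ?thesis using vector_diff_chain_within by (force simp: o_def)
  qed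
  have "(0::'a) = 0 \<and> g (t0 + \<sigma> * T) = 0"
    by (rule singular_gronwall[where n=1 and K=K and T=T and f="\<lambda>_. 0" and f'="\<lambda>_. 0" and
          g'="\<lambda>r. \<sigma> *\<^sub>R g' (t0 + \<sigma> * r)", OF _ _ _ dc])
      (use \<sigma> assms(3,5) bg mem in auto)
  then show ?thesis using \<sigma> by simp
qed (use assms in simp)

lemma smooth_on_lipschitz:
  fixes F :: "'a::euclidean_space \<Rightarrow> 'b::real_normed_vector"
  assumes "open S" "smooth_on S F" "x \<in> S"
  obtains r K where "r > 0" "K \<ge> 0" "cball x r \<subseteq> S"
    "\<And>y z. y \<in> cball x r \<Longrightarrow> z \<in> cball x r \<Longrightarrow> norm (F y - F z) \<le> K * norm (y - z)"
proof -
  obtain r where r: "r > 0" "cball x r \<subseteq> S" using assms(1,3) open_contains_cball by blast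
  \<comment> \<open>\<open>fd F\<close> is known to be continuous only in each fixed direction;
    \<open>B\<close> is continuous for this reason and still dominates the operator norm.\<close>
  define B where "B y = (\<Sum>b\<in>Basis. norm (fd F y b))" for y
  have "continuous_on (cball x r) B"
    unfolding B_def using r smooth_on_continuous_on[OF smooth_on_fd[OF assms(2)]]
    by (intro continuous_intros) (auto intro: continuous_on_subset)
  then obtain s where s: "s \<in> cball x r" "\<And>y. y \<in> cball x r \<Longrightarrow> B y \<le> B s"
    using continuous_attains_sup[OF compact_cball, of x r B] r(1) by force
  have on: "onorm (fd F y) \<le> B s" if "y \<in> cball x r" for y
  proof (rule onorm_le)
    fix v
    have lin: "linear (fd F y)" using linear_fd_smooth[OF assms(2)] that r by blast
    have "norm (fd F y v) \<le> (\<Sum>b\<in>Basis. norm ((v \<bullet> b) *\<^sub>R fd F y b))"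
      using linear_sum_Basis[OF lin, of v] norm_sum by metis
    also have "\<dots> \<le> (\<Sum>b\<in>Basis. norm v * norm (fd F y b))"
      by (intro sum_mono) (auto intro!: mult_right_mono Basis_le_norm)
    also have "\<dots> = B y * norm v" by (simp add: B_def sum_distrib_left mult.commute)
    also have "\<dots> \<le> B s * norm v" using s(2)[OF that] by (rule mult_right_mono) simp
    finally show "norm (fd F y v) \<le> B s * norm v" .
  qed
  show ?thesis
  proof (rule that[OF r(1) _ r(2)])
    show "B s \<ge> 0" unfolding B_def by (intro sum_nonneg) simp
    show "norm (F y - F z) \<le> B s * norm (y - z)" if "y \<in> cball x r" "z \<in> cball x r" for y z
      by (rule differentiable_bound[OF convex_cball _ on that])
        (use r in \<open>auto intro!: has_derivative_at_withinI smooth_on_has_derivative[OF assms(2)]\<close>)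
  qed
qed

lemma ode_locally_unique:
  fixes F :: "'a::euclidean_space \<Rightarrow> 'a"
  assumes "open S" "smooth_on S F" "open J" "t0 \<in> J"
    and z: "\<And>t. t \<in> J \<Longrightarrow> (z has_vector_derivative F (z t)) (at t)"
    and w: "\<And>t. t \<in> J \<Longrightarrow> (w has_vector_derivative F (w t)) (at t)"
    and "z t0 = w t0" "z t0 \<in> S"
  obtains d where "d > 0" "\<And>t. \<bar>t - t0\<bar> < d \<Longrightarrow> z t = w t"
proof -
  obtain r K where r: "r > 0" "K \<ge> 0"
    and lip: "\<And>y x. y \<in> cball (z t0) r \<Longrightarrow> x \<in> cball (z t0) r \<Longrightarrow> norm (F y - F x) \<le> K * norm (y - x)"
    using smooth_on_lipschitz[OF assms(1,2,8)] by metis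
  have "isCont z t0" "isCont w t0"
    using z w \<open>t0 \<in> J\<close> has_vector_derivative_continuous by blast+
  then have "\<forall>\<^sub>F t in at t0. z t \<in> ball (z t0) r" "\<forall>\<^sub>F t in at t0. w t \<in> ball (z t0) r"
    "\<forall>\<^sub>F t in at t0. t \<in> J"
    using r \<open>z t0 = w t0\<close> assms(3,4)
    by (auto simp: isCont_def tendsto_iff dist_commute eventually_at_in_open')
  then have "\<forall>\<^sub>F t in at t0. t \<in> J \<and> z t \<in> cball (z t0) r \<and> w t \<in> cball (z t0) r"
    by eventually_elim auto
  then obtain d where d: "d > 0" "\<And>t. t \<noteq> t0 \<Longrightarrow> \<bar>t - t0\<bar> < d \<Longrightarrow>
      t \<in> J \<and> z t \<in> cball (z t0) r \<and> w t \<in> cball (z t0) r"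
    by (auto simp: eventually_at dist_real_def)
  then have d': "t \<in> J \<and> z t \<in> cball (z t0) r \<and> w t \<in> cball (z t0) r" if "\<bar>t - t0\<bar> < d" for t
    using that r assms(4,7) by (cases "t = t0") auto
  have "z t - w t = 0" if t: "\<bar>t - t0\<bar> < d" for t
  proof (rule gronwall_zero[where a="t0 - \<bar>t - t0\<bar>" and b="t0 + \<bar>t - t0\<bar>" and K=K and ?t0.0=t0
        and g="\<lambda>t. z t - w t" and g'="\<lambda>t. F (z t) - F (w t)"])
    fix s assume s: "s \<in> {t0 - \<bar>t - t0\<bar>..t0 + \<bar>t - t0\<bar>}"
    then have "\<bar>s - t0\<bar> < d" using t by auto
    note s' = d'[OF this]
    show "((\<lambda>t. z t - w t) has_vector_derivative F (z s) - F (w s))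
        (at s within {t0 - \<bar>t - t0\<bar>..t0 + \<bar>t - t0\<bar>})"
      by (rule has_vector_derivative_at_within, rule has_vector_derivative_diff[OF z w]) (use s' in auto)
    show "norm (F (z s) - F (w s)) \<le> K * norm (z s - w s)"
      using s' by (intro lip) auto
  qed (use r assms(7) in \<open>auto simp: abs_if\<close>)
  then show ?thesis using that d(1) by auto
qed

text \<open>Integrating an exponential gains the factor \<open>1 / l\<close>. A large rate
  \<open>l\<close> thus turns the integral operator of a linear equation into a contraction for the
  norm weighted by that exponential.\<close>

lemma exponential_growth_bound:
  fixes F :: "real \<Rightarrow> 'a::real_normed_vector"
  assumes dF: "\<And>s. s \<in> {a..b} \<Longrightarrow> (F has_vector_derivative F' s) (at s within {a..b})"
    and bF: "\<And>s. s \<in> {a..b} \<Longrightarrow> norm (F' s) \<le> C * exp (l * \<bar>s - t0\<bar>)"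
    and "l > 0" "C \<ge> 0" "t0 \<in> {a..b}" "t \<in> {a..b}" "F t0 = 0"
  shows "norm (F t) \<le> C / l * exp (l * \<bar>t - t0\<bar>)"
proof -
  have der: "(F has_vector_derivative F' s) (at s)" if "a < s" "s < b" for s
    using dF[of s] that by (simp add: at_within_Icc_at)
  have cF: "continuous_on {a..b} F"
    by (simp add: continuous_on_eq_continuous_within has_vector_derivative_continuous[OF dF])
  consider "t = t0" | "t0 < t" | "t < t0" by linarith
  then show ?thesis
  proof cases
    case 1
    then show ?thesis using assms by simp
  next
    case 2
    have "norm (F t - F t0) \<le> C / l * exp (l * (t - t0)) - C / l * exp (l * (t0 - t0))"
    proof (rule differentiable_bound_general[OF 2])
      show "continuous_on {t0..t} F" using cF by (rule continuous_on_subset) (use assms in auto)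
      show "((\<lambda>s. C / l * exp (l * (s - t0))) has_vector_derivative C * exp (l * (s - t0))) (at s)" for s
        using \<open>l > 0\<close> by (auto intro!: derivative_eq_intros simp flip: has_real_derivative_iff_has_vector_derivative)
      show "norm (F' s) \<le> C * exp (l * (s - t0))" if "t0 < s" "s < t" for s
        using bF[of s] that assms by auto
    qed (use der assms in \<open>auto intro!: continuous_intros\<close>)
    then have "norm (F t) \<le> C / l * exp (l * (t - t0)) - C / l" using assms by simp
    also have "\<dots> \<le> C / l * exp (l * \<bar>t - t0\<bar>)" using 2 assms by simp
    finally show ?thesis .
  next
    case 3
    have "norm (F t0 - F t) \<le> - (C / l * exp (l * (t0 - t0))) - - (C / l * exp (l * (t0 - t)))"
    proof (rule differentiable_bound_general[OF 3])
      show "continuous_on {t..t0} F" using cF by (rule continuous_on_subset) (use assms in auto)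
      show "((\<lambda>s. - (C / l * exp (l * (t0 - s)))) has_vector_derivative C * exp (l * (t0 - s))) (at s)" for s
        using \<open>l > 0\<close> by (auto intro!: derivative_eq_intros simp flip: has_real_derivative_iff_has_vector_derivative)
      show "norm (F' s) \<le> C * exp (l * (t0 - s))" if "t < s" "s < t0" for s
        using bF[of s] that assms by auto
    qed (use der assms in \<open>auto intro!: continuous_intros\<close>)
    then have "norm (F t) \<le> C / l * exp (l * (t0 - t)) - C / l" using assms by simp
    also have "\<dots> \<le> C / l * exp (l * \<bar>t - t0\<bar>)" using 3 assms by simp
    finally show ?thesis .
  qed
qed

text \<open>Picard iteration in a weighted supremum norm. The weight makes the integral operator
  contract on the whole interval at once, so no short solutions have to be glued.\<close>

lemma linear_ode_exists:
  fixes A :: "real \<Rightarrow> 'a::euclidean_space \<Rightarrow>\<^sub>L 'a"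
  assumes A: "continuous_on {a..b} A" and t0: "t0 \<in> {a..b}"
  obtains V where "V t0 = v"
    "\<And>t. t \<in> {a..b} \<Longrightarrow> (V has_vector_derivative A t (V t)) (at t within {a..b})"
proof -
  have ab: "a \<le> b" using t0 by simp
  have "bounded (A ` {a..b})"
    by (intro compact_imp_bounded compact_continuous_image A compact_Icc)
  then obtain K0 where K0: "\<And>t. t \<in> {a..b} \<Longrightarrow> norm (A t) \<le> K0"
    unfolding bounded_iff by blast
  \<comment> \<open>The lower bound 1 keeps the rate \<open>l\<close> positive even if the
    coefficient vanishes; \<open>l = 2 * K\<close> then yields the contraction factor 1/2.\<close>
  define K where "K = max K0 1"
  have K: "K > 0" "\<And>t. t \<in> {a..b} \<Longrightarrow> norm (A t) \<le> K" using K0 by (auto simp: K_def max.coboundedI1)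
  define l where "l = 2 * K"
  define w where "w t = exp (l * \<bar>t - t0\<bar>)" for t
  have w: "w t > 0" "w t0 = 1" "continuous_on S w" for t S
    unfolding w_def by (auto intro!: continuous_intros)
  define I where "I g t = integral {a..t} g - integral {a..t0} g" for g :: "real \<Rightarrow> 'a" and t
  have I: "(I g has_vector_derivative g t) (at t within {a..b})" if "continuous_on {a..b} g" "t \<in> {a..b}" for g t
    unfolding I_def using integral_has_vector_derivative[OF that] by (auto intro!: derivative_eq_intros)
  have I0: "I g t0 = 0" for g by (simp add: I_def)
  \<comment> \<open>Clamping extends functions on the interval to bounded continuous functions on
    the line, which form a complete metric space.\<close>
  define c where "c t = max a (min b t)" for t
  have c: "c t \<in> {a..b}" "t \<in> {a..b} \<Longrightarrow> c t = t" "continuous_on S c" for t S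
    unfolding c_def using ab by (auto intro!: continuous_intros)
  \<comment> \<open>The unknown \<open>\<phi>\<close> is the solution divided by the weight, so its
    ordinary supremum distance is the weighted distance of the solutions.\<close>
  define g where "g \<phi> s = w s *\<^sub>R A s (apply_bcontfun \<phi> s)" for \<phi> s
  have g: "continuous_on {a..b} (g \<phi>)" for \<phi>
    unfolding g_def by (intro continuous_intros A w) auto
  define \<Psi> where "\<Psi> \<phi> t = (1 / w t) *\<^sub>R (v + I (g \<phi>) t)" for \<phi> t
  have cI: "continuous_on {a..b} (I (g \<phi>))" for \<phi>
    by (simp add: continuous_on_eq_continuous_within has_vector_derivative_continuous[OF I[OF g]])
  have c\<Psi>: "continuous_on {a..b} (\<Psi> \<phi>)" for \<phi>
    unfolding \<Psi>_def using w(1) by (intro continuous_intros cI w) (auto simp: less_imp_neq[symmetric])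
  have "(\<lambda>t. \<Psi> \<phi> (c t)) \<in> bcontfun" for \<phi>
  proof -
    have "bounded (\<Psi> \<phi> ` {a..b})"
      using compact_continuous_image[OF c\<Psi> compact_Icc] compact_imp_bounded by blast
    then obtain B where "\<And>t. t \<in> {a..b} \<Longrightarrow> norm (\<Psi> \<phi> t) \<le> B" unfolding bounded_iff by blast
    then show ?thesis
      using c by (intro bcontfun_normI[of _ B]) (auto intro: continuous_on_compose2[OF c\<Psi>])
  qed
  then have app: "apply_bcontfun (Bcontfun (\<lambda>t. \<Psi> \<phi> (c t))) t = \<Psi> \<phi> (c t)" for \<phi> t
    by (simp add: Bcontfun_inverse)
  have "dist (Bcontfun (\<lambda>t. \<Psi> \<phi> (c t))) (Bcontfun (\<lambda>t. \<Psi> \<theta> (c t))) \<le> (1 / 2) * dist \<phi> \<theta>" for \<phi> \<theta>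
  proof (rule dist_bound)
    fix t
    have t: "c t \<in> {a..b}" by (rule c)
    have "norm (I (g \<phi>) (c t) - I (g \<theta>) (c t)) \<le> (K * dist \<phi> \<theta>) / l * exp (l * \<bar>c t - t0\<bar>)"
    proof (rule exponential_growth_bound[where F="\<lambda>t. I (g \<phi>) t - I (g \<theta>) t" and F'="\<lambda>t. g \<phi> t - g \<theta> t"])
      fix s assume s: "s \<in> {a..b}"
      show "((\<lambda>t. I (g \<phi>) t - I (g \<theta>) t) has_vector_derivative g \<phi> s - g \<theta> s) (at s within {a..b})"
        by (intro has_vector_derivative_diff I g s)
      have "norm (g \<phi> s - g \<theta> s) = w s * norm (A s (\<phi> s - \<theta> s))"
        using w(1)[of s] by (simp add: g_def blinfun.diff_right scaleR_diff_right[symmetric] less_imp_le)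
      also have "norm (A s (\<phi> s - \<theta> s)) \<le> K * dist \<phi> \<theta>"
        using K(2)[OF s] norm_blinfun[of "A s" "\<phi> s - \<theta> s"] dist_bounded[of \<phi> s \<theta>]
        by (smt (verit) dist_norm mult_mono norm_ge_zero)
      finally show "norm (g \<phi> s - g \<theta> s) \<le> K * dist \<phi> \<theta> * exp (l * \<bar>s - t0\<bar>)"
        using w(1)[of s] by (simp add: w_def mult.commute)
    qed (use K t0 t I0 in \<open>auto simp: l_def\<close>)
    then have "norm (I (g \<phi>) (c t) - I (g \<theta>) (c t)) \<le> (1 / 2) * dist \<phi> \<theta> * w (c t)"
      using K by (simp add: l_def w_def)
    then show "dist (apply_bcontfun (Bcontfun (\<lambda>t. \<Psi> \<phi> (c t))) t) (apply_bcontfun (Bcontfun (\<lambda>t. \<Psi> \<theta> (c t))) t)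
        \<le> (1 / 2) * dist \<phi> \<theta>"
      unfolding app using w(1)[of "c t"]
      by (simp add: \<Psi>_def dist_norm divide_le_eq less_imp_le flip: scaleR_diff_right)
  qed
  then have "\<exists>!\<phi>. Bcontfun (\<lambda>t. \<Psi> \<phi> (c t)) = \<phi>"
    by (intro banach_fix_type[of "1 / 2"]) auto
  then obtain \<phi> where \<phi>: "Bcontfun (\<lambda>t. \<Psi> \<phi> (c t)) = \<phi>" by blast
  have fix1: "w t *\<^sub>R apply_bcontfun \<phi> t = v + I (g \<phi>) t" if "t \<in> {a..b}" for t
    using app[of \<phi> t, unfolded \<phi>] w(1)[of t] that by (simp add: c \<Psi>_def)
  show ?thesis
  proof (rule that)
    show "v + I (g \<phi>) t0 = v" by (simp add: I0)
    fix t assume t: "t \<in> {a..b}"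
    have "((\<lambda>t. v + I (g \<phi>) t) has_vector_derivative g \<phi> t) (at t within {a..b})"
      using I[OF g t] by (auto intro!: derivative_eq_intros)
    moreover have "g \<phi> t = A t (v + I (g \<phi>) t)"
      using fix1[OF t] by (simp add: g_def flip: blinfun.scaleR_right)
    ultimately show "((\<lambda>t. v + I (g \<phi>) t) has_vector_derivative A t (v + I (g \<phi>) t)) (at t within {a..b})"
      by simp
  qed
qed

text \<open>Bootstrapping: regularity of \<open>V\<close> of order \<open>k\<close> passes through
  the right-hand side to the derivative of \<open>V\<close>.\<close>

lemma smooth_on_linear_ode_solution:
  fixes A :: "real \<Rightarrow> 'a::real_normed_vector \<Rightarrow>\<^sub>L 'a"
  assumes "open S" "smooth_on S A"
    and V: "\<And>t. t \<in> S \<Longrightarrow> (V has_vector_derivative A t (V t)) (at t)"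
  shows "smooth_on S V"
  unfolding smooth_on_def
proof
  fix k
  show "Ck_on k V S"
  proof (induction k)
    case 0
    then show ?case
      by (auto intro!: continuous_at_imp_continuous_on has_vector_derivative_continuous[OF V])
  next
    case (Suc k)
    have d: "(V has_derivative (\<lambda>h. h *\<^sub>R A t (V t))) (at t)" if "t \<in> S" for t
      using V[OF that] by (simp add: has_vector_derivative_def)
    have "Ck_on k (\<lambda>t. fd V t h) S" for h
    proof (rule Ck_on_cong[OF \<open>open S\<close>])
      show "Ck_on k (\<lambda>t. h *\<^sub>R A t (V t)) S"
        using assms(2) Suc by (intro Ck_on_bounded_linear_comp[OF bounded_linear_scaleR_right]
            Ck_on_bilinear[OF bounded_bilinear_blinfun_apply] \<open>open S\<close>) (auto simp: smooth_on_def)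
    qed (simp add: fd_eq[OF d])
    then show ?case using d by (auto simp: differentiable_def)
  qed
qed

section \<open>Parametrized open sets of a manifold\<close>

lemma fd_fd_linear:
  fixes f :: "'a::euclidean_space \<Rightarrow> 'b::real_normed_vector"
  assumes "open S" "smooth_on S f" "x \<in> S"
  shows "fd (\<lambda>y. fd f y w) x v = (\<Sum>b\<in>Basis. (w \<bullet> b) *\<^sub>R fd (\<lambda>y. fd f y b) x v)"
proof -
  have "((\<lambda>y. \<Sum>b\<in>Basis. (w \<bullet> b) *\<^sub>R fd f y b) has_derivative
      (\<lambda>v. \<Sum>b\<in>Basis. (w \<bullet> b) *\<^sub>R fd (\<lambda>y. fd f y b) x v)) (at x)"
    by (intro has_derivative_sum has_derivative_scaleR_right
        smooth_on_has_derivative[OF smooth_on_fd[OF assms(2)] assms(3)])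
  then have "((\<lambda>y. fd f y w) has_derivative
      (\<lambda>v. \<Sum>b\<in>Basis. (w \<bullet> b) *\<^sub>R fd (\<lambda>y. fd f y b) x v)) (at x)"
    by (rule has_derivative_transform_within_open[OF _ assms(1,3)])
      (rule linear_sum_Basis[OF linear_fd_smooth[OF assms(2)], symmetric])
  from fd_eq[OF this] show ?thesis by simp
qed

text \<open>Product rule for a derivative applied to a varying vector. Its first term is where
  second derivatives of coordinate changes enter the formulas for vector fields.\<close>

lemma fd_fd_joint:
  fixes f :: "'a::euclidean_space \<Rightarrow> 'b::real_normed_vector"
  assumes "open S" "smooth_on S f" "smooth_on S h" "x \<in> S"
  shows "fd (\<lambda>x. fd f x (h x)) x v = fd (\<lambda>y. fd f y (h x)) x v + fd f x (fd h x v)"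
proof -
  have e: "fd f y w = (\<Sum>b\<in>Basis. (w \<bullet> b) *\<^sub>R fd f y b)" if "y \<in> S" for y w
    using linear_sum_Basis[OF linear_fd_smooth[OF assms(2) that], of w] .
  have "((\<lambda>y. \<Sum>b\<in>Basis. (h y \<bullet> b) *\<^sub>R fd f y b) has_derivative
      (\<lambda>v. \<Sum>b\<in>Basis. (h x \<bullet> b) *\<^sub>R fd (\<lambda>y. fd f y b) x v + (fd h x v \<bullet> b) *\<^sub>R fd f x b)) (at x)"
    by (intro has_derivative_sum has_derivative_scaleR has_derivative_inner_left
        smooth_on_has_derivative[OF assms(3,4)] smooth_on_has_derivative[OF smooth_on_fd[OF assms(2)] assms(4)])
  from has_derivative_transform_within_open[OF this assms(1,4), of "\<lambda>y. fd f y (h y)"]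
  have "((\<lambda>y. fd f y (h y)) has_derivative
      (\<lambda>v. \<Sum>b\<in>Basis. (h x \<bullet> b) *\<^sub>R fd (\<lambda>y. fd f y b) x v + (fd h x v \<bullet> b) *\<^sub>R fd f x b)) (at x)"
    using e by metis
  from fd_eq[OF this] show ?thesis
    unfolding fd_fd_linear[OF assms(1,2,4), of "h x"] e[OF assms(4), of "fd h x v"] by (simp add: sum.distrib)
qed

section \<open>Charts and the axioms of the connection\<close>

locale acs_space =
  fixes M :: "('m::{t2_space,second_countable_topology}, 'c, 'e::euclidean_space) acs"
  assumes acs: "affine_connection_space M"
begin

lemma manifold: "smooth_manifold M"
  using acs unfolding affine_connection_space_def by (elim conjE)

lemma chart_exists: "\<exists>i. i \<in> charts_at M x"
  using manifold unfolding smooth_manifold_def charts_at_def by blast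

lemma charts_atD: "i \<in> charts_at M x \<Longrightarrow> i \<in> charts M" "i \<in> charts_at M x \<Longrightarrow> x \<in> cdom M i"
  by (auto simp: charts_at_def)

context
  fixes i assumes i: "i \<in> charts M"
begin

lemma open_cdom: "open (cdom M i)"
  using manifold i unfolding smooth_manifold_def by blast

lemma open_cmap_cdom: "open (cmap M i ` cdom M i)"
  using manifold i unfolding smooth_manifold_def by blast

lemma chart_homeomorphism: "homeomorphism (cdom M i) (cmap M i ` cdom M i) (cmap M i) (cinv M i)"
  using manifold i unfolding smooth_manifold_def by blast

lemma cinv_cmap: "x \<in> cdom M i \<Longrightarrow> cinv M i (cmap M i x) = x"
  using chart_homeomorphism by (simp add: homeomorphism_def)

lemma continuous_on_cmap: "continuous_on (cdom M i) (cmap M i)"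
  using chart_homeomorphism by (simp add: homeomorphism_def)

lemma continuous_on_cinv: "continuous_on (cmap M i ` cdom M i) (cinv M i)"
  using chart_homeomorphism by (simp add: homeomorphism_def)

lemma open_cmap_image:
  assumes "open S"
  shows "open (cmap M i ` (S \<inter> cdom M i))"
proof -
  have "cmap M i ` (S \<inter> cdom M i) = (cmap M i ` cdom M i) \<inter> cinv M i -` S"
    using cinv_cmap by auto
  then show ?thesis
    using continuous_open_preimage[OF continuous_on_cinv open_cmap_cdom assms]
    by simp
qed

lemma open_chart_preimage:
  assumes "open J" "continuous_on J \<gamma>"
  shows "open {s \<in> J. \<gamma> s \<in> cdom M i}"
proof -
  have "{s \<in> J. \<gamma> s \<in> cdom M i} = J \<inter> \<gamma> -` cdom M i" by auto
  then show ?thesis using continuous_open_preimage[OF assms(2,1) open_cdom] by simp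
qed

lemma smooth_on_transition:
  "j \<in> charts M \<Longrightarrow> smooth_on (cmap M i ` (cdom M i \<inter> cdom M j)) (cmap M j \<circ> cinv M i)"
  using manifold i unfolding smooth_manifold_def by blast

end

lemmas connection_axioms = acs[unfolded affine_connection_space_def, THEN conjunct2]

lemma nabla_smooth:
  "open U \<Longrightarrow> smooth_vfield M U X \<Longrightarrow> smooth_vfield M U Y \<Longrightarrow> smooth_vfield M U (nabla M X Y)"
  using connection_axioms[THEN conjunct1] by blast

lemma nabla_local:
  "open U \<Longrightarrow> smooth_vfield M U X \<Longrightarrow> smooth_vfield M U Y \<Longrightarrow> (\<And>x. x \<in> U \<Longrightarrow> X' x = X x) \<Longrightarrow>
    (\<And>x. x \<in> U \<Longrightarrow> Y' x = Y x) \<Longrightarrow> x \<in> U \<Longrightarrow> nabla M X' Y' x = nabla M X Y x"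
  using connection_axioms[THEN conjunct2, THEN conjunct1] by blast

lemma nabla_add_left:
  "open U \<Longrightarrow> smooth_vfield M U X \<Longrightarrow> smooth_vfield M U Z \<Longrightarrow> smooth_vfield M U Y \<Longrightarrow> x \<in> U \<Longrightarrow>
    nabla M (\<lambda>x. tadd (X x) (Z x)) Y x = tadd (nabla M X Y x) (nabla M Z Y x)"
  using connection_axioms[THEN conjunct2, THEN conjunct2, THEN conjunct1] by blast

lemma nabla_scale_left:
  "open U \<Longrightarrow> smooth_from M U f \<Longrightarrow> smooth_vfield M U X \<Longrightarrow> smooth_vfield M U Y \<Longrightarrow> x \<in> U \<Longrightarrow>
    nabla M (\<lambda>x. tscale (f x) (X x)) Y x = tscale (f x) (nabla M X Y x)"
  using connection_axioms[THEN conjunct2, THEN conjunct2, THEN conjunct2, THEN conjunct1] by blast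

lemma nabla_add_right:
  "open U \<Longrightarrow> smooth_vfield M U X \<Longrightarrow> smooth_vfield M U Y \<Longrightarrow> smooth_vfield M U Z \<Longrightarrow> x \<in> U \<Longrightarrow>
    nabla M X (\<lambda>x. tadd (Y x) (Z x)) x = tadd (nabla M X Y x) (nabla M X Z x)"
  using connection_axioms[THEN conjunct2, THEN conjunct2, THEN conjunct2, THEN conjunct2, THEN conjunct1]
  by blast

lemma nabla_scale_right:
  "open U \<Longrightarrow> smooth_from M U f \<Longrightarrow> smooth_vfield M U X \<Longrightarrow> smooth_vfield M U Y \<Longrightarrow> x \<in> U \<Longrightarrow>
    i \<in> charts_at M x \<Longrightarrow> nabla M X (\<lambda>x. tscale (f x) (Y x)) x =
      tadd (tscale (dir_deriv M i x (X x) f) (Y x)) (tscale (f x) (nabla M X Y x))"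
  using connection_axioms[THEN conjunct2, THEN conjunct2, THEN conjunct2, THEN conjunct2, THEN conjunct2]
  by blast

end

text \<open>Both the inverse of a chart and normal coordinates are of this form, which allows to compute with the
  connection uniformly.\<close>

locale param = acs_space M
  for M :: "('m::{t2_space,second_countable_topology}, 'c, 'e::euclidean_space) acs" +
  fixes W :: "'e set" and \<phi> :: "'e \<Rightarrow> 'm" and \<psi> :: "'m \<Rightarrow> 'e"
  assumes open_W: "open W" and smooth_\<phi>: "smooth_into M W \<phi>"
    and open_range: "open (\<phi> ` W)" and smooth_\<psi>: "smooth_from M (\<phi> ` W) \<psi>"
    and \<psi>_\<phi>: "x \<in> W \<Longrightarrow> \<psi> (\<phi> x) = x"
begin

abbreviation Wc :: "'c \<Rightarrow> 'e set" where "Wc i \<equiv> {x \<in> W. \<phi> x \<in> cdom M i}"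
abbreviation Yc :: "'c \<Rightarrow> 'e set" where "Yc i \<equiv> cmap M i ` (\<phi> ` W \<inter> cdom M i)"

definition to_chart :: "'c \<Rightarrow> 'e \<Rightarrow> 'e" where "to_chart i x = cmap M i (\<phi> x)"
definition from_chart :: "'c \<Rightarrow> 'e \<Rightarrow> 'e" where "from_chart i y = \<psi> (cinv M i y)"

lemma \<phi>_\<psi>: "z \<in> \<phi> ` W \<Longrightarrow> \<phi> (\<psi> z) = z" "z \<in> \<phi> ` W \<Longrightarrow> \<psi> z \<in> W"
  using \<psi>_\<phi> by auto

lemma continuous_on_\<phi>: "continuous_on W \<phi>"
  using smooth_\<phi> by (simp add: smooth_into_def)

lemma open_Wc:
  assumes "i \<in> charts M" "open W'" "W' \<subseteq> W"
  shows "open {x \<in> W'. \<phi> x \<in> cdom M i}"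
  by (rule open_chart_preimage[OF assms(1,2) continuous_on_subset[OF continuous_on_\<phi> assms(3)]])

lemma smooth_on_to_chart: "i \<in> charts M \<Longrightarrow> smooth_on (Wc i) (to_chart i)"
  using smooth_\<phi> by (simp add: smooth_into_def to_chart_def[abs_def] o_def)

lemma smooth_on_from_chart: "i \<in> charts M \<Longrightarrow> smooth_on (Yc i) (from_chart i)"
  using smooth_\<psi> by (simp add: smooth_from_def from_chart_def[abs_def] o_def)

lemma from_chart_to_chart: "i \<in> charts M \<Longrightarrow> x \<in> Wc i \<Longrightarrow> from_chart i (to_chart i x) = x"
  by (simp add: from_chart_def to_chart_def cinv_cmap \<psi>_\<phi>)

lemma to_chart_in: "x \<in> Wc i \<Longrightarrow> to_chart i x \<in> Yc i"
  by (auto simp: to_chart_def)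

lemma to_chart_from_chart:
  "i \<in> charts M \<Longrightarrow> y \<in> Yc i \<Longrightarrow> to_chart j (from_chart i y) = cmap M j (cinv M i y)"
  by (auto simp: from_chart_def to_chart_def cinv_cmap \<psi>_\<phi>)

lemma open_Yc: "i \<in> charts M \<Longrightarrow> open (Yc i)"
  using open_cmap_image open_range by blast

lemma fd_from_to:
  assumes "i \<in> charts M" "x \<in> Wc i"
  shows "fd (from_chart i) (to_chart i x) (fd (to_chart i) x v) = v"
proof -
  have "fd (from_chart i) (to_chart i x) (fd (to_chart i) x v) = fd (\<lambda>x. from_chart i (to_chart i x)) x v"
    using fd_compose_smooth[OF smooth_on_to_chart[OF assms(1)] assms(2) smooth_on_from_chart[OF assms(1)]
        to_chart_in[OF assms(2)]] by simp
  also have "\<dots> = fd (\<lambda>x. x) x v"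
    using fd_cong[OF open_Wc[OF assms(1) open_W order_refl] assms(2), of "\<lambda>x. from_chart i (to_chart i x)" "\<lambda>x. x"]
      from_chart_to_chart[OF assms(1)] by simp
  finally show ?thesis by simp
qed

lemma fd_to_from:
  assumes "i \<in> charts M" "j \<in> charts M" "x \<in> Wc i" "x \<in> Wc j"
  shows "fd (to_chart j) x (fd (from_chart i) (to_chart i x) v) = fd (cmap M j \<circ> cinv M i) (to_chart i x) v"
proof -
  have "fd (\<lambda>y. to_chart j (from_chart i y)) (to_chart i x) v
      = fd (to_chart j) (from_chart i (to_chart i x)) (fd (from_chart i) (to_chart i x) v)"
    by (rule fd_compose_smooth[OF smooth_on_from_chart[OF assms(1)] to_chart_in[OF assms(3)] smooth_on_to_chart[OF assms(2)]])
      (use assms in \<open>simp add: from_chart_to_chart\<close>)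
  moreover have "fd (\<lambda>y. to_chart j (from_chart i y)) (to_chart i x) = fd (cmap M j \<circ> cinv M i) (to_chart i x)"
    using to_chart_from_chart[OF assms(1)] by (intro fd_cong[OF open_Yc[OF assms(1)] to_chart_in[OF assms(3)]]) simp
  ultimately show ?thesis using assms by (simp add: from_chart_to_chart)
qed

text \<open>The differential of \<open>\<phi>\<close> at \<open>x\<close>, an isomorphism from the
  model space onto the tangent space at \<open>\<phi> x\<close>.\<close>

definition push :: "'e \<Rightarrow> 'e \<Rightarrow> ('c, 'e) tvec" where
  "push x v = (\<lambda>i. if i \<in> charts_at M (\<phi> x) then fd (to_chart i) x v else 0)"

text \<open>Inverse of \<open>push\<close>, read off in one arbitrary chart;
  \<open>coords_in_chart\<close> shows that every chart gives the same result.\<close>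

definition coords :: "'e \<Rightarrow> ('c, 'e) tvec \<Rightarrow> 'e" where
  "coords x X = (let i = SOME i. i \<in> charts_at M (\<phi> x) in fd (from_chart i) (to_chart i x) (X i))"

lemma charts_at_Wc: "x \<in> W \<Longrightarrow> i \<in> charts_at M (\<phi> x) \<longleftrightarrow> i \<in> charts M \<and> x \<in> Wc i"
  by (simp add: charts_at_def)

lemma push_at: "i \<in> charts_at M (\<phi> x) \<Longrightarrow> push x v i = fd (to_chart i) x v"
  by (simp add: push_def)

lemma push_in_chart: "x \<in> W \<Longrightarrow> i \<in> charts M \<Longrightarrow> \<phi> x \<in> cdom M i \<Longrightarrow> push x v i = fd (to_chart i) x v"
  by (simp add: push_def charts_at_def)

lemma push_from_chart:
  assumes "x \<in> W" "i \<in> charts_at M (\<phi> x)" "X \<in> tangent_space M (\<phi> x)"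
  shows "push x (fd (from_chart i) (to_chart i x) (X i)) = X"
proof
  fix j
  have i: "i \<in> charts M" "x \<in> Wc i" using assms charts_at_Wc by auto
  show "push x (fd (from_chart i) (to_chart i x) (X i)) j = X j"
  proof (cases "j \<in> charts_at M (\<phi> x)")
    case True
    then have j: "j \<in> charts M" "x \<in> Wc j" using assms(1) charts_at_Wc by auto
    have "push x (fd (from_chart i) (to_chart i x) (X i)) j = fd (to_chart j) x (fd (from_chart i) (to_chart i x) (X i))"
      using True by (rule push_at)
    also have "\<dots> = fd (cmap M j \<circ> cinv M i) (to_chart i x) (X i)"
      by (rule fd_to_from[OF i(1) j(1) i(2) j(2)])
    also have "\<dots> = fd (cmap M j \<circ> cinv M i) (cmap M i (\<phi> x)) (X i)"
      by (rule arg_cong[OF to_chart_def])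
    finally have "push x (fd (from_chart i) (to_chart i x) (X i)) j = fd (cmap M j \<circ> cinv M i) (cmap M i (\<phi> x)) (X i)" .
    moreover have "X j = fd (cmap M j \<circ> cinv M i) (cmap M i (\<phi> x)) (X i)"
      using assms True unfolding tangent_space_def by blast
    ultimately show ?thesis by (rule trans[OF _ sym])
  next
    case False
    then show ?thesis using assms(3) by (simp add: push_def tangent_space_def)
  qed
qed

lemma coords_push: "x \<in> W \<Longrightarrow> coords x (push x v) = v"
proof -
  assume x: "x \<in> W"
  define i where "i = (SOME i. i \<in> charts_at M (\<phi> x))"
  have i: "i \<in> charts_at M (\<phi> x)" unfolding i_def using chart_exists someI_ex by metis
  then show "coords x (push x v) = v"
    using fd_from_to[of i x] charts_at_Wc[OF x] unfolding coords_def i_def[symmetric] Let_def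
    by (simp add: push_def)
qed

lemma push_coords: "x \<in> W \<Longrightarrow> X \<in> tangent_space M (\<phi> x) \<Longrightarrow> push x (coords x X) = X"
  unfolding coords_def Let_def using push_from_chart someI_ex[OF chart_exists] by metis

lemma coords_in_chart:
  "x \<in> W \<Longrightarrow> i \<in> charts_at M (\<phi> x) \<Longrightarrow> X \<in> tangent_space M (\<phi> x) \<Longrightarrow>
    coords x X = fd (from_chart i) (to_chart i x) (X i)"
  using coords_push push_from_chart by metis

lemma push_tangent: "x \<in> W \<Longrightarrow> push x v \<in> tangent_space M (\<phi> x)"
proof -
  assume x: "x \<in> W"
  have "push x v j = fd (cmap M j \<circ> cinv M i) (cmap M i (\<phi> x)) (push x v i)"
    if "i \<in> charts_at M (\<phi> x)" "j \<in> charts_at M (\<phi> x)" for i j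
  proof -
    have i: "i \<in> charts M" "x \<in> Wc i" "j \<in> charts M" "x \<in> Wc j" using that x charts_at_Wc by auto
    show ?thesis
      using fd_to_from[OF i(1,3,2,4), of "fd (to_chart i) x v"] fd_from_to[OF i(1,2), of v]
        push_at[OF that(1)] push_at[OF that(2)] to_chart_def[of i x] by metis
  qed
  moreover have "\<forall>i. i \<notin> charts_at M (\<phi> x) \<longrightarrow> push x v i = 0" by (simp add: push_def)
  ultimately show ?thesis unfolding tangent_space_def by blast
qed

lemma push_inject: "x \<in> W \<Longrightarrow> push x v = push x w \<longleftrightarrow> v = w"
  using coords_push by metis

lemma linear_to_chart: "x \<in> W \<Longrightarrow> i \<in> charts_at M (\<phi> x) \<Longrightarrow> linear (fd (to_chart i) x)"
  using linear_fd_smooth[OF smooth_on_to_chart] by (simp add: charts_at_def)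

lemma push_add: "x \<in> W \<Longrightarrow> push x (v + w) = tadd (push x v) (push x w)"
  by (auto simp: push_def tadd_def fun_eq_iff linear_add linear_to_chart)

lemma push_diff: "x \<in> W \<Longrightarrow> push x (v - w) = tdiff (push x v) (push x w)"
  by (auto simp: push_def tdiff_def fun_eq_iff linear_diff linear_to_chart)

lemma push_scale: "x \<in> W \<Longrightarrow> push x (a *\<^sub>R v) = tscale a (push x v)"
  by (auto simp: push_def tscale_def fun_eq_iff linear_cmul linear_to_chart)

lemma push_0: "x \<in> W \<Longrightarrow> push x 0 = tzero"
  by (auto simp: push_def tzero_def fun_eq_iff linear_0 linear_to_chart)

text \<open>\<open>smooth_from\<close> speaks of chart expressions only, so continuity on the
  manifold has to be assembled from the charts.\<close>

lemma continuous_on_\<psi>: "continuous_on (\<phi> ` W) \<psi>"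
proof -
  have "isCont \<psi> z" if z: "z \<in> \<phi> ` W" for z
  proof -
    obtain i where i: "i \<in> charts M" "z \<in> cdom M i" using chart_exists charts_atD by blast
    have "continuous_on (\<phi> ` W \<inter> cdom M i) (\<lambda>z. from_chart i (cmap M i z))"
      using continuous_on_cmap[OF i(1)]
      by (intro continuous_on_compose2[OF smooth_on_continuous_on[OF smooth_on_from_chart[OF i(1)]]])
        (auto intro: continuous_on_subset)
    then have "continuous_on (\<phi> ` W \<inter> cdom M i) \<psi>"
      by (rule continuous_on_eq) (simp add: from_chart_def cinv_cmap[OF i(1)])
    then show ?thesis
      using z i open_cdom open_range continuous_on_eq_continuous_at open_Int by blast
  qed
  then show ?thesis by (simp add: continuous_at_imp_continuous_on)
qed

lemma open_image:
  assumes "open W'" "W' \<subseteq> W"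
  shows "open (\<phi> ` W')"
proof -
  have "\<phi> ` W' = \<phi> ` W \<inter> \<psi> -` W'" using assms(2) \<psi>_\<phi> by force
  then show ?thesis using continuous_open_preimage[OF continuous_on_\<psi> open_range assms(1)] by simp
qed

lemma image_cinv_in:
  "i \<in> charts M \<Longrightarrow> W' \<subseteq> W \<Longrightarrow> y \<in> cmap M i ` (\<phi> ` W' \<inter> cdom M i) \<Longrightarrow>
    from_chart i y \<in> W' \<and> \<phi> (from_chart i y) \<in> cdom M i \<and> cinv M i y = \<phi> (from_chart i y)"
  by (auto simp: from_chart_def cinv_cmap subset_iff \<psi>_\<phi>)

definition represents :: "'e set \<Rightarrow> ('m, 'c, 'e) vfield \<Rightarrow> ('e \<Rightarrow> 'e) \<Rightarrow> bool" where
  "represents W' X f \<longleftrightarrow> open W' \<and> W' \<subseteq> W \<and> smooth_on W' f \<and> (\<forall>x\<in>W'. X (\<phi> x) = push x (f x))"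

lemma represents_cong:
  "represents W' X f \<Longrightarrow> (\<And>x. x \<in> W' \<Longrightarrow> f x = g x) \<Longrightarrow> represents W' X g"
  unfolding represents_def using smooth_on_cong by metis

lemma represents_in_chart:
  assumes "represents W' X f" "i \<in> charts M"
  shows "x \<in> W' \<Longrightarrow> \<phi> x \<in> cdom M i \<Longrightarrow> X (\<phi> x) i = fd (to_chart i) x (f x)"
    and "smooth_on {x \<in> W'. \<phi> x \<in> cdom M i} (\<lambda>x. fd (to_chart i) x (f x))"
    and "smooth_on (cmap M i ` (\<phi> ` W' \<inter> cdom M i)) (\<lambda>y. X (cinv M i y) i)"
proof -
  have W': "open W'" "W' \<subseteq> W" "smooth_on W' f" using assms(1) by (auto simp: represents_def)
  show 1: "X (\<phi> x) i = fd (to_chart i) x (f x)" if "x \<in> W'" "\<phi> x \<in> cdom M i" for x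
    using assms that by (auto simp: represents_def push_def charts_at_def)
  show 2: "smooth_on {x \<in> W'. \<phi> x \<in> cdom M i} (\<lambda>x. fd (to_chart i) x (f x))"
    by (rule smooth_on_fd_joint[OF open_Wc[OF assms(2) W'(1,2)]])
      (use W' smooth_on_to_chart[OF assms(2)] in \<open>auto elim!: smooth_on_subset\<close>)
  let ?Y = "cmap M i ` (\<phi> ` W' \<inter> cdom M i)"
  have "smooth_on ?Y (\<lambda>y. fd (to_chart i) (from_chart i y) (f (from_chart i y)))"
    by (rule smooth_on_compose[OF open_cmap_image[OF assms(2) open_image[OF W'(1,2)]] open_Wc[OF assms(2) W'(1,2)] _ 2])
      (use W' image_cinv_in[OF assms(2) W'(2)] smooth_on_from_chart[OF assms(2)] in \<open>auto elim!: smooth_on_subset\<close>)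
  then show "smooth_on ?Y (\<lambda>y. X (cinv M i y) i)"
    by (rule smooth_on_cong[OF open_cmap_image[OF assms(2) open_image[OF W'(1,2)]], rotated])
      (use 1 image_cinv_in[OF assms(2) W'(2)] in force)
qed

lemma represents_smooth_vfield: "represents W' X f \<Longrightarrow> smooth_vfield M (\<phi> ` W') X"
  unfolding smooth_vfield_def
  using represents_in_chart(3) push_tangent by (auto simp: represents_def subset_iff)

lemma smooth_vfield_represents:
  assumes "open W'" "W' \<subseteq> W" "smooth_vfield M (\<phi> ` W') X"
  shows "represents W' X (\<lambda>x. coords x (X (\<phi> x)))"
proof -
  have tan: "X (\<phi> x) \<in> tangent_space M (\<phi> x)" if "x \<in> W'" for x
    using that assms(3) by (auto simp: smooth_vfield_def)
  have "smooth_on W' (\<lambda>x. coords x (X (\<phi> x)))"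
  proof (rule smooth_on_local[OF assms(1)])
    fix x assume "x \<in> W'"
    obtain i where i: "i \<in> charts M" "\<phi> x \<in> cdom M i" using chart_exists charts_atD by blast
    let ?T = "{x \<in> W'. \<phi> x \<in> cdom M i}" and ?Y = "cmap M i ` (\<phi> ` W' \<inter> cdom M i)"
    have oT: "open ?T" by (rule open_Wc[OF i(1) assms(1,2)])
    have oY: "open ?Y" by (rule open_cmap_image[OF i(1) open_image[OF assms(1,2)]])
    have sm: "smooth_on ?Y (\<lambda>y. fd (from_chart i) y (X (cinv M i y) i))"
      by (rule smooth_on_fd_joint[OF oY smooth_on_subset[OF smooth_on_from_chart[OF i(1)]]])
        (use assms i in \<open>auto simp: smooth_vfield_def\<close>)
    have "smooth_on ?T (\<lambda>x. fd (from_chart i) (to_chart i x) (X (cinv M i (to_chart i x)) i))"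
      by (rule smooth_on_compose[OF oT oY smooth_on_subset[OF smooth_on_to_chart[OF i(1)]] sm])
        (use assms in \<open>auto simp: to_chart_def\<close>)
    then have "smooth_on ?T (\<lambda>x. coords x (X (\<phi> x)))"
      by (rule smooth_on_cong[OF oT, rotated])
        (use assms i tan in \<open>auto simp: coords_in_chart charts_at_def to_chart_def cinv_cmap subset_iff\<close>)
    then show "\<exists>T. open T \<and> x \<in> T \<and> smooth_on T (\<lambda>x. coords x (X (\<phi> x)))"
      using oT i \<open>x \<in> W'\<close> by blast
  qed
  then show ?thesis using assms tan push_coords by (auto simp: represents_def subset_iff)
qed

lemma smooth_from_compose_\<psi>:
  fixes a :: "'e \<Rightarrow> 'b::real_normed_vector"
  assumes "open W'" "W' \<subseteq> W" "smooth_on W' a"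
  shows "smooth_from M (\<phi> ` W') (\<lambda>z. a (\<psi> z))"
  unfolding smooth_from_def
proof
  fix i assume i: "i \<in> charts M"
  have "smooth_on (cmap M i ` (\<phi> ` W' \<inter> cdom M i)) (\<lambda>y. a (from_chart i y))"
    by (rule smooth_on_compose[OF open_cmap_image[OF i open_image[OF assms(1,2)]] assms(1)
          smooth_on_subset[OF smooth_on_from_chart[OF i]] assms(3)])
      (use assms(2) image_cinv_in[OF i assms(2)] in auto)
  then show "smooth_on (cmap M i ` (\<phi> ` W' \<inter> cdom M i)) ((\<lambda>z. a (\<psi> z)) \<circ> cinv M i)"
    by (simp add: from_chart_def o_def)
qed

text \<open>The second derivative of the coordinate change enters both directional derivatives and
  cancels by its symmetry, so the bracket keeps its flat form in every parametrization.\<close>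

lemma represents_lie_bracket:
  assumes X: "represents W' X f" and Y: "represents W' Y h"
  shows "represents W' (lie_bracket M X Y) (\<lambda>x. fd h x (f x) - fd f x (h x))"
proof -
  have W': "open W'" "W' \<subseteq> W" "smooth_on W' f" "smooth_on W' h"
    using X Y by (auto simp: represents_def)
  have *: "dir_deriv M i (\<phi> x) (X (\<phi> x)) (\<lambda>z. Y z i)
      = fd (\<lambda>y. fd (to_chart i) y (h x)) x (f x) + fd (to_chart i) x (fd h x (f x))"
    if X: "represents W' X f" and Y: "represents W' Y h" and x: "x \<in> W'" "i \<in> charts_at M (\<phi> x)" for X Y f h x i
  proof -
    have i: "i \<in> charts M" "\<phi> x \<in> cdom M i" using charts_atD[OF x(2)] by auto
    let ?T = "{x \<in> W'. \<phi> x \<in> cdom M i}"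
    have oT: "open ?T" and xT: "x \<in> ?T" using open_Wc[OF i(1) W'(1,2)] i x by auto
    have smt: "smooth_on ?T (to_chart i)" "smooth_on ?T h"
      using smooth_on_to_chart[OF i(1)] Y W'(2) by (auto elim!: smooth_on_subset simp: represents_def)
    have "dir_deriv M i (\<phi> x) (X (\<phi> x)) (\<lambda>z. Y z i) = fd (\<lambda>y. Y (cinv M i y) i) (to_chart i x) (fd (to_chart i) x (f x))"
      using represents_in_chart(1)[OF X i(1) x(1) i(2)] by (simp add: dir_deriv_def o_def to_chart_def)
    also have "\<dots> = fd (\<lambda>x. Y (cinv M i (to_chart i x)) i) x (f x)"
      by (rule fd_compose_smooth[OF smt(1) xT represents_in_chart(3)[OF Y i(1)], symmetric])
        (use x i in \<open>auto simp: to_chart_def\<close>)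
    also have "\<dots> = fd (\<lambda>x. fd (to_chart i) x (h x)) x (f x)"
      by (subst fd_cong[OF oT xT, where g="\<lambda>x. fd (to_chart i) x (h x)"])
        (use represents_in_chart(1)[OF Y i(1)] i in \<open>auto simp: to_chart_def cinv_cmap\<close>)
    also have "\<dots> = fd (\<lambda>y. fd (to_chart i) y (h x)) x (f x) + fd (to_chart i) x (fd h x (f x))"
      by (rule fd_fd_joint[OF oT smt xT])
    finally show ?thesis .
  qed
  have "lie_bracket M X Y (\<phi> x) i = push x (fd h x (f x) - fd f x (h x)) i" if x: "x \<in> W'" for x i
  proof (cases "i \<in> charts_at M (\<phi> x)")
    case True
    then have i: "i \<in> charts M" "\<phi> x \<in> cdom M i" using charts_atD by auto
    have "fd (\<lambda>y. fd (to_chart i) y (h x)) x (f x) = fd (\<lambda>y. fd (to_chart i) y (f x)) x (h x)"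
      by (rule fd_fd_commute[OF open_Wc[OF i(1) open_W order_refl] _ smooth_on_to_chart[OF i(1)]])
        (use x W' i in auto)
    then show ?thesis
      using True *[OF X Y x True] *[OF Y X x True] linear_diff[OF linear_to_chart[OF _ True]] x W'(2)
      by (auto simp: lie_bracket_def push_def)
  qed (simp add: lie_bracket_def push_def)
  then show ?thesis
    using W' by (auto simp: represents_def fun_eq_iff intro!: smooth_on_diff smooth_on_fd_joint)
qed

end

section \<open>The connection in a parametrization\<close>

text \<open>Extending values on basis pairs makes bilinearity automatic and places the result in a
  normed space, so that \<open>smooth_on\<close> and \<open>fd\<close> apply to the Christoffel
  symbols as a whole.\<close>

definition bilift :: "('e::euclidean_space \<Rightarrow> 'e \<Rightarrow> 'b::real_normed_vector) \<Rightarrow> 'e \<Rightarrow>\<^sub>L 'e \<Rightarrow>\<^sub>L 'b" where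
  "bilift g = (\<Sum>b\<in>Basis. blinfun_scaleR_left
     (\<Sum>c\<in>Basis. blinfun_scaleR_left (g b c) o\<^sub>L blinfun_inner_left c) o\<^sub>L blinfun_inner_left b)"

lemma bilift_apply: "bilift g u v = (\<Sum>b\<in>Basis. (u \<bullet> b) *\<^sub>R (\<Sum>c\<in>Basis. (v \<bullet> c) *\<^sub>R g b c))"
  by (simp add: bilift_def blinfun.sum_left blinfun.scaleR_left)

lemma smooth_on_bilift:
  assumes "open S" "\<And>b c. b \<in> Basis \<Longrightarrow> c \<in> Basis \<Longrightarrow> smooth_on S (\<lambda>x. g x b c)"
  shows "smooth_on S (\<lambda>x. bilift (g x))"
proof -
  have L: "bounded_linear (\<lambda>X. blinfun_scaleR_left X o\<^sub>L blinfun_inner_left b)" for b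
    by (rule bounded_linear_compose[OF
        bounded_bilinear.bounded_linear_left[OF bounded_bilinear_blinfun_compose] bounded_linear_blinfun_scaleR_left])
  show ?thesis
    unfolding bilift_def
    by (intro smooth_on_sum smooth_on_bounded_linear_comp[OF L] assms finite_Basis)
qed

context param
begin

definition frame_field :: "('e \<Rightarrow> 'e) \<Rightarrow> ('m, 'c, 'e) vfield" where
  "frame_field f = (\<lambda>z. push (\<psi> z) (f (\<psi> z)))"

lemma represents_frame_field:
  "open W' \<Longrightarrow> W' \<subseteq> W \<Longrightarrow> smooth_on W' f \<Longrightarrow> represents W' (frame_field f) f"
  by (auto simp: represents_def frame_field_def \<psi>_\<phi> subset_iff)

definition nabla_coords :: "('e \<Rightarrow> 'e) \<Rightarrow> ('e \<Rightarrow> 'e) \<Rightarrow> 'e \<Rightarrow> 'e" where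
  "nabla_coords f h x = coords x (nabla M (frame_field f) (frame_field h) (\<phi> x))"

lemma nabla_represented:
  assumes X: "represents W' X f" and Y: "represents W' Y h"
  shows "represents W' (nabla M X Y) (nabla_coords f h)"
proof -
  have W': "open W'" "W' \<subseteq> W" "smooth_on W' f" "smooth_on W' h"
    using X Y by (auto simp: represents_def)
  have r: "represents W' (frame_field f) f" "represents W' (frame_field h) h"
    using W' represents_frame_field by auto
  have "nabla M (frame_field f) (frame_field h) (\<phi> x) = nabla M X Y (\<phi> x)" if "x \<in> W'" for x
    by (rule nabla_local[OF open_image[OF W'(1,2)] represents_smooth_vfield[OF X] represents_smooth_vfield[OF Y]])
      (use X Y r that in \<open>auto simp: represents_def\<close>)
  then show ?thesis
    using smooth_vfield_represents[OF W'(1,2)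
        nabla_smooth[OF open_image[OF W'(1,2)] represents_smooth_vfield[OF X] represents_smooth_vfield[OF Y]]]
    by (auto intro: represents_cong simp: nabla_coords_def)
qed

lemma nabla_at:
  "represents W' X f \<Longrightarrow> represents W' Y h \<Longrightarrow> x \<in> W' \<Longrightarrow>
    nabla M X Y (\<phi> x) = push x (nabla_coords f h x)"
  using nabla_represented by (simp add: represents_def)

context
  fixes W' assumes W': "open W'" "W' \<subseteq> W"
begin

lemma nabla_coords_add_left:
  assumes "smooth_on W' f" "smooth_on W' g" "smooth_on W' h" "x \<in> W'"
  shows "nabla_coords (\<lambda>x. f x + g x) h x = nabla_coords f h x + nabla_coords g h x"
proof -
  have x: "x \<in> W" using assms W' by auto
  have r: "represents W' (frame_field f) f" "represents W' (frame_field g) g" "represents W' (frame_field h) h"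
    using W' assms represents_frame_field by auto
  then have Z: "represents W' (\<lambda>z. tadd (frame_field f z) (frame_field g z)) (\<lambda>x. f x + g x)"
    using W' by (auto simp: represents_def push_add subset_iff intro: smooth_on_add)
  have "push x (nabla_coords (\<lambda>x. f x + g x) h x) = push x (nabla_coords f h x + nabla_coords g h x)"
    using nabla_at[OF Z r(3) assms(4)] nabla_at[OF r(1,3) assms(4)] nabla_at[OF r(2,3) assms(4)]
      nabla_add_left[OF open_image[OF W'] represents_smooth_vfield[OF r(1)] represents_smooth_vfield[OF r(2)]
        represents_smooth_vfield[OF r(3)], of "\<phi> x"] assms(4) push_add[OF x] by simp
  then show ?thesis using push_inject x by blast
qed

lemma nabla_coords_add_right:
  assumes "smooth_on W' f" "smooth_on W' g" "smooth_on W' h" "x \<in> W'"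
  shows "nabla_coords h (\<lambda>x. f x + g x) x = nabla_coords h f x + nabla_coords h g x"
proof -
  have x: "x \<in> W" using assms W' by auto
  have r: "represents W' (frame_field f) f" "represents W' (frame_field g) g" "represents W' (frame_field h) h"
    using W' assms represents_frame_field by auto
  then have Z: "represents W' (\<lambda>z. tadd (frame_field f z) (frame_field g z)) (\<lambda>x. f x + g x)"
    using W' by (auto simp: represents_def push_add subset_iff intro: smooth_on_add)
  have "push x (nabla_coords h (\<lambda>x. f x + g x) x) = push x (nabla_coords h f x + nabla_coords h g x)"
    using nabla_at[OF r(3) Z assms(4)] nabla_at[OF r(3,1) assms(4)] nabla_at[OF r(3,2) assms(4)]
      nabla_add_right[OF open_image[OF W'] represents_smooth_vfield[OF r(3)] represents_smooth_vfield[OF r(1)]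
        represents_smooth_vfield[OF r(2)], of "\<phi> x"] assms(4) push_add[OF x] by simp
  then show ?thesis using push_inject x by blast
qed

lemma represents_scale:
  assumes "represents W' X f" "smooth_on W' a"
  shows "represents W' (\<lambda>z. tscale (a (\<psi> z)) (X z)) (\<lambda>x. a x *\<^sub>R f x)"
  using assms by (auto simp: represents_def push_scale subset_iff \<psi>_\<phi> intro: smooth_on_scaleR)

lemma nabla_coords_scale_left:
  assumes "smooth_on W' f" "smooth_on W' a" "smooth_on W' h" "x \<in> W'"
  shows "nabla_coords (\<lambda>x. a x *\<^sub>R f x) h x = a x *\<^sub>R nabla_coords f h x"
proof -
  have x: "x \<in> W" using assms W' by auto
  have r: "represents W' (frame_field f) f" "represents W' (frame_field h) h"
    using W' assms represents_frame_field by auto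
  have "push x (nabla_coords (\<lambda>x. a x *\<^sub>R f x) h x) = push x (a x *\<^sub>R nabla_coords f h x)"
    using nabla_at[OF represents_scale[OF r(1) assms(2)] r(2) assms(4)] nabla_at[OF r assms(4)]
      nabla_scale_left[OF open_image[OF W'] smooth_from_compose_\<psi>[OF W' assms(2)]
        represents_smooth_vfield[OF r(1)] represents_smooth_vfield[OF r(2)], of "\<phi> x"]
      assms(4) push_scale[OF x] by (simp add: \<psi>_\<phi>[OF x])
  then show ?thesis using push_inject x by blast
qed

lemma dir_deriv_compose_\<psi>:
  assumes "smooth_on W' a" "x \<in> W'" "i \<in> charts_at M (\<phi> x)"
  shows "dir_deriv M i (\<phi> x) (push x v) (\<lambda>z. a (\<psi> z)) = fd a x v"
proof -
  have x: "x \<in> W" and i: "i \<in> charts M" "\<phi> x \<in> cdom M i" using assms W' charts_atD by auto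
  let ?T = "{x \<in> W'. \<phi> x \<in> cdom M i}" and ?Y = "cmap M i ` (\<phi> ` W' \<inter> cdom M i)"
  have sa: "smooth_on ?Y (\<lambda>y. a (from_chart i y))"
    by (rule smooth_on_compose[OF open_cmap_image[OF i(1) open_image[OF W']] W'(1)
          smooth_on_subset[OF smooth_on_from_chart[OF i(1)]] assms(1)])
      (use W'(2) image_cinv_in[OF i(1) W'(2)] in auto)
  have "dir_deriv M i (\<phi> x) (push x v) (\<lambda>z. a (\<psi> z))
      = fd (\<lambda>y. a (from_chart i y)) (to_chart i x) (fd (to_chart i) x v)"
    by (simp add: dir_deriv_def push_at[OF assms(3)] to_chart_def from_chart_def o_def)
  also have "\<dots> = fd (\<lambda>x. a (from_chart i (to_chart i x))) x v"
    by (rule fd_compose_smooth[OF smooth_on_to_chart[OF i(1)] _ sa, symmetric])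
      (use x i assms in \<open>auto simp: to_chart_def\<close>)
  also have "\<dots> = fd a x v"
    by (subst fd_cong[OF open_Wc[OF i(1) W'], where g=a])
      (use assms i W' from_chart_to_chart[OF i(1)] in auto)
  finally show ?thesis .
qed

lemma nabla_coords_scale_right:
  assumes "smooth_on W' f" "smooth_on W' a" "smooth_on W' h" "x \<in> W'"
  shows "nabla_coords h (\<lambda>x. a x *\<^sub>R f x) x = fd a x (h x) *\<^sub>R f x + a x *\<^sub>R nabla_coords h f x"
proof -
  have x: "x \<in> W" using assms W' by auto
  have r: "represents W' (frame_field f) f" "represents W' (frame_field h) h"
    using W' assms represents_frame_field by auto
  obtain i where i: "i \<in> charts_at M (\<phi> x)" using chart_exists by blast
  have "nabla M (frame_field h) (\<lambda>z. tscale (a (\<psi> z)) (frame_field f z)) (\<phi> x)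
      = tadd (tscale (dir_deriv M i (\<phi> x) (frame_field h (\<phi> x)) (\<lambda>z. a (\<psi> z))) (frame_field f (\<phi> x)))
        (tscale (a (\<psi> (\<phi> x))) (nabla M (frame_field h) (frame_field f) (\<phi> x)))"
    by (rule nabla_scale_right[OF open_image[OF W'] smooth_from_compose_\<psi>[OF W' assms(2)]
        represents_smooth_vfield[OF r(2)] represents_smooth_vfield[OF r(1)] _ i]) (use assms in auto)
  also have "\<dots> = push x (fd a x (h x) *\<^sub>R f x + a x *\<^sub>R nabla_coords h f x)"
    using r assms(4) by (simp add: nabla_at[OF r(2,1) assms(4)] push_add[OF x] push_scale[OF x] \<psi>_\<phi>[OF x]
        represents_def dir_deriv_compose_\<psi>[OF assms(2,4) i])
  finally have "push x (nabla_coords h (\<lambda>x. a x *\<^sub>R f x) x) = push x (fd a x (h x) *\<^sub>R f x + a x *\<^sub>R nabla_coords h f x)"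
    using nabla_at[OF r(2) represents_scale[OF r(1) assms(2)] assms(4)] by simp
  then show ?thesis using push_inject x by blast
qed

lemma nabla_coords_sum_left:
  assumes "finite A" "\<And>b. b \<in> A \<Longrightarrow> smooth_on W' (f b)" "smooth_on W' h" "x \<in> W'"
  shows "nabla_coords (\<lambda>x. \<Sum>b\<in>A. f b x) h x = (\<Sum>b\<in>A. nabla_coords (f b) h x)"
  using assms(1,2)
proof (induction rule: finite_induct)
  case empty
  show ?case using nabla_coords_scale_left[OF smooth_on_const[of _ 0] smooth_on_const[of _ 0] assms(3,4)] by simp
next
  case (insert b A)
  then show ?case
    using nabla_coords_add_left[of "f b" "\<lambda>x. \<Sum>b\<in>A. f b x" h x] smooth_on_sum[OF W'(1), of A f] assms by simp
qed

lemma nabla_coords_sum_right: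
  assumes "finite A" "\<And>b. b \<in> A \<Longrightarrow> smooth_on W' (f b)" "smooth_on W' h" "x \<in> W'"
  shows "nabla_coords h (\<lambda>x. \<Sum>b\<in>A. f b x) x = (\<Sum>b\<in>A. nabla_coords h (f b) x)"
  using assms(1,2)
proof (induction rule: finite_induct)
  case empty
  show ?case using nabla_coords_scale_right[OF smooth_on_const[of _ 0] smooth_on_const[of _ 0] assms(3,4)] by simp
next
  case (insert b A)
  then show ?case
    using nabla_coords_add_right[of "f b" "\<lambda>x. \<Sum>b\<in>A. f b x" h x] smooth_on_sum[OF W'(1), of A f] assms by simp
qed

end

text \<open>The Christoffel symbols of the parametrization: covariant derivatives of the constant
  frame along itself, extended bilinearly.\<close>

definition \<Gamma> :: "'e \<Rightarrow> 'e \<Rightarrow>\<^sub>L 'e \<Rightarrow>\<^sub>L 'e" where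
  "\<Gamma> x = bilift (\<lambda>b c. nabla_coords (\<lambda>_. b) (\<lambda>_. c) x)"

lemma smooth_\<Gamma>: "smooth_on W \<Gamma>"
proof -
  have "smooth_on W (nabla_coords (\<lambda>_. b) (\<lambda>_. c))" for b c
    using nabla_represented[OF represents_frame_field represents_frame_field, of W "\<lambda>_. b" "\<lambda>_. c"]
      open_W smooth_on_const by (auto simp: represents_def)
  then show ?thesis unfolding \<Gamma>_def[abs_def] by (intro smooth_on_bilift open_W)
qed

text \<open>Both fields are expanded in the constant frame. The first slot is linear over functions;
  in the second the Leibniz rule differentiates the coefficients, which gives the term
  \<open>fd h x (f x)\<close>.\<close>

lemma nabla_coords_eq:
  assumes W': "open W'" "W' \<subseteq> W" and f: "smooth_on W' f" and h: "smooth_on W' h" and x: "x \<in> W'"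
  shows "nabla_coords f h x = fd h x (f x) + \<Gamma> x (f x) (h x)"
proof -
  have inner: "smooth_on W' (\<lambda>x. k x \<bullet> b)" if "smooth_on W' k" for k :: "'e \<Rightarrow> 'e" and b
    by (rule smooth_on_bounded_linear_comp[OF bounded_linear_inner_left W'(1) that])
  have fd_inner: "fd (\<lambda>x. h x \<bullet> c) x b = fd h x b \<bullet> c" for b c
    using fd_eq[OF has_derivative_inner_left[OF smooth_on_has_derivative[OF h x]]] by simp
  have 1: "nabla_coords (\<lambda>_. b) h x = fd h x b + (\<Sum>c\<in>Basis. (h x \<bullet> c) *\<^sub>R nabla_coords (\<lambda>_. b) (\<lambda>_. c) x)" for b
  proof -
    have "nabla_coords (\<lambda>_. b) (\<lambda>x. \<Sum>c\<in>Basis. (h x \<bullet> c) *\<^sub>R c) x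
        = (\<Sum>c\<in>Basis. nabla_coords (\<lambda>_. b) (\<lambda>x. (h x \<bullet> c) *\<^sub>R c) x)"
      by (intro nabla_coords_sum_right[OF W'] smooth_on_scaleR[OF W'(1)] inner h smooth_on_const x finite_Basis)
    also have "\<dots> = (\<Sum>c\<in>Basis. (fd h x b \<bullet> c) *\<^sub>R c + (h x \<bullet> c) *\<^sub>R nabla_coords (\<lambda>_. b) (\<lambda>_. c) x)"
      by (intro sum.cong refl, subst nabla_coords_scale_right[OF W' smooth_on_const inner[OF h] smooth_on_const x])
        (simp add: fd_inner)
    finally show ?thesis by (simp add: euclidean_representation sum.distrib)
  qed
  have "nabla_coords (\<lambda>x. \<Sum>b\<in>Basis. (f x \<bullet> b) *\<^sub>R b) h x
      = (\<Sum>b\<in>Basis. nabla_coords (\<lambda>x. (f x \<bullet> b) *\<^sub>R b) h x)"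
    by (intro nabla_coords_sum_left[OF W'] smooth_on_scaleR[OF W'(1)] inner f h smooth_on_const x finite_Basis)
  also have "\<dots> = (\<Sum>b\<in>Basis. (f x \<bullet> b) *\<^sub>R nabla_coords (\<lambda>_. b) h x)"
    by (intro sum.cong refl nabla_coords_scale_left[OF W' smooth_on_const inner[OF f] h x])
  also have "\<dots> = (\<Sum>b\<in>Basis. (f x \<bullet> b) *\<^sub>R fd h x b) + \<Gamma> x (f x) (h x)"
    by (simp add: 1 scaleR_right_distrib sum.distrib \<Gamma>_def bilift_apply)
  also have "(\<Sum>b\<in>Basis. (f x \<bullet> b) *\<^sub>R fd h x b) = fd h x (f x)"
    by (rule linear_sum_Basis[OF linear_fd_smooth[OF h x], symmetric])
  finally show ?thesis by (simp add: euclidean_representation)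
qed

lemma represents_nabla:
  assumes X: "represents W' X f" and Y: "represents W' Y h"
  shows "represents W' (nabla M X Y) (\<lambda>x. fd h x (f x) + \<Gamma> x (f x) (h x))"
  by (rule represents_cong[OF nabla_represented[OF X Y]])
    (use X Y in \<open>auto simp: represents_def intro!: nabla_coords_eq\<close>)

end

section \<open>Charts as parametrizations of their domains\<close>

lemma (in acs_space) chart_param:
  assumes i: "i \<in> charts M"
  shows "param M (cmap M i ` cdom M i) (cinv M i) (cmap M i)"
proof
  have im: "cinv M i ` (cmap M i ` cdom M i) = cdom M i" using cinv_cmap[OF i] by force
  show "open (cmap M i ` cdom M i)" by (rule open_cmap_cdom[OF i])
  have "{y \<in> cmap M i ` cdom M i. cinv M i y \<in> cdom M j} = cmap M i ` (cdom M i \<inter> cdom M j)" for j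
    using cinv_cmap[OF i] by auto
  then show "smooth_into M (cmap M i ` cdom M i) (cinv M i)"
    using continuous_on_cinv[OF i] smooth_on_transition[OF i] by (simp add: smooth_into_def)
  show "open (cinv M i ` cmap M i ` cdom M i)" using im open_cdom[OF i] by simp
  show "smooth_from M (cinv M i ` cmap M i ` cdom M i) (cmap M i)"
    unfolding im smooth_from_def using smooth_on_transition[OF _ i] by (simp add: Int_commute)
  show "cmap M i (cinv M i y) = y" if "y \<in> cmap M i ` cdom M i" for y
    using that cinv_cmap[OF i] by auto
qed

context acs_space
begin

context
  fixes i z assumes i: "i \<in> charts M" and z: "z \<in> cdom M i"
begin

interpretation C: param M "cmap M i ` cdom M i" "cinv M i" "cmap M i" by (rule chart_param[OF i])

text \<open>Seen in the parametrization by its own inverse, the chart is the identity map, so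
  \<open>push\<close> just inserts its argument at index \<open>i\<close>.\<close>

lemma fd_chart_id: "fd (C.to_chart i) (cmap M i z) = (\<lambda>v. v)" "fd (C.from_chart i) (cmap M i z) = (\<lambda>v. v)"
  using z by (subst fd_cong[OF open_cmap_cdom[OF i], where g="\<lambda>y. y"];
      simp add: C.to_chart_def C.from_chart_def C.\<psi>_\<phi>)+

lemma chart_push_at: "param.push M (cinv M i) (cmap M i z) v i = v"
  using C.push_at[of i "cmap M i z" v] i z by (simp add: charts_at_def cinv_cmap[OF i] fd_chart_id)

lemma chart_push: "X \<in> tangent_space M z \<Longrightarrow> X = param.push M (cinv M i) (cmap M i z) (X i)"
  using C.push_from_chart[of "cmap M i z" i X] i z
  by (simp add: charts_at_def cinv_cmap[OF i] C.to_chart_def fd_chart_id)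

end

lemma chart_represents:
  assumes i: "i \<in> charts M" and U: "open U" "U \<subseteq> cdom M i" and X: "smooth_vfield M U X"
  shows "param.represents M (cmap M i ` cdom M i) (cinv M i) (cmap M i ` U) X (\<lambda>y. X (cinv M i y) i)"
proof -
  interpret C: param M "cmap M i ` cdom M i" "cinv M i" "cmap M i" by (rule chart_param[OF i])
  have UI: "U \<inter> cdom M i = U" using U by auto
  show ?thesis
    unfolding C.represents_def
    using X i U open_cmap_image[OF i U(1)] chart_push[OF i]
    by (auto simp: UI smooth_vfield_def cinv_cmap[OF i] subset_iff)
qed

text \<open>The bridge from the symbols that define covariant derivatives along curves to those of a
  parametrization: a coordinate field of the chart has constant coordinates.\<close>

lemma christoffel_chart:
  assumes i: "i \<in> charts M" and z: "z \<in> cdom M i"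
  shows "christoffel M i z u v = param.\<Gamma> M (cinv M i) (cmap M i) (cmap M i z) u v"
proof -
  interpret C: param M "cmap M i ` cdom M i" "cinv M i" "cmap M i" by (rule chart_param[OF i])
  have "C.represents (cmap M i ` cdom M i) (coord_field M i w) (\<lambda>_. w)" for w
    unfolding C.represents_def
    using open_cmap_cdom[OF i] smooth_on_const
    by (auto simp: coord_field_def C.push_def fun_eq_iff cinv_cmap[OF i] C.to_chart_def[abs_def] o_def)
  from C.represents_nabla[OF this this, of u v] z
  have "nabla M (coord_field M i u) (coord_field M i v) z = C.push (cmap M i z) (C.\<Gamma> (cmap M i z) u v)"
    by (simp add: C.represents_def cinv_cmap[OF i])
  then show ?thesis using chart_push_at[OF i z] by (simp add: christoffel_def)
qed

end

context param
begin

text \<open>The inhomogeneous transformation law. One covariant derivative of constant fields is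
  computed in the parametrization and again in the chart, and the components at index
  \<open>i\<close> are compared.\<close>

lemma christoffel_transform:
  assumes i: "i \<in> charts M" and x: "x \<in> Wc i"
  shows "christoffel M i (\<phi> x) (fd (to_chart i) x u) (fd (to_chart i) x v)
    = fd (to_chart i) x (\<Gamma> x u v) - fd (\<lambda>y. fd (to_chart i) y v) x u"
proof -
  interpret C: param M "cmap M i ` cdom M i" "cinv M i" "cmap M i" by (rule chart_param[OF i])
  define U where "U = \<phi> ` W \<inter> cdom M i"
  have U: "open U" "U \<subseteq> cdom M i" using open_range open_cdom[OF i] by (auto simp: U_def)
  have UW: "U = \<phi> ` Wc i" by (auto simp: U_def)
  have oW: "open (Wc i)" "Wc i \<subseteq> W" using open_Wc[OF i open_W] by auto
  define y where "y = to_chart i x"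
  have y: "y \<in> cmap M i ` U" "cinv M i y = \<phi> x" "y = cmap M i (\<phi> x)" "\<phi> x \<in> cdom M i"
    using x by (auto simp: y_def to_chart_def U_def cinv_cmap[OF i])
  have r: "represents (Wc i) (frame_field (\<lambda>_. w)) (\<lambda>_. w)" for w
    using oW by (intro represents_frame_field smooth_on_const)
  define h where "h w y = frame_field (\<lambda>_. w) (cinv M i y) i" for w y
  have rC: "C.represents (cmap M i ` U) (frame_field (\<lambda>_. w)) (h w)" for w
    unfolding h_def[abs_def] by (rule chart_represents[OF i U represents_smooth_vfield[OF r, folded UW]])
  have hx: "h w (to_chart i x') = fd (to_chart i) x' w" if "x' \<in> Wc i" for x' w
    using represents_in_chart(1)[OF r i that] that by (simp add: h_def to_chart_def cinv_cmap[OF i])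
  let ?N = "nabla M (frame_field (\<lambda>_. u)) (frame_field (\<lambda>_. v)) (\<phi> x)"
  have "?N = push x (\<Gamma> x u v)"
    using represents_nabla[OF r[of u] r[of v]] x by (simp add: represents_def)
  moreover have "?N = C.push y (fd (h v) y (h u y) + C.\<Gamma> y (h u y) (h v y))"
    using C.represents_nabla[OF rC[of u] rC[of v]] y by (metis (no_types, lifting) C.represents_def)
  ultimately have "push x (\<Gamma> x u v) i = C.push y (fd (h v) y (h u y) + C.\<Gamma> y (h u y) (h v y)) i" by simp
  then have "fd (to_chart i) x (\<Gamma> x u v) = fd (h v) y (h u y) + C.\<Gamma> y (h u y) (h v y)"
    unfolding y(3) chart_push_at[OF i y(4)] using push_in_chart[of x i] x i by simp
  moreover have "h w y = fd (to_chart i) x w" for w unfolding y_def by (rule hx[OF x])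
  moreover have "fd (h v) y (fd (to_chart i) x u) = fd (\<lambda>y. fd (to_chart i) y v) x u"
  proof -
    have "fd (\<lambda>x. h v (to_chart i x)) x u = fd (h v) (to_chart i x) (fd (to_chart i) x u)"
      by (rule fd_compose_smooth[OF smooth_on_to_chart[OF i] x])
        (use rC[of v] y in \<open>auto simp: C.represents_def y_def\<close>)
    moreover have "fd (\<lambda>x. h v (to_chart i x)) x = fd (\<lambda>y. fd (to_chart i) y v) x"
      by (rule fd_cong[OF oW(1) x hx])
    ultimately show ?thesis by (simp add: y_def)
  qed
  ultimately show ?thesis by (simp add: christoffel_chart[OF i y(4)] flip: y(3))
qed

end

section \<open>Curves in a parametrization\<close>

lemma has_vector_derivative_fd_along:
  fixes f :: "'a::euclidean_space \<Rightarrow> 'b::real_normed_vector"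
  assumes "open S" "smooth_on S f" "open J" "t \<in> J" "\<And>s. s \<in> J \<Longrightarrow> c s \<in> S"
    and dc: "(c has_vector_derivative c') (at t)" and dh: "(h has_vector_derivative h') (at t)"
  shows "((\<lambda>s. fd f (c s) (h s)) has_vector_derivative
      fd (\<lambda>y. fd f y (h t)) (c t) c' + fd f (c t) h') (at t)"
proof -
  have ct: "c t \<in> S" using assms by blast
  have "((\<lambda>s. \<Sum>b\<in>Basis. (h s \<bullet> b) *\<^sub>R fd f (c s) b) has_vector_derivative
      (\<Sum>b\<in>Basis. (h t \<bullet> b) *\<^sub>R fd (\<lambda>y. fd f y b) (c t) c' + (h' \<bullet> b) *\<^sub>R fd f (c t) b)) (at t)"
  proof (rule has_vector_derivative_sum)
    fix b :: 'a
    have "((\<lambda>s. h s \<bullet> b) has_real_derivative h' \<bullet> b) (at t)"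
      using bounded_linear.has_vector_derivative[OF bounded_linear_inner_left dh]
      by (simp add: has_real_derivative_iff_has_vector_derivative)
    from has_vector_derivative_scaleR[OF this smooth_on_has_derivative_along[OF smooth_on_fd[OF assms(2)] ct dc]]
    show "((\<lambda>s. (h s \<bullet> b) *\<^sub>R fd f (c s) b) has_vector_derivative
      (h t \<bullet> b) *\<^sub>R fd (\<lambda>y. fd f y b) (c t) c' + (h' \<bullet> b) *\<^sub>R fd f (c t) b) (at t)" .
  qed
  then have "((\<lambda>s. fd f (c s) (h s)) has_vector_derivative
      (\<Sum>b\<in>Basis. (h t \<bullet> b) *\<^sub>R fd (\<lambda>y. fd f y b) (c t) c' + (h' \<bullet> b) *\<^sub>R fd f (c t) b)) (at t)"
    by (rule has_vector_derivative_transform_within_open[OF _ assms(3,4)])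
      (rule linear_sum_Basis[OF linear_fd_smooth[OF assms(2) assms(5)], symmetric])
  also have "(\<Sum>b\<in>Basis. (h t \<bullet> b) *\<^sub>R fd (\<lambda>y. fd f y b) (c t) c' + (h' \<bullet> b) *\<^sub>R fd f (c t) b)
      = fd (\<lambda>y. fd f y (h t)) (c t) c' + fd f (c t) h'"
    unfolding sum.distrib fd_fd_linear[OF assms(1,2) ct, of "h t"]
      linear_sum_Basis[OF linear_fd_smooth[OF assms(2) ct], of h'] by simp
  finally show ?thesis .
qed

lemma smooth_on_fd_along:
  fixes f :: "'a::euclidean_space \<Rightarrow> 'b::real_normed_vector" and c :: "'d::real_normed_vector \<Rightarrow> 'a"
  assumes "open J" "open S" "smooth_on S f" "smooth_on J c" "smooth_on J h" "\<And>s. s \<in> J \<Longrightarrow> c s \<in> S"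
  shows "smooth_on J (\<lambda>s. fd f (c s) (h s))"
proof (rule smooth_on_cong[OF assms(1)])
  show "smooth_on J (\<lambda>s. \<Sum>b\<in>Basis. (h s \<bullet> b) *\<^sub>R fd f (c s) b)"
    by (intro smooth_on_sum smooth_on_scaleR assms(1) finite_Basis
        smooth_on_bounded_linear_comp[OF bounded_linear_inner_left] assms(5)
        smooth_on_compose[OF assms(1,2,4) smooth_on_fd[OF assms(3)] assms(6)])
  show "(\<Sum>b\<in>Basis. (h s \<bullet> b) *\<^sub>R fd f (c s) b) = fd f (c s) (h s)" if "s \<in> J" for s
    by (rule linear_sum_Basis[OF linear_fd_smooth[OF assms(3) assms(6)[OF that]], symmetric])
qed

lemma smooth_on_has_vector_derivative:
  fixes y :: "real \<Rightarrow> 'a::real_normed_vector"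
  assumes "smooth_on J y" "t \<in> J"
  shows "(y has_vector_derivative fd y t 1) (at t)"
  unfolding has_vector_derivative_def
proof (rule has_derivative_eq_rhs[OF smooth_on_has_derivative[OF assms]])
  show "fd y t = (\<lambda>h. h *\<^sub>R fd y t 1)"
  proof
    fix h show "fd y t h = h *\<^sub>R fd y t 1"
      using linear_cmul[OF linear_fd_smooth[OF assms], of h 1] by simp
  qed
qed

context param
begin

lemma smooth_on_\<psi>_curve:
  fixes \<gamma> :: "'a::real_normed_vector \<Rightarrow> 'm"
  assumes "open J" "smooth_into M J \<gamma>" "\<And>s. s \<in> J \<Longrightarrow> \<gamma> s \<in> \<phi> ` W"
  shows "smooth_on J (\<lambda>s. \<psi> (\<gamma> s))"
proof (rule smooth_on_local[OF assms(1)])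
  fix t assume "t \<in> J"
  obtain i where i: "i \<in> charts M" "\<gamma> t \<in> cdom M i" using chart_exists charts_atD by blast
  let ?T = "{s \<in> J. \<gamma> s \<in> cdom M i}"
  have oT: "open ?T" using open_chart_preimage[OF i(1) assms(1)] assms(2) by (simp add: smooth_into_def)
  have "smooth_on ?T (\<lambda>s. from_chart i (cmap M i (\<gamma> s)))"
    by (rule smooth_on_compose[OF oT open_Yc[OF i(1)] _ smooth_on_from_chart[OF i(1)]])
      (use assms i in \<open>auto simp: smooth_into_def o_def\<close>)
  then have "smooth_on ?T (\<lambda>s. \<psi> (\<gamma> s))"
    by (rule smooth_on_cong[OF oT, rotated]) (simp add: from_chart_def cinv_cmap[OF i(1)])
  then show "\<exists>T. open T \<and> t \<in> T \<and> smooth_on T (\<lambda>s. \<psi> (\<gamma> s))" using oT i \<open>t \<in> J\<close> by blast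
qed

lemma smooth_into_\<phi>_curve:
  fixes \<gamma> :: "'a::real_normed_vector \<Rightarrow> 'm"
  assumes "open J" "smooth_on J y" "\<And>s. s \<in> J \<Longrightarrow> y s \<in> W \<and> \<gamma> s = \<phi> (y s)"
  shows "smooth_into M J \<gamma>"
proof -
  have "continuous_on J (\<lambda>s. \<phi> (y s))"
    by (rule continuous_on_compose2[OF continuous_on_\<phi> smooth_on_continuous_on[OF assms(2)]]) (use assms in auto)
  then have c: "continuous_on J \<gamma>" using assms(3) by (simp cong: continuous_on_cong)
  have "smooth_on {s \<in> J. \<gamma> s \<in> cdom M i} (cmap M i \<circ> \<gamma>)" if i: "i \<in> charts M" for i
  proof -
    have oT: "open {s \<in> J. \<gamma> s \<in> cdom M i}" by (rule open_chart_preimage[OF i assms(1) c])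
    have "smooth_on {s \<in> J. \<gamma> s \<in> cdom M i} (\<lambda>s. to_chart i (y s))"
      by (rule smooth_on_compose[OF oT open_Wc[OF i open_W order_refl] _ smooth_on_to_chart[OF i]])
        (use assms in \<open>auto elim!: smooth_on_subset\<close>)
    then show ?thesis
      by (rule smooth_on_cong[OF oT, rotated]) (use assms(3) in \<open>simp add: to_chart_def\<close>)
  qed
  then show ?thesis using c by (simp add: smooth_into_def)
qed

lemma velocity_param:
  assumes "open J" "t \<in> J" "\<And>s. s \<in> J \<Longrightarrow> y s \<in> W \<and> \<gamma> s = \<phi> (y s)"
    and dy: "(y has_vector_derivative y') (at t)"
  shows "velocity M \<gamma> t = push (y t) y'"
proof
  fix i
  have yt: "y t \<in> W" "\<gamma> t = \<phi> (y t)" using assms by auto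
  show "velocity M \<gamma> t i = push (y t) y' i"
  proof (cases "i \<in> charts_at M (\<gamma> t)")
    case True
    then have i: "i \<in> charts M" "y t \<in> Wc i" using yt charts_at_Wc by auto
    have "((\<lambda>s. to_chart i (y s)) has_vector_derivative fd (to_chart i) (y t) y') (at t)"
      by (rule smooth_on_has_derivative_along[OF smooth_on_to_chart[OF i(1)] i(2) dy])
    then have "((cmap M i \<circ> \<gamma>) has_vector_derivative fd (to_chart i) (y t) y') (at t)"
      by (rule has_vector_derivative_transform_within_open[OF _ assms(1,2)])
        (use assms(3) in \<open>simp add: to_chart_def\<close>)
    then show ?thesis using True yt by (simp add: velocity_def push_def vector_derivative_at)
  qed (use yt in \<open>simp add: velocity_def push_def\<close>)
qed

text \<open>Differentiating the chart components of \<open>V\<close> along the curve produces a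
  second derivative of the coordinate change; it cancels against the inhomogeneous term of
  \<open>christoffel_transform\<close>.\<close>

lemma cov_deriv_param:
  assumes J: "open J" "t \<in> J" "\<And>s. s \<in> J \<Longrightarrow> y s \<in> W \<and> \<gamma> s = \<phi> (y s)"
    and V: "\<And>s. s \<in> J \<Longrightarrow> V s = push (y s) (f s)"
    and dy: "(y has_vector_derivative y') (at t)" and df: "(f has_vector_derivative f') (at t)"
  shows "cov_deriv_along M \<gamma> V t = push (y t) (f' + \<Gamma> (y t) y' (f t))"
proof
  fix i
  have yt: "y t \<in> W" "\<gamma> t = \<phi> (y t)" using J by auto
  show "cov_deriv_along M \<gamma> V t i = push (y t) (f' + \<Gamma> (y t) y' (f t)) i"
  proof (cases "i \<in> charts_at M (\<gamma> t)")
    case True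
    then have i: "i \<in> charts M" "y t \<in> Wc i" using yt charts_at_Wc by auto
    have oW: "open (Wc i)" by (rule open_Wc[OF i(1) open_W order_refl])
    have "isCont y t" using dy has_vector_derivative_continuous by blast
    then obtain T where T: "open T" "t \<in> T" "\<And>s. s \<in> T \<Longrightarrow> y s \<in> Wc i"
      using oW i(2) by (metis (no_types, lifting) continuous_at_open)
    have "((\<lambda>s. fd (to_chart i) (y s) (f s)) has_vector_derivative
        fd (\<lambda>z. fd (to_chart i) z (f t)) (y t) y' + fd (to_chart i) (y t) f') (at t)"
      by (rule has_vector_derivative_fd_along[OF oW smooth_on_to_chart[OF i(1)] T dy df])
    then have "((\<lambda>s. V s i) has_vector_derivative
        fd (\<lambda>z. fd (to_chart i) z (f t)) (y t) y' + fd (to_chart i) (y t) f') (at t)"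
      by (rule has_vector_derivative_transform_within_open[where S="T \<inter> J"])
        (use J T V i in \<open>auto simp: push_in_chart\<close>)
    moreover have "velocity M \<gamma> t i = fd (to_chart i) (y t) y'"
      using velocity_param[OF J dy] i yt by (simp add: push_in_chart)
    moreover have "V t i = fd (to_chart i) (y t) (f t)" using V[OF J(2)] i by (simp add: push_in_chart)
    ultimately show ?thesis
      using True yt christoffel_transform[OF i] linear_add[OF linear_to_chart[OF yt(1)], of i]
      by (simp add: cov_deriv_along_def push_def vector_derivative_at)
  qed (use yt in \<open>simp add: cov_deriv_along_def push_def\<close>)
qed

text \<open>Unlike in \<open>geodesic\<close>, the parameter set is merely open, so the notion
  applies to the preimage of a chart domain, which may be disconnected.\<close>

definition geodesic_coords :: "real set \<Rightarrow> (real \<Rightarrow> 'm) \<Rightarrow> (real \<Rightarrow> 'e) \<Rightarrow> (real \<Rightarrow> 'e) \<Rightarrow> bool" where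
  "geodesic_coords J \<gamma> y v \<longleftrightarrow> open J \<and> smooth_on J y \<and> (\<forall>s\<in>J. y s \<in> W \<and> \<gamma> s = \<phi> (y s) \<and>
     (y has_vector_derivative v s) (at s) \<and> (v has_vector_derivative - \<Gamma> (y s) (v s) (v s)) (at s))"

lemma geodesic_coordsD:
  assumes "geodesic_coords J \<gamma> y v"
  shows "open J" "smooth_on J y" "s \<in> J \<Longrightarrow> y s \<in> W \<and> \<gamma> s = \<phi> (y s)"
    "s \<in> J \<Longrightarrow> (y has_vector_derivative v s) (at s)"
    "s \<in> J \<Longrightarrow> (v has_vector_derivative - \<Gamma> (y s) (v s) (v s)) (at s)"
    "s \<in> J \<Longrightarrow> velocity M \<gamma> s = push (y s) (v s)"
  using assms unfolding geodesic_coords_def by (blast intro: velocity_param)+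

lemma geodesicD:
  assumes "geodesic M J \<gamma>" "open J'" "J' \<subseteq> J" "\<And>s. s \<in> J' \<Longrightarrow> \<gamma> s \<in> \<phi> ` W"
  obtains y v where "geodesic_coords J' \<gamma> y v"
proof -
  define y where "y s = \<psi> (\<gamma> s)" for s
  define v where "v s = fd y s 1" for s
  have "smooth_into M J' \<gamma>"
  proof -
    have s: "smooth_into M J \<gamma>" using assms(1) by (simp add: geodesic_def smooth_curve_def)
    show ?thesis unfolding smooth_into_def
    proof (intro conjI ballI)
      show "continuous_on J' \<gamma>" using s assms(3) continuous_on_subset by (auto simp: smooth_into_def)
      show "smooth_on {s \<in> J'. \<gamma> s \<in> cdom M i} (cmap M i \<circ> \<gamma>)" if "i \<in> charts M" for i
        using s that assms(3) by (auto simp: smooth_into_def intro: smooth_on_subset)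
    qed
  qed
  then have sy: "smooth_on J' y" unfolding y_def[abs_def] by (rule smooth_on_\<psi>_curve[OF assms(2) _ assms(4)])
  have sv: "smooth_on J' v" unfolding v_def[abs_def] by (rule smooth_on_fd[OF sy])
  have yW: "y s \<in> W \<and> \<gamma> s = \<phi> (y s)" if "s \<in> J'" for s
    using assms(4)[OF that] \<phi>_\<psi> by (simp add: y_def)
  have dy: "(y has_vector_derivative v s) (at s)" if "s \<in> J'" for s
    unfolding v_def by (rule smooth_on_has_vector_derivative[OF sy that])
  have vel: "velocity M \<gamma> s = push (y s) (v s)" if "s \<in> J'" for s
    by (rule velocity_param[OF assms(2) that yW dy[OF that]])
  have "(v has_vector_derivative - \<Gamma> (y s) (v s) (v s)) (at s)" if s: "s \<in> J'" for s
  proof -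
    have dv: "(v has_vector_derivative fd v s 1) (at s)"
      by (rule smooth_on_has_vector_derivative[OF sv s])
    have "push (y s) (fd v s 1 + \<Gamma> (y s) (v s) (v s)) = cov_deriv_along M \<gamma> (velocity M \<gamma>) s"
      by (rule cov_deriv_param[OF assms(2) s yW vel dy[OF s] dv, symmetric])
    also have "\<dots> = push (y s) 0"
      using assms s yW[OF s] push_0 by (auto simp: geodesic_def)
    finally have "fd v s 1 = - \<Gamma> (y s) (v s) (v s)"
      using push_inject yW[OF s] by (simp add: eq_neg_iff_add_eq_0)
    then show ?thesis using dv by simp
  qed
  then show ?thesis using that assms(2) sy yW dy unfolding geodesic_coords_def by blast
qed

end

context acs_space
begin

lemma smooth_into_local:
  assumes "open J" "\<And>t. t \<in> J \<Longrightarrow> \<exists>J'. open J' \<and> t \<in> J' \<and> J' \<subseteq> J \<and> smooth_into M J' \<gamma>"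
  shows "smooth_into M J \<gamma>"
  unfolding smooth_into_def
proof (intro conjI ballI)
  have "continuous (at t) \<gamma>" if "t \<in> J" for t
    using assms(2)[OF that] continuous_on_eq_continuous_at by (auto simp: smooth_into_def)
  then show c: "continuous_on J \<gamma>" by (simp add: continuous_at_imp_continuous_on)
  fix i assume i: "i \<in> charts M"
  have o: "open {s \<in> J. \<gamma> s \<in> cdom M i}" by (rule open_chart_preimage[OF i assms(1) c])
  show "smooth_on {s \<in> J. \<gamma> s \<in> cdom M i} (cmap M i \<circ> \<gamma>)"
  proof (rule smooth_on_local[OF o])
    fix t assume t: "t \<in> {s \<in> J. \<gamma> s \<in> cdom M i}"
    then obtain J' where J': "open J'" "t \<in> J'" "J' \<subseteq> J" "smooth_into M J' \<gamma>" using assms(2) by blast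
    then have "smooth_on {s \<in> J'. \<gamma> s \<in> cdom M i} (cmap M i \<circ> \<gamma>)" using i by (simp add: smooth_into_def)
    moreover have "{s \<in> J'. \<gamma> s \<in> cdom M i} = J' \<inter> {s \<in> J. \<gamma> s \<in> cdom M i}" using J' by auto
    ultimately have "smooth_on (J' \<inter> {s \<in> J. \<gamma> s \<in> cdom M i}) (cmap M i \<circ> \<gamma>)" by (simp only:)
    moreover have "open (J' \<inter> {s \<in> J. \<gamma> s \<in> cdom M i})" by (rule open_Int[OF J'(1) o])
    ultimately show "\<exists>T. open T \<and> t \<in> T \<and> smooth_on T (cmap M i \<circ> \<gamma>)"
      using J'(2) t by blast
  qed
qed

text \<open>The geodesic equation is local, and the parametrization may change from point to point.
  This covers charts, used for rescaling, as well as normal coordinates, used for the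
  reflection.\<close>

lemma geodesicI:
  assumes J: "open J" "is_interval J"
    and loc: "\<And>t. t \<in> J \<Longrightarrow> \<exists>W \<phi> \<psi> J' y v. param M W \<phi> \<psi> \<and> t \<in> J' \<and> J' \<subseteq> J \<and>
      param.geodesic_coords M W \<phi> \<psi> J' \<gamma> y v"
  shows "geodesic M J \<gamma>"
proof -
  have "\<exists>J'. open J' \<and> t \<in> J' \<and> J' \<subseteq> J \<and> smooth_into M J' \<gamma>"
    and "cov_deriv_along M \<gamma> (velocity M \<gamma>) t = tzero" if "t \<in> J" for t
  proof -
    obtain W \<phi> \<psi> J' y v where p: "param M W \<phi> \<psi>" and J': "t \<in> J'" "J' \<subseteq> J"
      and c: "param.geodesic_coords M W \<phi> \<psi> J' \<gamma> y v"
      using loc[OF \<open>t \<in> J\<close>] by (elim exE conjE)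
    interpret param M W \<phi> \<psi> by (rule p)
    note c' = geodesic_coordsD[OF c]
    show "\<exists>J'. open J' \<and> t \<in> J' \<and> J' \<subseteq> J \<and> smooth_into M J' \<gamma>"
      using smooth_into_\<phi>_curve[OF c'(1,2,3)] c'(1) J' by blast
    have "cov_deriv_along M \<gamma> (velocity M \<gamma>) t = push (y t) (- \<Gamma> (y t) (v t) (v t) + \<Gamma> (y t) (v t) (v t))"
      by (rule cov_deriv_param[OF c'(1) J'(1) c'(3) c'(6) c'(4)[OF J'(1)] c'(5)[OF J'(1)]])
    then show "cov_deriv_along M \<gamma> (velocity M \<gamma>) t = tzero"
      using c'(3)[OF J'(1)] push_0 by simp
  qed
  then show ?thesis using J smooth_into_local[OF J(1)] by (simp add: geodesic_def smooth_curve_def)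
qed

lemma geodesic_in_chart:
  assumes "geodesic M J \<gamma>" "t \<in> J" and i: "i \<in> charts M" "\<gamma> t \<in> cdom M i"
  obtains J' y v where "t \<in> J'" "J' \<subseteq> J"
    "param.geodesic_coords M (cmap M i ` cdom M i) (cinv M i) (cmap M i) J' \<gamma> y v"
proof -
  interpret C: param M "cmap M i ` cdom M i" "cinv M i" "cmap M i" by (rule chart_param[OF i(1)])
  have J: "open J" "continuous_on J \<gamma>" using assms(1) by (auto simp: geodesic_def smooth_curve_def smooth_into_def)
  define J' where "J' = {s \<in> J. \<gamma> s \<in> cdom M i}"
  have J': "open J'" "t \<in> J'" "J' \<subseteq> J"
    using open_chart_preimage[OF i(1) J] i assms(2) by (auto simp: J'_def)
  have "cdom M i = cinv M i ` cmap M i ` cdom M i" using cinv_cmap[OF i(1)] by force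
  then have "\<gamma> s \<in> cinv M i ` cmap M i ` cdom M i" if "s \<in> J'" for s using that by (auto simp: J'_def)
  from C.geodesicD[OF assms(1) J'(1,3) this] that[OF J'(2,3)] show ?thesis by metis
qed

text \<open>The equation is quadratic in the velocity and the new parameter set is a preimage, so
  nothing is divided by \<open>a\<close>. Factors 0 and below are covered, which later provides
  reversed geodesics.\<close>

lemma geodesic_rescale:
  assumes g: "geodesic M J \<gamma>"
  shows "geodesic M {t. a * t \<in> J} (\<lambda>t. \<gamma> (a * t))"
    and "a * t \<in> J \<Longrightarrow> velocity M (\<lambda>t. \<gamma> (a * t)) t = tscale a (velocity M \<gamma> (a * t))"
proof -
  have J: "open J" "is_interval J" using g by (auto simp: geodesic_def smooth_curve_def)
  let ?J = "{t. a * t \<in> J}" and ?\<gamma> = "\<lambda>t. \<gamma> (a * t)"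
  have vim: "{t. a * t \<in> S} = (\<lambda>t. a * t) -` S" for S by auto
  have o: "open {t. a * t \<in> S}" if "open S" for S
    unfolding vim using that by (intro open_vimage continuous_intros)
  have key: "(\<exists>W \<phi> \<psi> J' y v. param M W \<phi> \<psi> \<and> t \<in> J' \<and> J' \<subseteq> ?J \<and> param.geodesic_coords M W \<phi> \<psi> J' ?\<gamma> y v) \<and>
      velocity M ?\<gamma> t = tscale a (velocity M \<gamma> (a * t))" if t: "a * t \<in> J" for t
  proof -
    obtain i where i: "i \<in> charts M" "\<gamma> (a * t) \<in> cdom M i" using chart_exists charts_atD by blast
    interpret C: param M "cmap M i ` cdom M i" "cinv M i" "cmap M i" by (rule chart_param[OF i(1)])
    obtain J' y v where J': "a * t \<in> J'" "J' \<subseteq> J" and c: "C.geodesic_coords J' \<gamma> y v"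
      using geodesic_in_chart[OF g t i] by metis
    note c' = C.geodesic_coordsD[OF c]
    let ?J' = "{s. a * s \<in> J'}"
    have dl: "((\<lambda>s. a * s) has_vector_derivative a) (at s)" for s
      by (auto intro!: derivative_eq_intros simp flip: has_real_derivative_iff_has_vector_derivative)
    have "smooth_on ?J' (\<lambda>s. y (a * s))"
      by (rule smooth_on_compose[OF o[OF c'(1)] c'(1) smooth_on_bounded_linear[OF bounded_linear_mult_right] c'(2)]) simp
    moreover have "((\<lambda>s. y (a * s)) has_vector_derivative a *\<^sub>R v (a * s)) (at s)" if "a * s \<in> J'" for s
      using vector_diff_chain_at[OF dl c'(4)[OF that]] by (simp add: o_def)
    moreover have "((\<lambda>s. a *\<^sub>R v (a * s)) has_vector_derivative
        - C.\<Gamma> (y (a * s)) (a *\<^sub>R v (a * s)) (a *\<^sub>R v (a * s))) (at s)" if "a * s \<in> J'" for s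
    proof -
      have "((\<lambda>s. v (a * s)) has_vector_derivative a *\<^sub>R - C.\<Gamma> (y (a * s)) (v (a * s)) (v (a * s))) (at s)"
        using vector_diff_chain_at[OF dl c'(5)[OF that]] by (simp add: o_def)
      from bounded_linear.has_vector_derivative[OF bounded_linear_scaleR_right this, of a]
      show ?thesis by (simp add: blinfun.scaleR_right blinfun.scaleR_left)
    qed
    ultimately have gc: "C.geodesic_coords ?J' ?\<gamma> (\<lambda>s. y (a * s)) (\<lambda>s. a *\<^sub>R v (a * s))"
      unfolding C.geodesic_coords_def using o[OF c'(1)] c'(3) by simp
    have vel: "velocity M ?\<gamma> t = tscale a (velocity M \<gamma> (a * t))"
      using C.geodesic_coordsD(6)[OF gc, of t] c'(6)[OF J'(1)] c'(3)[OF J'(1)] J'(1) C.push_scale by simp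
    have t': "t \<in> ?J'" "?J' \<subseteq> ?J" using J' by auto
    show ?thesis
      by (intro conjI exI[of _ "cmap M i ` cdom M i"] exI[of _ "cinv M i"] exI[of _ "cmap M i"] exI[of _ ?J']
          exI[of _ "\<lambda>s. y (a * s)"] exI[of _ "\<lambda>s. a *\<^sub>R v (a * s)"] chart_param[OF i(1)] t' gc vel)
  qed
  show "geodesic M ?J ?\<gamma>"
  proof (rule geodesicI[OF o[OF J(1)]])
    have "linear (\<lambda>t. a * t)" by (rule bounded_linear.linear[OF bounded_linear_mult_right])
    then have "convex ((\<lambda>t. a * t) -` J)"
      using J(2) is_interval_convex convex_linear_vimage by blast
    then show "is_interval ?J" unfolding vim using is_interval_convex_1 by blast
  qed (use key in blast)
  show "velocity M ?\<gamma> t = tscale a (velocity M \<gamma> (a * t))" if "a * t \<in> J"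
    using key[OF that] by blast
qed

end

section \<open>Uniqueness of geodesics and the exponential map\<close>

context acs_space
begin

lemma geodesic_velocity_tangent:
  assumes "geodesic M J \<gamma>" "t \<in> J"
  shows "velocity M \<gamma> t \<in> tangent_space M (\<gamma> t)"
proof -
  obtain i where i: "i \<in> charts M" "\<gamma> t \<in> cdom M i" using chart_exists charts_atD by blast
  interpret C: param M "cmap M i ` cdom M i" "cinv M i" "cmap M i" by (rule chart_param[OF i(1)])
  show ?thesis
    using geodesic_in_chart[OF assms i] C.geodesic_coordsD(3,6) C.push_tangent by metis
qed

abbreviation agree :: "(real \<Rightarrow> 'm) \<Rightarrow> (real \<Rightarrow> 'm) \<Rightarrow> real \<Rightarrow> bool" where
  "agree \<gamma> \<delta> s \<equiv> \<gamma> s = \<delta> s \<and> velocity M \<gamma> s = velocity M \<delta> s"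

text \<open>The dichotomy makes agreement and disagreement both open conditions, as a connectedness
  argument requires. Equal velocities invoke uniqueness for the first-order system; different
  velocities stay different by continuity.\<close>

lemma geodesics_locally_agree:
  assumes g: "geodesic M J1 \<gamma>1" "geodesic M J2 \<gamma>2" and t: "t \<in> J1" "t \<in> J2" and eq: "\<gamma>1 t = \<gamma>2 t"
  obtains T where "open T" "t \<in> T" "T \<subseteq> J1 \<inter> J2"
    "(\<forall>s\<in>T. agree \<gamma>1 \<gamma>2 s) \<or>
     (\<forall>s\<in>T. \<not> agree \<gamma>1 \<gamma>2 s)"
proof -
  obtain i where i: "i \<in> charts M" "\<gamma>1 t \<in> cdom M i" using chart_exists charts_atD by blast
  interpret C: param M "cmap M i ` cdom M i" "cinv M i" "cmap M i" by (rule chart_param[OF i(1)])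
  let ?W = "cmap M i ` cdom M i"
  obtain T1 y v where T1: "t \<in> T1" "T1 \<subseteq> J1" and c1: "C.geodesic_coords T1 \<gamma>1 y v"
    using geodesic_in_chart[OF g(1) t(1) i] by metis
  obtain T2 z w where T2: "t \<in> T2" "T2 \<subseteq> J2" and c2: "C.geodesic_coords T2 \<gamma>2 z w"
    using geodesic_in_chart[OF g(2) t(2) i(1)] i(2) eq by metis
  note y = C.geodesic_coordsD[OF c1] and z = C.geodesic_coordsD[OF c2]
  have agree_iff: "agree \<gamma>1 \<gamma>2 s \<longleftrightarrow> (y s, v s) = (z s, w s)"
    if "s \<in> T1 \<inter> T2" for s
  proof -
    have s: "y s \<in> ?W" "z s \<in> ?W" "\<gamma>1 s = cinv M i (y s)" "\<gamma>2 s = cinv M i (z s)"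
      using y(3)[of s] z(3)[of s] that by blast+
    then have e: "\<gamma>1 s = \<gamma>2 s \<longleftrightarrow> y s = z s" using C.\<psi>_\<phi> by metis
    show ?thesis
    proof (cases "y s = z s")
      case True
      then show ?thesis using y(6)[of s] z(6)[of s] that C.push_inject[OF s(1)] e by simp
    qed (simp add: e)
  qed
  have o: "open (T1 \<inter> T2)" "t \<in> T1 \<inter> T2" using T1 T2 y(1) z(1) by auto
  have yz: "y t = z t" using y(3)[OF T1(1)] z(3)[OF T2(1)] eq C.\<psi>_\<phi> by metis
  show ?thesis
  proof (cases "v t = w t")
    case True
    \<comment> \<open>The geodesic spray, an autonomous field on pairs of position and
      velocity.\<close>
    define F where "F p = (snd p, - C.\<Gamma> (fst p) (snd p) (snd p))" for p
    have oW: "open (?W \<times> (UNIV :: 'e set))" using C.open_W by (intro open_Times) auto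
    have sG: "smooth_on (?W \<times> (UNIV :: 'e set)) (\<lambda>p. C.\<Gamma> (fst p))"
      by (rule smooth_on_compose[OF oW C.open_W smooth_on_bounded_linear[OF bounded_linear_fst] C.smooth_\<Gamma>]) auto
    have sF: "smooth_on (?W \<times> (UNIV :: 'e set)) F"
      unfolding F_def[abs_def]
      by (intro smooth_on_Pair smooth_on_minus smooth_on_blinfun_apply sG oW
          smooth_on_bounded_linear[OF bounded_linear_snd])
    have d1: "((\<lambda>s. (y s, v s)) has_vector_derivative F (y s, v s)) (at s)" if "s \<in> T1 \<inter> T2" for s
      using has_vector_derivative_Pair[OF y(4,5)] that by (simp add: F_def)
    have d2: "((\<lambda>s. (z s, w s)) has_vector_derivative F (z s, w s)) (at s)" if "s \<in> T1 \<inter> T2" for s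
      using has_vector_derivative_Pair[OF z(4,5)] that by (simp add: F_def)
    obtain d where d: "d > 0" "\<And>s. \<bar>s - t\<bar> < d \<Longrightarrow> (y s, v s) = (z s, w s)"
      by (rule ode_locally_unique[OF oW sF o d1 d2]) (use True yz y(3)[OF T1(1)] in auto)
    show ?thesis
    proof (rule that)
      show "open (T1 \<inter> T2 \<inter> ball t d)" "t \<in> T1 \<inter> T2 \<inter> ball t d" "T1 \<inter> T2 \<inter> ball t d \<subseteq> J1 \<inter> J2"
        using o T1 T2 d by auto
      have "agree \<gamma>1 \<gamma>2 s" if s: "s \<in> T1 \<inter> T2 \<inter> ball t d" for s
        using agree_iff[of s] d(2)[of s] s by (auto simp: dist_real_def abs_minus_commute)
      then show "(\<forall>s\<in>T1 \<inter> T2 \<inter> ball t d. agree \<gamma>1 \<gamma>2 s) \<or>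
        (\<forall>s\<in>T1 \<inter> T2 \<inter> ball t d. \<not> agree \<gamma>1 \<gamma>2 s)" by blast
    qed
  next
    case False
    have "isCont v t" "isCont w t"
      using y(5)[OF T1(1)] z(5)[OF T2(1)] has_vector_derivative_continuous by blast+
    then have "isCont (\<lambda>s. v s - w s) t" by (intro continuous_intros)
    then obtain T where T: "open T" "t \<in> T" "\<And>s. s \<in> T \<Longrightarrow> v s - w s \<in> - {0}"
      using False unfolding continuous_at_open by (elim allE[of _ "- {0}"]) auto
    show ?thesis
    proof (rule that)
      show "open (T1 \<inter> T2 \<inter> T)" "t \<in> T1 \<inter> T2 \<inter> T" "T1 \<inter> T2 \<inter> T \<subseteq> J1 \<inter> J2"
        using o T1 T2 T by auto
      have "\<not> agree \<gamma>1 \<gamma>2 s" if s: "s \<in> T1 \<inter> T2 \<inter> T" for s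
        using agree_iff[of s] T(3)[of s] s by auto
      then show "(\<forall>s\<in>T1 \<inter> T2 \<inter> T. agree \<gamma>1 \<gamma>2 s) \<or>
        (\<forall>s\<in>T1 \<inter> T2 \<inter> T. \<not> agree \<gamma>1 \<gamma>2 s)" by blast
    qed
  qed
qed

text \<open>The set of agreement is open and closed in the common interval, which is connected. Near
  parameters where the points themselves differ, the Hausdorff property separates the
  curves.\<close>

lemma geodesic_unique:
  assumes g: "geodesic M J1 \<gamma>1" "geodesic M J2 \<gamma>2" and t0: "t0 \<in> J1 \<inter> J2"
    and "\<gamma>1 t0 = \<gamma>2 t0" "velocity M \<gamma>1 t0 = velocity M \<gamma>2 t0" and t: "t \<in> J1 \<inter> J2"
  shows "\<gamma>1 t = \<gamma>2 t"
proof -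
  define J where "J = J1 \<inter> J2"
  have J12: "open J1" "open J2" "is_interval J1" "is_interval J2" "continuous_on J1 \<gamma>1" "continuous_on J2 \<gamma>2"
    using g by (auto simp: geodesic_def smooth_curve_def smooth_into_def)
  have oJ: "open J" and conn: "connected J"
    using J12 is_interval_Int is_interval_connected by (auto simp: J_def)
  define P where "P s \<longleftrightarrow> agree \<gamma>1 \<gamma>2 s" for s
  have loc: "\<exists>T. open T \<and> s \<in> T \<and> T \<subseteq> J \<and> ((\<forall>r\<in>T. P r) \<or> (\<forall>r\<in>T. \<not> P r))" if s: "s \<in> J" for s
  proof (cases "\<gamma>1 s = \<gamma>2 s")
    case True
    have s12: "s \<in> J1" "s \<in> J2" using s by (auto simp: J_def)
    obtain T where "open T" "s \<in> T" "T \<subseteq> J1 \<inter> J2"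
      "(\<forall>r\<in>T. agree \<gamma>1 \<gamma>2 r) \<or>
       (\<forall>r\<in>T. \<not> agree \<gamma>1 \<gamma>2 r)"
      using geodesics_locally_agree[OF g s12 True] .
    then show ?thesis unfolding J_def P_def by (intro exI[of _ T] conjI)
  next
    case False
    obtain U1 U2 where U: "open U1" "open U2" "\<gamma>1 s \<in> U1" "\<gamma>2 s \<in> U2" "U1 \<inter> U2 = {}"
      using hausdorff[OF False] by (elim exE conjE)
    have "open (J1 \<inter> \<gamma>1 -` U1)" "open (J2 \<inter> \<gamma>2 -` U2)"
      using continuous_open_preimage J12 U by blast+
    then show ?thesis
      using s U by (intro exI[of _ "(J1 \<inter> \<gamma>1 -` U1) \<inter> (J2 \<inter> \<gamma>2 -` U2)"]) (auto simp: J_def P_def)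
  qed
  have "\<exists>T. open T \<and> s \<in> T \<and> T \<subseteq> {s \<in> J. P s}" if "s \<in> {s \<in> J. P s}" for s
    using loc[of s] that by blast
  then have "open {s \<in> J. P s}" using open_subopen by blast
  moreover have "\<exists>T. open T \<and> s \<in> T \<and> T \<subseteq> {s \<in> J. \<not> P s}" if "s \<in> {s \<in> J. \<not> P s}" for s
    using loc[of s] that by blast
  then have "open {s \<in> J. \<not> P s}" using open_subopen by blast
  moreover have "{s \<in> J. P s} \<inter> {s \<in> J. \<not> P s} \<inter> J = {}" "J \<subseteq> {s \<in> J. P s} \<union> {s \<in> J. \<not> P s}" by auto
  ultimately have "{s \<in> J. P s} \<inter> J = {} \<or> {s \<in> J. \<not> P s} \<inter> J = {}"
    using connectedD[OF conn] by metis
  moreover have "t0 \<in> {s \<in> J. P s} \<inter> J" using assms by (auto simp: J_def P_def)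
  ultimately have "P t" using t by (auto simp: J_def)
  then show ?thesis by (simp add: P_def)
qed

section \<open>The exponential map along geodesics\<close>

lemma exp_map_eq:
  assumes "geodesic M J \<gamma>" "{0..1} \<subseteq> J"
  shows "exp_map M (\<gamma> 0) (velocity M \<gamma> 0) = \<gamma> 1"
  unfolding exp_map_def
proof (rule the_equality)
  show "\<exists>J \<gamma>'. geodesic M J \<gamma>' \<and> {0..1} \<subseteq> J \<and> \<gamma>' 0 = \<gamma> 0 \<and> velocity M \<gamma>' 0 = velocity M \<gamma> 0 \<and> \<gamma>' 1 = \<gamma> 1"
    using assms by blast
  fix y assume "\<exists>J \<gamma>'. geodesic M J \<gamma>' \<and> {0..1} \<subseteq> J \<and> \<gamma>' 0 = \<gamma> 0 \<and> velocity M \<gamma>' 0 = velocity M \<gamma> 0 \<and> \<gamma>' 1 = y"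
  then obtain J' \<gamma>' where g: "geodesic M J' \<gamma>'" "{0..1} \<subseteq> J'" "\<gamma>' 0 = \<gamma> 0" "velocity M \<gamma>' 0 = velocity M \<gamma> 0" "\<gamma>' 1 = y"
    by (elim exE conjE)
  have m: "(0::real) \<in> J' \<inter> J" "(1::real) \<in> J' \<inter> J" using assms(2) g(2) by (auto simp: subset_iff)
  show "y = \<gamma> 1" using geodesic_unique[OF g(1) assms(1) m(1) g(3,4) m(2)] g(5) by simp
qed

text \<open>The geodesic \<open>t \<mapsto> \<gamma> (a * t)\<close> starts with the scaled velocity
  and is defined on the unit interval, because the interval \<open>J\<close> contains everything
  between 0 and \<open>a\<close>, on either side of 0.\<close>

lemma exp_map_ray:
  assumes g: "geodesic M J \<gamma>" and "0 \<in> J" "a \<in> J"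
  shows "exp_map M (\<gamma> 0) (tscale a (velocity M \<gamma> 0)) = \<gamma> a"
    and "tscale a (velocity M \<gamma> 0) \<in> exp_domain M (\<gamma> 0)"
proof -
  have iv: "is_interval J" using g by (auto simp: geodesic_def smooth_curve_def)
  have sub: "{0..1} \<subseteq> {t. a * t \<in> J}"
  proof
    fix t :: real assume t: "t \<in> {0..1}"
    show "t \<in> {t. a * t \<in> J}"
    proof (cases "a \<ge> 0")
      case True
      then have "0 \<le> a * t" "a * t \<le> a" using t by (auto intro: mult_left_le)
      then show ?thesis using iv assms(2,3) unfolding is_interval_1 by blast
    next
      case False
      then have "a * t \<le> 0" "a \<le> a * t" using t by (auto simp: mult_le_0_iff mult_le_cancel_left2)
      then show ?thesis using iv assms(2,3) unfolding is_interval_1 by blast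
    qed
  qed
  note g' = geodesic_rescale(1)[OF g, of a]
  have v: "velocity M (\<lambda>t. \<gamma> (a * t)) 0 = tscale a (velocity M \<gamma> 0)"
    using geodesic_rescale(2)[OF g, of a 0] assms(2) by simp
  show "exp_map M (\<gamma> 0) (tscale a (velocity M \<gamma> 0)) = \<gamma> a"
    using exp_map_eq[OF g' sub] by (simp add: v)
  show "tscale a (velocity M \<gamma> 0) \<in> exp_domain M (\<gamma> 0)"
    unfolding exp_domain_def
  proof (intro CollectI conjI)
    have "velocity M (\<lambda>t. \<gamma> (a * t)) 0 \<in> tangent_space M (\<gamma> (a * 0))"
      by (rule geodesic_velocity_tangent[OF g']) (use assms in simp)
    then show "tscale a (velocity M \<gamma> 0) \<in> tangent_space M (\<gamma> 0)" by (simp add: v)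
    show "\<exists>J' \<gamma>'. geodesic M J' \<gamma>' \<and> {0..1} \<subseteq> J' \<and> \<gamma>' 0 = \<gamma> 0 \<and> velocity M \<gamma>' 0 = tscale a (velocity M \<gamma> 0)"
      using g' sub v by (intro exI[of _ "{t. a * t \<in> J}"] exI[of _ "\<lambda>t. \<gamma> (a * t)"]) simp
  qed
qed

lemma exp_domain_geodesic:
  assumes "v \<in> exp_domain M x"
  obtains J \<gamma> where "geodesic M J \<gamma>" "{0..1} \<subseteq> J" "\<gamma> 0 = x" "velocity M \<gamma> 0 = v"
    "\<And>a. a \<in> J \<Longrightarrow> exp_map M x (tscale a v) = \<gamma> a"
proof -
  obtain J \<gamma> where g: "geodesic M J \<gamma>" "{0..1} \<subseteq> J" "\<gamma> 0 = x" "velocity M \<gamma> 0 = v"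
    using assms unfolding exp_domain_def by blast
  have "0 \<in> J" using g(2) by (auto simp: subset_iff)
  then have "exp_map M x (tscale a v) = \<gamma> a" if "a \<in> J" for a
    using exp_map_ray(1)[OF g(1) _ that] g(3,4) by simp
  from that[OF g this] show ?thesis .
qed

end

section \<open>Christoffel symbols of a locally symmetric connection in normal coordinates\<close>

text \<open>The curvature \<open>R(u, v)w\<close> for constant fields; \<open>fd G x u v w\<close>
  is the derivative of the symbols in direction \<open>u\<close>, evaluated on \<open>v\<close> and
  \<open>w\<close>.\<close>

definition curv :: "('e::euclidean_space \<Rightarrow> 'e \<Rightarrow>\<^sub>L 'e \<Rightarrow>\<^sub>L 'e) \<Rightarrow> 'e \<Rightarrow> 'e \<Rightarrow> 'e \<Rightarrow> 'e \<Rightarrow> 'e" where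
  "curv G x u v w = fd G x u v w - fd G x v u w + G x u (G x v w) - G x v (G x u w)"

definition lift_linear :: "('e::euclidean_space \<Rightarrow> 'b::real_normed_vector) \<Rightarrow> 'e \<Rightarrow>\<^sub>L 'b" where
  "lift_linear g = (\<Sum>b\<in>Basis. blinfun_scaleR_left (g b) o\<^sub>L blinfun_inner_left b)"

lemma lift_linear_apply: "linear g \<Longrightarrow> lift_linear g v = g v"
  unfolding lift_linear_def by (simp add: blinfun.sum_left linear_sum_Basis[of g v])

lemma has_vector_derivative_lift_linear:
  assumes "\<And>b. b \<in> Basis \<Longrightarrow> ((\<lambda>t. g t b) has_vector_derivative g' b) (at t within S)"
  shows "((\<lambda>t. lift_linear (g t)) has_vector_derivative lift_linear g') (at t within S)"
  unfolding lift_linear_def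
proof (rule has_vector_derivative_sum)
  fix b :: 'a assume b: "b \<in> Basis"
  have L: "bounded_linear (\<lambda>X. blinfun_scaleR_left X o\<^sub>L blinfun_inner_left b)"
    by (rule bounded_linear_compose[OF
        bounded_bilinear.bounded_linear_left[OF bounded_bilinear_blinfun_compose] bounded_linear_blinfun_scaleR_left])
  show "((\<lambda>t. blinfun_scaleR_left (g t b) o\<^sub>L blinfun_inner_left b) has_vector_derivative
      blinfun_scaleR_left (g' b) o\<^sub>L blinfun_inner_left b) (at t within S)"
    by (rule bounded_linear.has_vector_derivative[OF L assms[OF b]])
qed

lemmas blinfun_apply_has_vector_derivative =
  bounded_bilinear.has_vector_derivative[OF bounded_bilinear_blinfun_apply]

lemma smooth_on_curv:
  fixes G :: "'e::euclidean_space \<Rightarrow> 'e \<Rightarrow>\<^sub>L 'e \<Rightarrow>\<^sub>L 'e"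
  assumes "open S" "smooth_on S G" "smooth_on S u" "smooth_on S v" "smooth_on S w"
  shows "smooth_on S (\<lambda>x. curv G x (u x) (v x) (w x))"
  unfolding curv_def
  by (intro smooth_on_add smooth_on_diff smooth_on_blinfun_apply smooth_on_fd_joint assms)

text \<open>Normal coordinates detached from the manifold. \<open>radial\<close> says that rays are
  geodesics with constant velocity, \<open>sym\<close> is vanishing torsion, and
  \<open>parallel_curv\<close> is \<open>\<nabla>R = 0\<close> on constant fields.\<close>

locale symmetric_normal_coords =
  fixes W :: "'e::euclidean_space set" and G :: "'e \<Rightarrow> 'e \<Rightarrow>\<^sub>L 'e \<Rightarrow>\<^sub>L 'e"
  assumes open_W: "open W" and zero_W: "0 \<in> W"
    and star: "x \<in> W \<Longrightarrow> t \<in> {0..1} \<Longrightarrow> t *\<^sub>R x \<in> W" and neg_W: "x \<in> W \<Longrightarrow> - x \<in> W"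
    and smooth_G: "smooth_on W G" and sym: "x \<in> W \<Longrightarrow> G x u v = G x v u"
    and radial: "x \<in> W \<Longrightarrow> G x x x = 0"
    and parallel_curv: "x \<in> W \<Longrightarrow> fd (\<lambda>y. curv G y a b c) x w =
      - G x w (curv G x a b c) + curv G x (G x w a) b c + curv G x a (G x w b) c + curv G x a b (G x w c)"
begin

lemma linear_fd_G: "x \<in> W \<Longrightarrow> linear (fd G x)"
  by (rule linear_fd_smooth[OF smooth_G])

lemmas fd_G_simps = linear_add[OF linear_fd_G] linear_cmul[OF linear_fd_G] linear_0[OF linear_fd_G]
  linear_neg[OF linear_fd_G] linear_diff[OF linear_fd_G]

lemmas bl_simps = blinfun.add_left blinfun.add_right blinfun.scaleR_left blinfun.scaleR_right
  blinfun.minus_left blinfun.minus_right blinfun.diff_left blinfun.diff_right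
  blinfun.zero_left blinfun.zero_right

lemma curv_linear:
  assumes "x \<in> W"
  shows "linear (\<lambda>u. curv G x u v w)" "linear (\<lambda>v. curv G x u v w)" "linear (\<lambda>w. curv G x u v w)"
  by (auto intro!: linearI simp: curv_def fd_G_simps[OF assms] bl_simps algebra_simps)

lemma curv_minus: "x \<in> W \<Longrightarrow> curv G x (- u) v w = - curv G x u v w"
  using linear_neg[OF curv_linear(1)] .

lemma has_derivative_G: "x \<in> W \<Longrightarrow> (G has_derivative fd G x) (at x)"
  by (rule smooth_on_has_derivative[OF smooth_G])

lemma fd_G_sym: "x \<in> W \<Longrightarrow> fd G x w u v = fd G x w v u"
proof -
  assume x: "x \<in> W"
  have d: "((\<lambda>y. G y u v) has_derivative (\<lambda>w. fd G x w u v)) (at x)" for u v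
    by (rule bounded_linear.has_derivative[OF bounded_linear_compose[OF
            bounded_bilinear.bounded_linear_left[OF bounded_bilinear_blinfun_apply]
            bounded_bilinear.bounded_linear_left[OF bounded_bilinear_blinfun_apply]] has_derivative_G[OF x]])
  have "fd (\<lambda>y. G y u v) x = fd (\<lambda>y. G y v u) x"
    by (rule fd_cong[OF open_W x sym])
  then show ?thesis unfolding fd_eq[OF d] by metis
qed

text \<open>For \<open>t > 0\<close> the factor \<open>t^2\<close> divides out of
  \<open>radial\<close>; the value at the origin follows by continuity.\<close>

lemma radial_line:
  assumes "x \<in> W" "t \<in> {0..1}"
  shows "G (t *\<^sub>R x) x x = 0"
proof -
  have "continuous_on (closure {0<..<1}) (\<lambda>t. G (t *\<^sub>R x) x x)"
    using star[OF assms(1)]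
    by (intro continuous_intros continuous_on_compose2[OF smooth_on_continuous_on[OF smooth_G]]) auto
  then show ?thesis
  proof (rule continuous_constant_on_closure)
    fix s :: real assume s: "s \<in> {0<..<1}"
    have "G (s *\<^sub>R x) (s *\<^sub>R x) (s *\<^sub>R x) = 0" by (rule radial[OF star[OF assms(1)]]) (use s in auto)
    then show "G (s *\<^sub>R x) x x = 0" using s by (simp add: bl_simps)
  qed (use assms(2) in simp)
qed

text \<open>Every direction is tangent to a ray inside \<open>W\<close>, so the quadratic form at
  the origin vanishes; polarization of the symmetric symbol does the rest.\<close>

lemma G_zero: "G 0 = 0"
proof -
  have sq: "G 0 u u = 0" for u
  proof -
    have "\<forall>\<^sub>F e in at_right (0::real). e *\<^sub>R u \<in> W"
      by (rule topological_tendstoD[OF _ open_W, of "\<lambda>e. e *\<^sub>R u" 0]) (auto intro!: tendsto_eq_intros simp: zero_W)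
    then have "\<forall>\<^sub>F e in at_right (0::real). e *\<^sub>R u \<in> W \<and> e > 0"
      using eventually_at_right_less[of 0] by eventually_elim simp
    then obtain e :: real where "e *\<^sub>R u \<in> W" "e > 0"
      using eventually_happens[of _ "at_right (0::real)"] by (auto simp: trivial_limit_at_right_real)
    then show ?thesis using radial_line[of "e *\<^sub>R u" 0] by (simp add: bl_simps)
  qed
  have "G 0 u v = 0" for u v
  proof -
    have "0 = G 0 (u + v) (u + v)" by (simp only: sq)
    also have "\<dots> = G 0 u v + G 0 v u" by (simp add: bl_simps sq)
    also have "\<dots> = 2 *\<^sub>R G 0 u v" using sym[OF zero_W, of u v] by (simp add: scaleR_2)
    finally show ?thesis by simp
  qed
  then show ?thesis by (intro blinfun_eqI) simp
qed

text \<open>Derivative of the identity \<open>G y y y = 0\<close> in direction \<open>v\<close>,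
  with the two undifferentiated terms merged by symmetry. It controls a derivative transversal to
  the ray.\<close>

lemma fd_radial:
  assumes y: "y \<in> W"
  shows "fd G y v y y = - 2 *\<^sub>R G y v y"
proof -
  have "((\<lambda>y. G y y y) has_derivative (\<lambda>h. G y y h + (G y h + fd G y h y) y)) (at y)"
    by (intro bounded_bilinear.FDERIV[OF bounded_bilinear_blinfun_apply] has_derivative_G[OF y] has_derivative_ident)
  moreover have "((\<lambda>y. G y y y) has_derivative (\<lambda>h. 0)) (at y)"
    by (rule has_derivative_transform_within_open[OF has_derivative_const open_W y]) (simp add: radial)
  ultimately have "(\<lambda>h. G y y h + (G y h + fd G y h y) y) = (\<lambda>h. 0)"
    by (rule has_derivative_unique)
  then have "G y y v + (G y v + fd G y v y) y = 0" by metis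
  then show ?thesis using sym[OF y, of y v] by (simp add: bl_simps scaleR_2 eq_neg_iff_add_eq_0 algebra_simps)
qed

section \<open>The Riccati system along a ray\<close>

definition A :: "'e \<Rightarrow> real \<Rightarrow> 'e \<Rightarrow>\<^sub>L 'e" where "A x t = G (t *\<^sub>R x) x"
definition \<rho> :: "'e \<Rightarrow> real \<Rightarrow> 'e \<Rightarrow>\<^sub>L 'e" where "\<rho> x t = lift_linear (\<lambda>v. curv G (t *\<^sub>R x) x v x)"

context
  fixes x assumes x: "x \<in> W"
begin

lemma line_in: "t \<in> {0..1} \<Longrightarrow> t *\<^sub>R x \<in> W"
  using star x by blast

lemma \<rho>_apply: "t \<in> {0..1} \<Longrightarrow> \<rho> x t v = curv G (t *\<^sub>R x) x v x"
  unfolding \<rho>_def by (rule lift_linear_apply[OF curv_linear(2)[OF line_in]])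

lemma line_derivative: "((\<lambda>t. t *\<^sub>R x) has_vector_derivative x) (at t within S)"
  by (auto intro!: derivative_eq_intros)

lemma G_line_derivative:
  "t \<in> {0..1} \<Longrightarrow> ((\<lambda>t. G (t *\<^sub>R x)) has_vector_derivative fd G (t *\<^sub>R x) x) (at t within S)"
  by (rule smooth_on_has_derivative_along[OF smooth_G line_in line_derivative])

lemma A_derivative:
  "t \<in> {0..1} \<Longrightarrow> (A x has_vector_derivative fd G (t *\<^sub>R x) x x) (at t within S)"
  unfolding A_def[abs_def]
  by (rule bounded_linear.has_vector_derivative[OF
        bounded_bilinear.bounded_linear_left[OF bounded_bilinear_blinfun_apply] G_line_derivative])

text \<open>In \<open>\<rho> x t v\<close> the only derivative leaving the ray is the one in
  direction \<open>v\<close>, evaluated on \<open>x\<close>, \<open>x\<close>. Times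
  \<open>t ^ 2\<close> it equals \<open>- (2 * t) *\<^sub>R A x t v\<close> by
  \<open>fd_radial\<close>; moved to the other side, this completes \<open>t ^ 2\<close> times the
  derivative of \<open>A\<close> to the derivative of the weighted operator.\<close>

lemma riccati:
  assumes t: "t \<in> {0..1}"
  shows "((\<lambda>t. t ^ 2 *\<^sub>R A x t) has_vector_derivative t ^ 2 *\<^sub>R (\<rho> x t - (A x t o\<^sub>L A x t))) (at t within {0..1})"
proof -
  have "t ^ 2 *\<^sub>R \<rho> x t v = t ^ 2 *\<^sub>R fd G (t *\<^sub>R x) x x v + (2 * t) *\<^sub>R A x t v + t ^ 2 *\<^sub>R A x t (A x t v)" for v
  proof -
    note y = line_in[OF t]
    have "t ^ 2 *\<^sub>R fd G (t *\<^sub>R x) v x x = fd G (t *\<^sub>R x) v (t *\<^sub>R x) (t *\<^sub>R x)"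
      by (simp add: bl_simps power2_eq_square)
    also have "\<dots> = - 2 *\<^sub>R G (t *\<^sub>R x) v (t *\<^sub>R x)" by (rule fd_radial[OF y])
    also have "\<dots> = - (2 * t) *\<^sub>R A x t v"
      unfolding sym[OF y, of v] by (simp add: A_def bl_simps)
    finally show ?thesis
      using radial_line[OF x t] fd_G_sym[OF y, of x v x] sym[OF y, of v x]
      by (simp add: \<rho>_apply[OF t] curv_def scaleR_diff_right scaleR_add_right bl_simps A_def)
  qed
  then have *: "t ^ 2 *\<^sub>R (\<rho> x t - (A x t o\<^sub>L A x t)) = t ^ 2 *\<^sub>R fd G (t *\<^sub>R x) x x + (2 * t) *\<^sub>R A x t"
    by (intro blinfun_eqI) (simp add: bl_simps scaleR_diff_right)
  have "((\<lambda>t. t ^ 2) has_real_derivative 2 * t) (at t within {0..1})"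
    by (auto intro!: derivative_eq_intros)
  from has_vector_derivative_scaleR[OF this A_derivative[OF t]]
  show ?thesis unfolding * .
qed

text \<open>The ray direction fills the first and third slots of the curvature. Their corrections in
  \<open>parallel_curv\<close> vanish by \<open>radial_line\<close>, and the remaining two terms
  form a commutator.\<close>

lemma \<rho>_derivative:
  assumes t: "t \<in> {0..1}"
  shows "(\<rho> x has_vector_derivative (\<rho> x t o\<^sub>L A x t) - (A x t o\<^sub>L \<rho> x t)) (at t within S)"
proof -
  note y = line_in[OF t]
  define g' where "g' v = - A x t (curv G (t *\<^sub>R x) x v x) + curv G (t *\<^sub>R x) x (A x t v) x" for v
  have "((\<lambda>t. curv G (t *\<^sub>R x) x v x) has_vector_derivative g' v) (at t within S)" for v
  proof -
    have "smooth_on W (\<lambda>y. curv G y x v x)"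
      by (intro smooth_on_curv open_W smooth_G smooth_on_const)
    from smooth_on_has_derivative_along[OF this y line_derivative]
    show ?thesis
      using radial_line[OF x t] linear_0[OF curv_linear(1)[OF y]] linear_0[OF curv_linear(3)[OF y]]
      by (simp add: parallel_curv[OF y] g'_def A_def)
  qed
  then have "(\<rho> x has_vector_derivative lift_linear g') (at t within S)"
    unfolding \<rho>_def[abs_def] by (rule has_vector_derivative_lift_linear)
  moreover have "linear g'"
    unfolding g'_def
    by (intro linearI) (simp_all add: linear_add[OF curv_linear(2)[OF y]] linear_cmul[OF curv_linear(2)[OF y]] bl_simps algebra_simps)
  then have "lift_linear g' = (\<rho> x t o\<^sub>L A x t) - (A x t o\<^sub>L \<rho> x t)"
    by (intro blinfun_eqI, subst lift_linear_apply) (simp_all add: g'_def bl_simps \<rho>_apply[OF t])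
  ultimately show ?thesis by simp
qed

lemma continuous_on_A: "continuous_on {0..1} (A x)"
  by (simp add: continuous_on_eq_continuous_within has_vector_derivative_continuous[OF A_derivative])

lemma continuous_on_\<rho>: "continuous_on {0..1} (\<rho> x)"
  by (simp add: continuous_on_eq_continuous_within has_vector_derivative_continuous[OF \<rho>_derivative])

end

lemma bounded_on_Icc:
  fixes f :: "real \<Rightarrow> 'b::real_normed_vector"
  assumes "continuous_on {0..1} f"
  obtains c where "c \<ge> 0" "\<And>t. t \<in> {0..1} \<Longrightarrow> norm (f t) \<le> c"
proof -
  have "bounded (f ` {0..1})" by (intro compact_imp_bounded compact_continuous_image assms compact_Icc)
  then obtain c where c: "\<And>t. t \<in> {0..1} \<Longrightarrow> norm (f t) \<le> c" unfolding bounded_iff by blast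
  have "0 \<le> norm (f 0)" by simp
  also have "\<dots> \<le> c" using c[of 0] by simp
  finally show ?thesis using that c by blast
qed

text \<open>The pairs \<open>(A, \<rho>)\<close> for \<open>x\<close> and for \<open>- x\<close>
  solve one system, so their differences satisfy the singular estimate. The \<open>\<rho>\<close>
  components agree at 0, being quadratic in the direction there; for the \<open>A\<close> components
  continuity suffices.\<close>

lemma G_radial_odd:
  assumes x: "x \<in> W"
  shows "G (- x) x = - G x x"
proof -
  note x' = neg_W[OF x]
  obtain c1 where c1: "c1 \<ge> 0" "\<And>t. t \<in> {0..1} \<Longrightarrow> norm (A x t) \<le> c1" using bounded_on_Icc[OF continuous_on_A[OF x]] by blast
  obtain c2 where c2: "c2 \<ge> 0" "\<And>t. t \<in> {0..1} \<Longrightarrow> norm (A (- x) t) \<le> c2" using bounded_on_Icc[OF continuous_on_A[OF x']] by blast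
  obtain c3 where c3: "c3 \<ge> 0" "\<And>t. t \<in> {0..1} \<Longrightarrow> norm (\<rho> x t) \<le> c3" using bounded_on_Icc[OF continuous_on_\<rho>[OF x]] by blast
  \<comment> \<open>Collects the coefficients of both estimates below: \<open>1\<close>,
    \<open>c1\<close> and \<open>c2\<close> from the Riccati equation, \<open>2 * c2\<close> and
    \<open>2 * c3\<close> from the commutator equation.\<close>
  define K where "K = 1 + c1 + 2 * c2 + 2 * c3"
  let ?f = "\<lambda>t. A x t - A (- x) t" and ?g = "\<lambda>t. \<rho> x t - \<rho> (- x) t"
  let ?f' = "\<lambda>t. (\<rho> x t - (A x t o\<^sub>L A x t)) - (\<rho> (- x) t - (A (- x) t o\<^sub>L A (- x) t))"
  let ?g' = "\<lambda>t. ((\<rho> x t o\<^sub>L A x t) - (A x t o\<^sub>L \<rho> x t)) - ((\<rho> (- x) t o\<^sub>L A (- x) t) - (A (- x) t o\<^sub>L \<rho> (- x) t))"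
  have comp: "norm (a o\<^sub>L b) \<le> norm a * norm b" for a b :: "'e \<Rightarrow>\<^sub>L 'e" by (rule norm_blinfun_compose)
  have tri: "norm (a - b - c) \<le> norm a + norm b + norm c" for a b c :: "'e \<Rightarrow>\<^sub>L 'e"
    using norm_triangle_ineq4[of "a - b" c] norm_triangle_ineq4[of a b] by linarith
  have "?f 1 = 0 \<and> ?g 1 = 0"
  proof (rule singular_gronwall[where n=2 and K=K and T=1 and f'="?f'" and g'="?g'"])
    fix t :: real assume t: "t \<in> {0..1}"
    show "((\<lambda>t. t ^ 2 *\<^sub>R ?f t) has_vector_derivative t ^ 2 *\<^sub>R ?f' t) (at t within {0..1})"
      using has_vector_derivative_diff[OF riccati[OF x t] riccati[OF x' t]] by (simp add: scaleR_diff_right)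
    show "(?g has_vector_derivative ?g' t) (at t within {0..1})"
      by (rule has_vector_derivative_diff[OF \<rho>_derivative[OF x t] \<rho>_derivative[OF x' t]])
    \<comment> \<open>Differences of products are telescoped, so that every summand contains
      \<open>?f t\<close> or \<open>?g t\<close>.\<close>
    have f': "?f' t = ?g t - (?f t o\<^sub>L A x t) - (A (- x) t o\<^sub>L ?f t)"
      by (intro blinfun_eqI) (simp add: bl_simps)
    have "norm (?f' t) \<le> norm (?g t) + norm (?f t) * c1 + c2 * norm (?f t)"
      unfolding f' using c1 c2 t
      by (intro order.trans[OF tri] add_mono order.trans[OF comp] mult_left_mono mult_right_mono order.refl) auto
    also have "\<dots> \<le> K * (norm (?f t) + norm (?g t))"
      using c1(1) c2(1) c3(1) by (simp add: K_def algebra_simps add_increasing)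
    finally show "norm (?f' t) \<le> K * (norm (?f t) + norm (?g t))" .
    have g': "?g' t = ((?g t o\<^sub>L A (- x) t) + (\<rho> x t o\<^sub>L ?f t)) - ((?f t o\<^sub>L \<rho> x t) + (A (- x) t o\<^sub>L ?g t))"
      by (intro blinfun_eqI) (simp add: bl_simps)
    have "norm (?g' t) \<le> (norm (?g t) * c2 + c3 * norm (?f t)) + (norm (?f t) * c3 + c2 * norm (?g t))"
      unfolding g' using c3 c2 t
      by (intro norm_triangle_le_diff norm_triangle_le add_mono order.trans[OF comp] mult_left_mono mult_right_mono) auto
    also have "\<dots> \<le> K * (norm (?f t) + norm (?g t))"
      using c1(1) c2(1) c3(1) by (simp add: K_def algebra_simps add_increasing)
    finally show "norm (?g' t) \<le> K * (norm (?f t) + norm (?g t))" .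
  next
    show "continuous_on {0..1} ?f" by (intro continuous_intros continuous_on_A x x')
    show "?g 0 = 0" using curv_minus[OF zero_W] linear_neg[OF curv_linear(3)[OF zero_W]]
      by (intro blinfun_eqI) (simp add: bl_simps \<rho>_apply x x')
  qed (use c1 c2 c3 in \<open>auto simp: K_def\<close>)
  then have "G x x = G (- x) (- x)" by (simp add: A_def)
  then show ?thesis by (simp add: bl_simps)
qed

text \<open>\<open>G_radial_odd\<close> at the point \<open>t *\<^sub>R x\<close> yields the second
  identity after division by \<open>t\<close>; at \<open>t = 0\<close> both sides vanish by
  \<open>G_zero\<close>.\<close>

lemma A_even:
  assumes x: "x \<in> W" and t: "t \<in> {0..1}"
  shows "A (- x) t = A x t" "G (- (t *\<^sub>R x)) x = - A x t"
proof -
  show 2: "G (- (t *\<^sub>R x)) x = - A x t"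
  proof (cases "t = 0")
    case False
    then have "t *\<^sub>R G (- (t *\<^sub>R x)) x = t *\<^sub>R - A x t"
      using G_radial_odd[OF line_in[OF x t]] by (simp add: A_def bl_simps)
    then show ?thesis using False by (metis real_vector.scale_left_imp_eq)
  qed (simp add: A_def G_zero)
  then show "A (- x) t = A x t" by (simp add: A_def bl_simps)
qed

text \<open>Obtained by differentiating \<open>G (- y) (- y) = G y y\<close> in an arbitrary
  direction. It later exchanges transversal derivatives of the symbols for their values.\<close>

lemma fd_G_radial_odd:
  assumes y: "y \<in> W"
  shows "fd G (- y) v (- y) + G (- y) v = - (fd G y v y + G y v)"
proof -
  have d: "((\<lambda>y. G y y) has_derivative (\<lambda>h. G y h + fd G y h y)) (at y)" if "y \<in> W" for y
    by (intro bounded_bilinear.FDERIV[OF bounded_bilinear_blinfun_apply] has_derivative_G[OF that] has_derivative_ident)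
  have "((\<lambda>y. G (- y) (- y)) has_derivative (\<lambda>h. G (- y) (- h) + fd G (- y) (- h) (- y))) (at y)"
    using has_derivative_compose[OF has_derivative_minus[OF has_derivative_ident] d[OF neg_W[OF y]]] by simp
  moreover have "((\<lambda>y. G (- y) (- y)) has_derivative (\<lambda>h. G y h + fd G y h y)) (at y)"
    by (rule has_derivative_transform_within_open[OF d[OF y] open_W y]) (simp add: G_radial_odd bl_simps)
  ultimately have "(\<lambda>h. G (- y) (- h) + fd G (- y) (- h) (- y)) = (\<lambda>h. G y h + fd G y h y)"
    by (rule has_derivative_unique)
  then have "G (- y) (- v) + fd G (- y) (- v) (- y) = G y v + fd G y v y" by metis
  then show ?thesis using fd_G_simps(4)[OF neg_W[OF y], of v] by (simp add: bl_simps algebra_simps)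
qed

text \<open>The value is prescribed at the outer end \<open>t = 1\<close>, since the parity
  statements concern arbitrary vectors at \<open>x\<close>.\<close>

lemma parallel_field_exists:
  assumes x: "x \<in> W"
  obtains V where "V 1 = v" "\<And>t. t \<in> {0..1} \<Longrightarrow> (V has_vector_derivative - A x t (V t)) (at t within {0..1})"
proof -
  have "continuous_on {0..1} (\<lambda>t. - A x t)" by (intro continuous_intros continuous_on_A x)
  from linear_ode_exists[OF this, of 1 v] that show ?thesis by (auto simp: bl_simps)
qed

text \<open>Since \<open>R\<close> is parallel, \<open>R(u, V)Z\<close> is parallel along a ray with direction \<open>u\<close> whenever \<open>V\<close> and \<open>Z\<close> are.\<close>

lemma curv_parallel:
  assumes u: "u \<in> W" and t: "t \<in> {0..1}"
    and V: "(V has_vector_derivative - A u t (V t)) (at t within {0..1})"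
    and Z: "(Z has_vector_derivative - A u t (Z t)) (at t within {0..1})"
  shows "((\<lambda>t. curv G (t *\<^sub>R u) u (V t) (Z t)) has_vector_derivative
    - A u t (curv G (t *\<^sub>R u) u (V t) (Z t))) (at t within {0..1})"
proof -
  note y = line_in[OF u t]
  \<comment> \<open>Packed as a smooth operator-valued map, the curvature admits the product rule
    with the moving arguments \<open>V t\<close> and \<open>Z t\<close>.\<close>
  define B where "B y = bilift (\<lambda>b c. curv G y u b c)" for y
  have B: "B y v w = curv G y u v w" if "y \<in> W" for y v w
  proof -
    have "curv G y u v w = (\<Sum>b\<in>Basis. (v \<bullet> b) *\<^sub>R curv G y u b w)"
      by (rule linear_sum_Basis[OF curv_linear(2)[OF that]])
    also have "\<dots> = (\<Sum>b\<in>Basis. (v \<bullet> b) *\<^sub>R (\<Sum>c\<in>Basis. (w \<bullet> c) *\<^sub>R curv G y u b c))"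
      by (intro sum.cong refl arg_cong2[where f=scaleR] linear_sum_Basis[OF curv_linear(3)[OF that]])
    finally show ?thesis by (simp add: B_def bilift_apply)
  qed
  have sB: "smooth_on W B"
    unfolding B_def[abs_def] by (intro smooth_on_bilift open_W smooth_on_curv smooth_G smooth_on_const)
  have fdB: "fd B y h v w = fd (\<lambda>y. curv G y u v w) y h" if "y \<in> W" for y h v w
  proof -
    have "((\<lambda>y. B y v w) has_derivative (\<lambda>h. fd B y h v w)) (at y)"
      by (rule bounded_linear.has_derivative[OF bounded_linear_compose[OF
            bounded_bilinear.bounded_linear_left[OF bounded_bilinear_blinfun_apply]
            bounded_bilinear.bounded_linear_left[OF bounded_bilinear_blinfun_apply]] smooth_on_has_derivative[OF sB that]])
    then have "((\<lambda>y. curv G y u v w) has_derivative (\<lambda>h. fd B y h v w)) (at y)"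
      by (rule has_derivative_transform_within_open[OF _ open_W that]) (rule B)
    from fd_eq[OF this] show ?thesis by simp
  qed
  have "((\<lambda>t. B (t *\<^sub>R u) (V t) (Z t)) has_vector_derivative
      B (t *\<^sub>R u) (V t) (- A u t (Z t)) +
      (B (t *\<^sub>R u) (- A u t (V t)) + fd B (t *\<^sub>R u) u (V t)) (Z t)) (at t within {0..1})"
    by (intro blinfun_apply_has_vector_derivative Z V smooth_on_has_derivative_along[OF sB y line_derivative[OF u]])
  also have "B (t *\<^sub>R u) (V t) (- A u t (Z t)) + (B (t *\<^sub>R u) (- A u t (V t)) + fd B (t *\<^sub>R u) u (V t)) (Z t)
      = - A u t (curv G (t *\<^sub>R u) u (V t) (Z t))"
    using radial_line[OF u t] linear_0[OF curv_linear(1)[OF y]]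
      linear_neg[OF curv_linear(2)[OF y]] linear_neg[OF curv_linear(3)[OF y]]
    by (simp add: bl_simps fdB[OF y] B[OF y] parallel_curv[OF y] A_def[symmetric])
  finally show ?thesis
    by (rule has_vector_derivative_transform[rotated 2]) (use t B line_in[OF u] in auto)
qed

text \<open>As \<open>A (- x) t = A x t\<close>, the same \<open>V\<close> and \<open>Z\<close> are
  parallel along both opposite rays. Then \<open>s x + s (- x)\<close> solves a linear equation and
  vanishes at the common origin, where the two directions are opposite.\<close>

lemma curv_radial_odd:
  assumes x: "x \<in> W"
  shows "curv G (- x) x v w = curv G x x v w"
proof -
  obtain V where V: "V 1 = v" "\<And>t. t \<in> {0..1} \<Longrightarrow> (V has_vector_derivative - A x t (V t)) (at t within {0..1})"
    using parallel_field_exists[OF x] by blast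
  obtain Z where Z: "Z 1 = w" "\<And>t. t \<in> {0..1} \<Longrightarrow> (Z has_vector_derivative - A x t (Z t)) (at t within {0..1})"
    using parallel_field_exists[OF x] by blast
  obtain c where c: "c \<ge> 0" "\<And>t. t \<in> {0..1} \<Longrightarrow> norm (A x t) \<le> c" using bounded_on_Icc[OF continuous_on_A[OF x]] by blast
  define s where "s u t = curv G (t *\<^sub>R u) u (V t) (Z t)" for u t
  have ds: "(s u has_vector_derivative - A x t (s u t)) (at t within {0..1})" if "u \<in> {x, - x}" "t \<in> {0..1}" for u t
  proof -
    have "A u t = A x t" "u \<in> W" using that A_even(1)[OF x] neg_W[OF x] x by auto
    then show ?thesis unfolding s_def[abs_def] using curv_parallel[of u t V Z] V(2) Z(2) that(2) by simp
  qed
  have "s x 1 + s (- x) 1 = 0"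
  proof (rule gronwall_zero[where g="\<lambda>t. s x t + s (- x) t" and a=0 and b=1 and ?t0.0=0 and K=c
        and g'="\<lambda>t. - A x t (s x t) + - A x t (s (- x) t)"])
    fix t :: real assume t: "t \<in> {0..1}"
    show "((\<lambda>t. s x t + s (- x) t) has_vector_derivative - A x t (s x t) + - A x t (s (- x) t)) (at t within {0..1})"
      by (intro has_vector_derivative_add ds t) auto
    have "norm (- A x t (s x t) + - A x t (s (- x) t)) = norm (A x t (s x t + s (- x) t))"
      by (metis (no_types, lifting) blinfun.add_right minus_add_distrib norm_minus_cancel)
    also have "\<dots> \<le> c * norm (s x t + s (- x) t)"
      using norm_blinfun c(2)[OF t] by (meson mult_right_mono norm_ge_zero order.trans)
    finally show "norm (- A x t (s x t) + - A x t (s (- x) t)) \<le> c * norm (s x t + s (- x) t)" .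
  qed (use c in \<open>auto simp: s_def curv_minus zero_W\<close>)
  then show ?thesis
    using curv_minus[OF neg_W[OF x]] by (simp add: s_def V(1) Z(1))
qed

text \<open>The first argument \<open>v\<close> stays constant and only \<open>Z\<close> is
  parallel. In the difference of \<open>R(y, v)Z\<close> at \<open>y\<close> and \<open>- y\<close>,
  the radial derivatives belong to \<open>h'\<close>, the transversal ones turn into
  \<open>h\<close> by \<open>fd_G_radial_odd\<close>, and the quadratic terms containing
  \<open>A x t (Z t)\<close> are absorbed by the derivative of \<open>Z\<close>.\<close>

theorem G_odd:
  assumes x: "x \<in> W"
  shows "G (- x) = - G x"
proof (intro blinfun_eqI)
  fix v w
  note x' = neg_W[OF x]
  obtain Z where Z: "Z 1 = w" "\<And>t. t \<in> {0..1} \<Longrightarrow> (Z has_vector_derivative - A x t (Z t)) (at t within {0..1})"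
    using parallel_field_exists[OF x] by blast
  obtain c where c: "c \<ge> 0" "\<And>t. t \<in> {0..1} \<Longrightarrow> norm (A x t) \<le> c" using bounded_on_Icc[OF continuous_on_A[OF x]] by blast
  define h where "h t = G (t *\<^sub>R x) v (Z t) + G (t *\<^sub>R - x) v (Z t)" for t
  define h' where "h' t = fd G (t *\<^sub>R x) x v (Z t) + fd G (t *\<^sub>R - x) (- x) v (Z t)
      - G (t *\<^sub>R x) v (A x t (Z t)) - G (t *\<^sub>R - x) v (A x t (Z t))" for t
  have dh: "(h has_vector_derivative h' t) (at t within {0..1})" if t: "t \<in> {0..1}" for t
  proof -
    have "((\<lambda>t. G (t *\<^sub>R u) v (Z t)) has_vector_derivative
        G (t *\<^sub>R u) v (- A x t (Z t)) + fd G (t *\<^sub>R u) u v (Z t)) (at t within {0..1})" if "u \<in> W" for u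
      by (intro blinfun_apply_has_vector_derivative Z(2)[OF t] bounded_linear.has_vector_derivative[OF
          bounded_bilinear.bounded_linear_left[OF bounded_bilinear_blinfun_apply] G_line_derivative[OF that t]])
    from has_vector_derivative_add[OF this[OF x] this[OF x']]
    show ?thesis unfolding h_def[abs_def] h'_def by (simp add: bl_simps algebra_simps)
  qed
  have eq: "h t + t *\<^sub>R h' t = t *\<^sub>R - A x t (h t)" if t: "t \<in> {0..1}" for t
  proof -
    define y where "y = t *\<^sub>R x"
    define z where "z = Z t"
    have y: "y \<in> W" "- y \<in> W" using line_in[OF x t] neg_W by (auto simp: y_def)
    have Ay: "G y x = A x t" "G (- y) x = - A x t" using A_even(2)[OF x t] by (auto simp: A_def y_def)
    have e: "fd G p v y z = t *\<^sub>R fd G p v x z" "G p y u = t *\<^sub>R G p x u" for p u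
      by (simp_all only: y_def bl_simps)
    have e': "fd G p y v z = t *\<^sub>R fd G p x v z" if "p \<in> W" for p
      unfolding y_def using fd_G_simps(2)[OF that, of t x] by (simp add: bl_simps)
    have "curv G (- y) y v z = curv G y y v z" by (rule curv_radial_odd[OF y(1)])
    then have "t *\<^sub>R (fd G (- y) x v z - fd G y x v z) + (t *\<^sub>R fd G y v x z - t *\<^sub>R fd G (- y) v x z)
        - t *\<^sub>R A x t (G y v z + G (- y) v z) + t *\<^sub>R (G y v (A x t z) + G (- y) v (A x t z)) = 0"
      unfolding curv_def e e'[OF y(1)] e'[OF y(2)] Ay by (simp add: bl_simps algebra_simps)
    moreover have "t *\<^sub>R fd G y v x z - t *\<^sub>R fd G (- y) v x z = - (G y v z + G (- y) v z)"
      using arg_cong[OF fd_G_radial_odd[OF y(1), of v], of "\<lambda>X. blinfun_apply X z"]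
      by (simp add: bl_simps e algebra_simps)
    ultimately show ?thesis
      using fd_G_simps(4)[OF y(2), of x]
      by (simp add: h_def h'_def bl_simps algebra_simps flip: y_def z_def)
  qed
  \<comment> \<open>The equation reads \<open>(t h)' = - t A h\<close>, hence weight exponent 1; the
    second component of the singular estimate is taken to be zero.\<close>
  have "h 1 = 0 \<and> (0::'e) = 0"
  proof (rule singular_gronwall[where n=1 and K=c and T=1 and g="\<lambda>_. 0" and g'="\<lambda>_. 0" and f'="\<lambda>t. - A x t (h t)"])
    fix t :: real assume t: "t \<in> {0..1}"
    have "((\<lambda>t. t *\<^sub>R h t) has_vector_derivative t *\<^sub>R h' t + 1 *\<^sub>R h t) (at t within {0..1})"
      by (intro has_vector_derivative_scaleR dh t) (auto intro!: derivative_eq_intros)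
    then show "((\<lambda>t. t ^ 1 *\<^sub>R h t) has_vector_derivative t ^ 1 *\<^sub>R - A x t (h t)) (at t within {0..1})"
      using eq[OF t] by (simp add: add.commute)
    have "norm (A x t (h t)) \<le> c * norm (h t)"
      using norm_blinfun c(2)[OF t] by (meson mult_right_mono norm_ge_zero order.trans)
    then show "norm (- A x t (h t)) \<le> c * (norm (h t) + norm (0::'e))" by simp
  next
    show "continuous_on {0..1} h"
      by (simp add: continuous_on_eq_continuous_within has_vector_derivative_continuous[OF dh])
  qed (use c in auto)
  then show "G (- x) v w = (- G x) v w"
    by (simp add: h_def Z(1) bl_simps eq_neg_iff_add_eq_0 add.commute)
qed

end

section \<open>Torsion, curvature and parallel fields in a parametrization\<close>

context acs_space
begin

lemma torsion_eq_0:
  assumes "locally_symmetric M" "open U" "smooth_vfield M U X" "smooth_vfield M U Y" "x \<in> U"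
  shows "torsion M X Y x = tzero"
  using assms(1)[unfolded locally_symmetric_def, THEN conjunct2, THEN conjunct1] assms(2-) by blast

lemma nabla_curvature_eq_0:
  assumes "locally_symmetric M" "open U" "smooth_vfield M U T" "smooth_vfield M U X" "smooth_vfield M U Y"
    "smooth_vfield M U Z" "x \<in> U"
  shows "nabla_curvature M T X Y Z x = tzero"
  using assms(1)[unfolded locally_symmetric_def, THEN conjunct2, THEN conjunct2] assms(2-) by blast

end

context param
begin

lemma represents_tdiff:
  assumes "represents W' X f" "represents W' Y g"
  shows "represents W' (\<lambda>z. tdiff (X z) (Y z)) (\<lambda>x. f x - g x)"
  using assms by (auto simp: represents_def push_diff subset_iff intro: smooth_on_diff)

lemma represents_zero:
  "represents W' X f \<Longrightarrow> x \<in> W' \<Longrightarrow> X (\<phi> x) = tzero \<Longrightarrow> f x = 0"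
  unfolding represents_def using push_inject push_0 by (metis subsetD)

lemma represents_constant: "represents W (frame_field (\<lambda>_. u)) (\<lambda>_. u)"
  by (intro represents_frame_field open_W order_refl smooth_on_const)

lemma represents_nabla_constant: "represents W (nabla M (frame_field (\<lambda>_. u)) (frame_field (\<lambda>_. v))) (\<lambda>x. \<Gamma> x u v)"
  using represents_nabla[OF represents_constant represents_constant, of u v] by simp

lemma \<Gamma>_symmetric:
  assumes M: "locally_symmetric M" and x: "x \<in> W"
  shows "\<Gamma> x u v = \<Gamma> x v u"
proof -
  let ?X = "frame_field (\<lambda>_. u)" and ?Y = "frame_field (\<lambda>_. v)"
  have r: "represents W (torsion M ?X ?Y) (\<lambda>x. \<Gamma> x u v - \<Gamma> x v u - (fd (\<lambda>_. v) x u - fd (\<lambda>_. u) x v))"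
    unfolding torsion_def
    by (intro represents_tdiff represents_nabla_constant represents_lie_bracket represents_constant)
  have "torsion M ?X ?Y (\<phi> x) = tzero"
    by (rule torsion_eq_0[OF M open_range]) (use x in \<open>auto intro: represents_smooth_vfield represents_constant\<close>)
  from represents_zero[OF r x this] show ?thesis by simp
qed

lemma fd_nabla_expression:
  assumes "open W'" "W' \<subseteq> W" and g: "smooth_on W' g" and h: "smooth_on W' h" and x: "x \<in> W'"
  shows "fd (\<lambda>x. fd h x (g x) + \<Gamma> x (g x) (h x)) x a = fd (\<lambda>y. fd h y (g x)) x a + fd h x (fd g x a)
    + (fd \<Gamma> x a (g x) (h x) + \<Gamma> x (fd g x a) (h x) + \<Gamma> x (g x) (fd h x a))"
proof -
  have xW: "x \<in> W" using assms by blast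
  have "((\<lambda>x. fd h x (g x) + \<Gamma> x (g x) (h x)) has_derivative
      (\<lambda>a. fd (\<lambda>x. fd h x (g x)) x a + (\<Gamma> x (g x) (fd h x a) + (\<Gamma> x (fd g x a) + fd \<Gamma> x a (g x)) (h x)))) (at x)"
    by (intro has_derivative_add bounded_bilinear.FDERIV[OF bounded_bilinear_blinfun_apply]
        smooth_on_has_derivative[OF smooth_on_fd_joint[OF assms(1) h g] x]
        smooth_on_has_derivative[OF g x] smooth_on_has_derivative[OF h x] smooth_on_has_derivative[OF smooth_\<Gamma> xW])
  from fd_eq[OF this] show ?thesis
    by (simp add: fd_fd_joint[OF assms(1) h g x] blinfun.add_left)
qed

text \<open>Varying coordinates are essential: in \<open>nabla_curvature\<close> the slots contain
  fields such as \<open>nabla M W X\<close>, with coordinates \<open>\<Gamma> x w a\<close> even for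
  constant fields. The second derivatives of \<open>h\<close> cancel by symmetry, and those of first
  order against the bracket term.\<close>

lemma represents_curvature:
  assumes X: "represents W' X f" and Y: "represents W' Y g" and Z: "represents W' Z h"
  shows "represents W' (curvature M X Y Z) (\<lambda>x. curv \<Gamma> x (f x) (g x) (h x))"
proof -
  have W': "open W'" "W' \<subseteq> W" and s: "smooth_on W' f" "smooth_on W' g" "smooth_on W' h"
    using X Y Z by (auto simp: represents_def)
  let ?p = "\<lambda>g x. fd h x (g x) + \<Gamma> x (g x) (h x)"
  have "represents W' (curvature M X Y Z) (\<lambda>x. fd (?p g) x (f x) + \<Gamma> x (f x) (?p g x)
      - (fd (?p f) x (g x) + \<Gamma> x (g x) (?p f x)) - ?p (\<lambda>x. fd g x (f x) - fd f x (g x)) x)"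
    unfolding curvature_def
    by (intro represents_tdiff represents_nabla represents_lie_bracket X Y Z)
  then show ?thesis
  proof (rule represents_cong)
    fix x assume x: "x \<in> W'"
    have "fd (\<lambda>y. fd h y (g x)) x (f x) = fd (\<lambda>y. fd h y (f x)) x (g x)"
      by (rule fd_fd_commute[OF W'(1) x s(3)])
    then show "fd (?p g) x (f x) + \<Gamma> x (f x) (?p g x)
      - (fd (?p f) x (g x) + \<Gamma> x (g x) (?p f x)) - ?p (\<lambda>x. fd g x (f x) - fd f x (g x)) x = curv \<Gamma> x (f x) (g x) (h x)"
      using linear_diff[OF linear_fd_smooth[OF s(3) x]]
      by (simp add: fd_nabla_expression[OF W' s(2,3) x] fd_nabla_expression[OF W' s(1,3) x] curv_def
          blinfun.add_right blinfun.diff_left blinfun.diff_right algebra_simps)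
  qed
qed

lemma curv_\<Gamma>_parallel:
  assumes M: "locally_symmetric M" and x: "x \<in> W"
  shows "fd (\<lambda>y. curv \<Gamma> y a b c) x w =
    - \<Gamma> x w (curv \<Gamma> x a b c) + curv \<Gamma> x (\<Gamma> x w a) b c + curv \<Gamma> x a (\<Gamma> x w b) c + curv \<Gamma> x a b (\<Gamma> x w c)"
proof -
  let ?F = "\<lambda>u. frame_field (\<lambda>_. u)"
  have r: "represents W (nabla_curvature M (?F w) (?F a) (?F b) (?F c)) (\<lambda>x. fd (\<lambda>y. curv \<Gamma> y a b c) x w
      + \<Gamma> x w (curv \<Gamma> x a b c) - curv \<Gamma> x (\<Gamma> x w a) b c - curv \<Gamma> x a (\<Gamma> x w b) c - curv \<Gamma> x a b (\<Gamma> x w c))"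
    unfolding nabla_curvature_def
    by (intro represents_tdiff represents_nabla represents_curvature represents_nabla_constant represents_constant)
  have "nabla_curvature M (?F w) (?F a) (?F b) (?F c) (\<phi> x) = tzero"
    by (rule nabla_curvature_eq_0[OF M open_range])
      (use x in \<open>auto intro: represents_smooth_vfield represents_constant\<close>)
  from represents_zero[OF r x this] show ?thesis by (simp add: algebra_simps)
qed

section \<open>Parallel fields along a curve in a parametrization\<close>

lemma parallel_alongI:
  assumes J: "open J" "is_interval J" and y: "smooth_on J y" "\<And>s. s \<in> J \<Longrightarrow> y s \<in> W \<and> \<gamma> s = \<phi> (y s)"
    and dy: "\<And>s. s \<in> J \<Longrightarrow> (y has_vector_derivative v s) (at s)"
    and f: "smooth_on J f" "\<And>s. s \<in> J \<Longrightarrow> (f has_vector_derivative - \<Gamma> (y s) (v s) (f s)) (at s)"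
  shows "parallel_along M J \<gamma> (\<lambda>s. push (y s) (f s))"
  unfolding parallel_along_def
proof (intro conjI ballI)
  have sc: "smooth_into M J \<gamma>" by (rule smooth_into_\<phi>_curve[OF J(1) y])
  then show "smooth_curve M J \<gamma>" using J by (simp add: smooth_curve_def)
  have "smooth_on {s \<in> J. \<gamma> s \<in> cdom M i} (\<lambda>s. push (y s) (f s) i)" if i: "i \<in> charts M" for i
  proof -
    have oT: "open {s \<in> J. \<gamma> s \<in> cdom M i}"
      using open_chart_preimage[OF i J(1)] sc by (simp add: smooth_into_def)
    have "smooth_on {s \<in> J. \<gamma> s \<in> cdom M i} (\<lambda>s. fd (to_chart i) (y s) (f s))"
      by (rule smooth_on_fd_along[OF oT open_Wc[OF i open_W order_refl] smooth_on_to_chart[OF i]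
            smooth_on_subset[OF y(1)] smooth_on_subset[OF f(1)]]) (use y(2) in auto)
    then show ?thesis
      by (rule smooth_on_cong[OF oT, rotated]) (use y(2) i in \<open>auto simp: push_in_chart\<close>)
  qed
  then show "smooth_vfield_along M J \<gamma> (\<lambda>s. push (y s) (f s))"
    using y(2) push_tangent by (auto simp: smooth_vfield_along_def)
  fix t assume t: "t \<in> J"
  have "cov_deriv_along M \<gamma> (\<lambda>s. push (y s) (f s)) t = push (y t) (- \<Gamma> (y t) (v t) (f t) + \<Gamma> (y t) (v t) (f t))"
    by (rule cov_deriv_param[OF J(1) t y(2) refl dy[OF t] f(2)[OF t]])
  then show "cov_deriv_along M \<gamma> (\<lambda>s. push (y s) (f s)) t = tzero" using push_0 y(2)[OF t] by simp
qed

lemma parallel_alongD: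
  assumes P: "parallel_along M J \<gamma> V" and J': "open J'" "J' \<subseteq> J"
    and y: "smooth_on J' y" "\<And>s. s \<in> J' \<Longrightarrow> y s \<in> W \<and> \<gamma> s = \<phi> (y s)"
    and dy: "\<And>s. s \<in> J' \<Longrightarrow> (y has_vector_derivative v s) (at s)"
  obtains f where "\<And>s. s \<in> J' \<Longrightarrow> V s = push (y s) (f s)"
    "\<And>s. s \<in> J' \<Longrightarrow> (f has_vector_derivative - \<Gamma> (y s) (v s) (f s)) (at s)"
proof -
  define f where "f s = coords (y s) (V s)" for s
  have tan: "V s \<in> tangent_space M (\<phi> (y s))" if "s \<in> J'" for s
  proof -
    have "V s \<in> tangent_space M (\<gamma> s)"
      using P J' that by (auto simp: parallel_along_def smooth_vfield_along_def)
    then show ?thesis using y(2)[OF that] by simp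
  qed
  have V: "V s = push (y s) (f s)" if "s \<in> J'" for s
    using push_coords[OF _ tan[OF that]] y(2)[OF that] by (simp add: f_def)
  have "smooth_on J' f"
  proof (rule smooth_on_local[OF J'(1)])
    fix t assume t: "t \<in> J'"
    obtain i where i: "i \<in> charts M" "\<gamma> t \<in> cdom M i" using chart_exists charts_atD by blast
    let ?T = "{s \<in> J'. \<gamma> s \<in> cdom M i}"
    have c: "continuous_on J' \<gamma>" using smooth_into_\<phi>_curve[OF J'(1) y] by (simp add: smooth_into_def)
    have oT: "open ?T" by (rule open_chart_preimage[OF i(1) J'(1) c])
    have sy: "smooth_on ?T (\<lambda>s. to_chart i (y s))"
      by (rule smooth_on_compose[OF oT open_Wc[OF i(1) open_W order_refl] smooth_on_subset[OF y(1)] smooth_on_to_chart[OF i(1)]])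
        (use y(2) in auto)
    have sV: "smooth_on ?T (\<lambda>s. V s i)"
      using P i(1) J'(2) by (auto simp: parallel_along_def smooth_vfield_along_def intro: smooth_on_subset)
    have "smooth_on ?T (\<lambda>s. fd (from_chart i) (to_chart i (y s)) (V s i))"
      by (rule smooth_on_fd_along[OF oT open_Yc[OF i(1)] smooth_on_from_chart[OF i(1)] sy sV])
        (rule to_chart_in, use y(2) in auto)
    then have "smooth_on ?T f"
      by (rule smooth_on_cong[OF oT, rotated])
        (use y(2) i tan in \<open>auto simp: f_def coords_in_chart charts_at_def\<close>)
    then show "\<exists>T. open T \<and> t \<in> T \<and> smooth_on T f" using oT t i by blast
  qed
  then have df: "(f has_vector_derivative fd f s 1) (at s)" if "s \<in> J'" for s
    by (rule smooth_on_has_vector_derivative[OF _ that])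
  have "(f has_vector_derivative - \<Gamma> (y s) (v s) (f s)) (at s)" if s: "s \<in> J'" for s
  proof -
    have "push (y s) (fd f s 1 + \<Gamma> (y s) (v s) (f s)) = cov_deriv_along M \<gamma> V s"
      by (rule cov_deriv_param[OF J'(1) s y(2) V dy[OF s] df[OF s], symmetric])
    also have "\<dots> = push (y s) 0"
      using P s J'(2) push_0 y(2)[OF s] by (auto simp: parallel_along_def)
    finally have "fd f s 1 = - \<Gamma> (y s) (v s) (f s)"
      using push_inject y(2)[OF s] by (simp add: eq_neg_iff_add_eq_0)
    then show ?thesis using df[OF s] by simp
  qed
  from that[OF V this] show ?thesis .
qed

end

section \<open>Normal neighborhoods\<close>

context acs_space
begin

context
  fixes i x assumes ix: "i \<in> charts_at M x"
begin

interpretation C: param M "cmap M i ` cdom M i" "cinv M i" "cmap M i"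
  by (rule chart_param[OF charts_atD(1)[OF ix]])

lemma coord_field_eq_push: "coord_field M i u x = param.push M (cinv M i) (cmap M i x) u"
  using charts_atD[OF ix]
  by (auto simp: coord_field_def C.push_def fun_eq_iff cinv_cmap C.to_chart_def[abs_def] o_def)

lemma coord_field_at: "coord_field M i u x i = u"
  unfolding coord_field_eq_push by (rule chart_push_at[OF charts_atD[OF ix]])

lemma coord_field_tangent: "coord_field M i u x \<in> tangent_space M x"
  using C.push_tangent[of "cmap M i x" u] charts_atD[OF ix] by (simp add: coord_field_eq_push cinv_cmap)

lemma coord_field_inverse: "v \<in> tangent_space M x \<Longrightarrow> coord_field M i (v i) x = v"
  unfolding coord_field_eq_push by (rule chart_push[OF charts_atD[OF ix], symmetric])

lemma coord_field_scale: "coord_field M i (a *\<^sub>R u) x = tscale a (coord_field M i u x)"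
  unfolding coord_field_eq_push by (rule C.push_scale) (use charts_atD[OF ix] in auto)

lemma tangent_eqI: "v \<in> tangent_space M x \<Longrightarrow> w \<in> tangent_space M x \<Longrightarrow> v i = w i \<Longrightarrow> v = w"
  using coord_field_inverse by metis

lemma tscale_tangent: "v \<in> tangent_space M x \<Longrightarrow> tscale a v \<in> tangent_space M x"
  using coord_field_scale coord_field_inverse coord_field_tangent by metis

end

lemma tneg_eq_tscale: "tneg v = tscale (- 1) v"
  by (simp add: tneg_def tscale_def)

lemma tscale_tscale: "tscale a (tscale b v) = tscale (a * b) v"
  by (simp add: tscale_def)

lemma exp_domain_tangent: "exp_domain M x \<subseteq> tangent_space M x"
  by (auto simp: exp_domain_def)

lemma symmetric_normal_tscale:
  assumes N: "symmetric_normal M x V" and u: "u \<in> tangent_space M x"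
  obtains e where "e > 0" "\<And>t. \<bar>t\<bar> < e \<Longrightarrow> tscale t u \<in> V"
proof -
  obtain i where i: "i \<in> charts_at M x" using chart_exists by blast
  have V: "open ((\<lambda>v. v i) ` V)" "tzero \<in> V" "V \<subseteq> tangent_space M x"
    using N i exp_domain_tangent unfolding symmetric_normal_def by blast+
  have "0 \<in> (\<lambda>v. v i) ` V" using V(2) by (force simp: tzero_def)
  moreover have "isCont (\<lambda>t. t *\<^sub>R u i) (0::real)" by (intro continuous_intros)
  ultimately have "\<forall>\<^sub>F t in at (0::real). t *\<^sub>R u i \<in> (\<lambda>v. v i) ` V"
    using V(1) by (auto simp: isCont_def intro: topological_tendstoD)
  then obtain e where e: "e > 0" "\<And>t. t \<noteq> 0 \<Longrightarrow> \<bar>t\<bar> < e \<Longrightarrow> t *\<^sub>R u i \<in> (\<lambda>v. v i) ` V"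
    by (auto simp: eventually_at dist_real_def)
  have "tscale t u \<in> V" if t: "\<bar>t\<bar> < e" for t
  proof -
    obtain v where v: "v \<in> V" "v i = t *\<^sub>R u i"
      using e(2)[of t] t \<open>0 \<in> (\<lambda>v. v i) ` V\<close> by (cases "t = 0") auto
    then have "v = tscale t u"
      using tangent_eqI[OF i, of v "tscale t u"] V(3) tscale_tangent[OF i u] by (auto simp: tscale_def)
    then show ?thesis using v by simp
  qed
  then show ?thesis using that e(1) by blast
qed

text \<open>The vector \<open>u\<close> itself may lie outside the domain of the exponential map. A
  small multiple \<open>tscale e u\<close> lies in \<open>V\<close>, and its geodesic,
  reparametrized by \<open>1 / e\<close>, starts with velocity \<open>u\<close>.\<close>

lemma symmetric_normal_geodesic:
  assumes N: "symmetric_normal M x V" and u: "u \<in> tangent_space M x"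
  obtains J \<gamma> where "geodesic M J \<gamma>" "0 \<in> J" "\<gamma> 0 = x" "velocity M \<gamma> 0 = u"
    "\<And>t. t \<in> J \<Longrightarrow> exp_map M x (tscale t u) = \<gamma> t" "\<And>t. t \<in> J \<Longrightarrow> tscale t u \<in> exp_domain M x"
proof -
  obtain d where d: "d > 0" "\<And>t. \<bar>t\<bar> < d \<Longrightarrow> tscale t u \<in> V" using symmetric_normal_tscale[OF N u] by blast
  define e where "e = d / 2"
  have e: "e > 0" "tscale e u \<in> exp_domain M x"
    using d(1) d(2)[of e] N unfolding symmetric_normal_def e_def by auto
  obtain J \<gamma> where g: "geodesic M J \<gamma>" "{0..1} \<subseteq> J" "\<gamma> 0 = x" "velocity M \<gamma> 0 = tscale e u"
    using exp_domain_geodesic[OF e(2)] by metis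
  have J0: "0 \<in> J" using g(2) by (auto simp: subset_iff)
  let ?J = "{t. 1 / e * t \<in> J}" and ?\<gamma> = "\<lambda>t. \<gamma> (1 / e * t)"
  have g': "geodesic M ?J ?\<gamma>" by (rule geodesic_rescale(1)[OF g(1)])
  have v': "velocity M ?\<gamma> 0 = u"
    using geodesic_rescale(2)[OF g(1), of "1 / e" 0] J0 e(1) g(4) by (simp add: tscale_tscale) (simp add: tscale_def)
  show ?thesis
  proof (rule that[OF g'])
    show "exp_map M x (tscale t u) = ?\<gamma> t" "tscale t u \<in> exp_domain M x" if "t \<in> ?J" for t
      using exp_map_ray[OF g' _ that] J0 v' g(3) by simp_all
  qed (use J0 g(3) v' in auto)
qed

section \<open>Symmetric normal neighborhoods in coordinates\<close>

context
  fixes m V i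
  assumes N: "symmetric_normal M m V" and i: "i \<in> charts_at M m"
begin

text \<open>Normal coordinates at \<open>m\<close>; the tangent space is identified with the model space by the chart \<open>i\<close>.\<close>

definition nW :: "'e set" where "nW = (\<lambda>v. v i) ` V"
definition n\<phi> :: "'e \<Rightarrow> 'm" where "n\<phi> u = exp_map M m (coord_field M i u m)"
definition n\<psi> :: "'m \<Rightarrow> 'e" where "n\<psi> z = log_map M m V z i"

lemma V_tangent: "v \<in> V \<Longrightarrow> v \<in> tangent_space M m"
  using N exp_domain_tangent unfolding symmetric_normal_def by blast

lemma n\<phi>_at: "v \<in> tangent_space M m \<Longrightarrow> n\<phi> (v i) = exp_map M m v"
  by (simp add: n\<phi>_def coord_field_inverse[OF i])

lemma coord_in_V: "u \<in> nW \<Longrightarrow> coord_field M i u m \<in> V"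
  using V_tangent coord_field_inverse[OF i] by (auto simp: nW_def)

lemma n\<phi>_image: "n\<phi> ` nW = exp_map M m ` V"
  unfolding nW_def using n\<phi>_at[OF V_tangent] by (auto simp: image_image)

lemma log_n\<phi>: "u \<in> nW \<Longrightarrow> log_map M m V (n\<phi> u) = coord_field M i u m"
  unfolding log_map_def n\<phi>_def using N coord_in_V
  by (intro inv_into_f_f) (auto simp: symmetric_normal_def)

lemma normal_param: "param M nW n\<phi> n\<psi>"
proof
  show "open nW" "smooth_into M nW n\<phi>"
    using N i unfolding symmetric_normal_def nW_def n\<phi>_def[abs_def] by blast+
  show "open (n\<phi> ` nW)" using N unfolding n\<phi>_image symmetric_normal_def by blast
  show "smooth_from M (n\<phi> ` nW) n\<psi>"
    using N i unfolding n\<phi>_image symmetric_normal_def n\<psi>_def[abs_def] by blast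
  show "n\<psi> (n\<phi> u) = u" if "u \<in> nW" for u
    using log_n\<phi>[OF that] coord_field_at[OF i] by (simp add: n\<psi>_def)
qed

lemma nW_star: "u \<in> nW \<Longrightarrow> t \<in> {0..1} \<Longrightarrow> t *\<^sub>R u \<in> nW"
proof -
  assume "u \<in> nW" "t \<in> {0..1}"
  then have "tscale t (coord_field M i u m) \<in> V"
    using N coord_in_V unfolding symmetric_normal_def by blast
  then show "t *\<^sub>R u \<in> nW"
    unfolding nW_def by (rule rev_image_eqI) (simp add: tscale_def coord_field_at[OF i])
qed

lemma nW_neg: "u \<in> nW \<Longrightarrow> - u \<in> nW"
proof -
  assume "u \<in> nW"
  then have "tneg (coord_field M i u m) \<in> V"
    using N coord_in_V unfolding symmetric_normal_def by blast
  then show "- u \<in> nW"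
    unfolding nW_def by (rule rev_image_eqI) (simp add: tneg_def coord_field_at[OF i])
qed

lemma nW_zero: "0 \<in> nW"
  using N unfolding nW_def symmetric_normal_def tzero_def by force

lemma n\<phi>_scale: "n\<phi> (a *\<^sub>R u) = exp_map M m (tscale a (coord_field M i u m))"
  by (simp add: n\<phi>_def coord_field_scale[OF i])

lemma geodesic_symmetry_n\<phi>: "u \<in> nW \<Longrightarrow> geodesic_symmetry M m V (n\<phi> u) = n\<phi> (- u)"
  using n\<phi>_scale[of "- 1" u] by (simp add: geodesic_symmetry_def log_n\<phi> tneg_eq_tscale)

lemma geodesic_segment_n\<phi>: "u \<in> nW \<Longrightarrow> geodesic_segment M m V (n\<phi> u) = (\<lambda>t. n\<phi> ((- t) *\<^sub>R u))"
  by (simp add: geodesic_segment_def log_n\<phi> fun_eq_iff flip: n\<phi>_scale)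

interpretation param M nW n\<phi> n\<psi> by (rule normal_param)

text \<open>Openness lets a ray run beyond its end point. This makes \<open>u\<close> an interior
  point in \<open>\<Gamma>_radial\<close> and gives an open parameter interval around the closed
  segment in the parallel transport.\<close>

lemma nW_extend:
  assumes u: "u \<in> nW"
  obtains t :: real where "t *\<^sub>R u \<in> nW" "t > 1"
proof -
  have "isCont (\<lambda>t. t *\<^sub>R u) (1::real)" by (intro continuous_intros)
  then have "\<forall>\<^sub>F t in at_right (1::real). t *\<^sub>R u \<in> nW"
    using open_W u by (auto simp: isCont_def filterlim_at_split intro: topological_tendstoD)
  then have "\<forall>\<^sub>F t in at_right (1::real). t *\<^sub>R u \<in> nW \<and> t > 1"
    using eventually_at_right_less[of 1] by eventually_elim simp
  then show ?thesis
    using that eventually_happens[of _ "at_right (1::real)"] by (auto simp: trivial_limit_at_right_real)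
qed

text \<open>In these coordinates a ray is a geodesic with constant velocity, so the geodesic
  equation leaves only the symbol term. It is read off at interior times, and \<open>u\<close> is
  reached as an interior point of a longer ray.\<close>

lemma \<Gamma>_radial:
  assumes u: "u \<in> nW"
  shows "\<Gamma> u u u = 0"
proof -
  have small: "\<Gamma> (t *\<^sub>R u) u u = 0" if u: "u \<in> nW" and t: "t \<in> {0<..<1}" for u t
  proof -
    have "coord_field M i u m \<in> exp_domain M m" using coord_in_V[OF u] N unfolding symmetric_normal_def by blast
    then obtain J \<gamma> where g: "geodesic M J \<gamma>" "{0..1} \<subseteq> J"
      and ray: "\<And>a. a \<in> J \<Longrightarrow> exp_map M m (tscale a (coord_field M i u m)) = \<gamma> a"
      using exp_domain_geodesic by metis
    have J': "open {0<..<1::real}" "{0<..<1} \<subseteq> J" using g(2) by (auto simp: subset_iff)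
    have \<gamma>: "\<gamma> s = n\<phi> (s *\<^sub>R u)" "s *\<^sub>R u \<in> nW" if "s \<in> {0<..<1}" for s
      using ray[of s] J' that n\<phi>_scale nW_star[OF u] by (auto simp: subset_iff)
    obtain y v where c: "geodesic_coords {0<..<1} \<gamma> y v"
      using geodesicD[OF g(1) J'] \<gamma> by (metis imageI)
    note y = geodesic_coordsD(3)[OF c] and dy = geodesic_coordsD(4)[OF c] and dv = geodesic_coordsD(5)[OF c]
    have ys: "y s = s *\<^sub>R u" if "s \<in> {0<..<1}" for s
      using y[OF that] \<gamma>[OF that] \<psi>_\<phi> by metis
    have vs: "v s = u" if s: "s \<in> {0<..<1}" for s
    proof -
      have "((\<lambda>s. s *\<^sub>R u) has_vector_derivative v s) (at s)"
        by (rule has_vector_derivative_transform_within_open[OF dy[OF s] J'(1) s]) (simp add: ys)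
      moreover have "((\<lambda>s. s *\<^sub>R u) has_vector_derivative u) (at s)"
        by (auto intro!: derivative_eq_intros)
      ultimately show ?thesis by (rule vector_derivative_unique_at)
    qed
    have "((\<lambda>_. u) has_vector_derivative - \<Gamma> (y t) (v t) (v t)) (at t)"
      by (rule has_vector_derivative_transform_within_open[OF dv[OF t] J'(1) t]) (simp add: vs)
    moreover have "((\<lambda>_. u) has_vector_derivative 0) (at t)" by (rule has_vector_derivative_const)
    ultimately have "- \<Gamma> (y t) (v t) (v t) = 0" by (rule vector_derivative_unique_at)
    then show ?thesis by (simp add: ys[OF t] vs[OF t])
  qed
  obtain t where t: "t *\<^sub>R u \<in> nW" "t > 1" by (rule nW_extend[OF u])
  have "\<Gamma> ((1 / t) *\<^sub>R (t *\<^sub>R u)) (t *\<^sub>R u) (t *\<^sub>R u) = 0" by (rule small[OF t(1)]) (use t(2) in auto)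
  then show ?thesis using t(2) by (simp add: blinfun.scaleR_left blinfun.scaleR_right)
qed

lemma \<Gamma>_odd:
  assumes M: "locally_symmetric M" and u: "u \<in> nW"
  shows "\<Gamma> (- u) = - \<Gamma> u"
proof -
  interpret symmetric_normal_coords nW \<Gamma>
    by unfold_locales (assumption | rule open_W nW_zero nW_star nW_neg smooth_\<Gamma> \<Gamma>_symmetric[OF M] \<Gamma>_radial
        curv_\<Gamma>_parallel[OF M])+
  show ?thesis by (rule G_odd[OF u])
qed

text \<open>The term \<open>\<Gamma> y v v\<close> is odd in the position and even in the velocity,
  so it changes sign under reflection exactly as the acceleration does.\<close>

lemma geodesic_reflection:
  assumes M: "locally_symmetric M" and J: "is_interval J" and c: "geodesic_coords J \<gamma> y v"
  shows "geodesic M J (\<lambda>s. n\<phi> (- y s))" "t \<in> J \<Longrightarrow> velocity M (\<lambda>s. n\<phi> (- y s)) t = push (- y t) (- v t)"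
proof -
  note c' = geodesic_coordsD[OF c]
  have "((\<lambda>s. - v s) has_vector_derivative - \<Gamma> (- y s) (- v s) (- v s)) (at s)" if "s \<in> J" for s
    using has_vector_derivative_minus[OF c'(5)[OF that]] \<Gamma>_odd[OF M, of "y s"] c'(3)[OF that]
    by (simp add: blinfun.minus_left blinfun.minus_right)
  then have gc: "geodesic_coords J (\<lambda>s. n\<phi> (- y s)) (\<lambda>s. - y s) (\<lambda>s. - v s)"
    unfolding geodesic_coords_def
    using c'(1) smooth_on_minus[OF c'(1,2)] nW_neg c'(3) has_vector_derivative_minus[OF c'(4)] by simp
  show "geodesic M J (\<lambda>s. n\<phi> (- y s))"
    by (rule geodesicI[OF c'(1) J]) (use gc normal_param in blast)
  show "velocity M (\<lambda>s. n\<phi> (- y s)) t = push (- y t) (- v t)" if "t \<in> J"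
    by (rule geodesic_coordsD(6)[OF gc that])
qed

text \<open>The coefficient \<open>A\<close> is odd in the parameter, so
  \<open>t \<mapsto> f (- t)\<close> solves the same equation as \<open>f\<close> and agrees with it
  at 0; hence \<open>f\<close> takes equal values at both ends. As the transport is a definite
  description, the field is constructed and then compared with every competitor.\<close>

lemma parallel_transport_reflection:
  assumes M: "locally_symmetric M" and u: "u \<in> nW"
  shows "parallel_transport M (geodesic_segment M m V (n\<phi> u)) (- 1) 1 (push u a) = push (- u) a"
proof -
  obtain b where b: "b *\<^sub>R u \<in> nW" "b > 1" by (rule nW_extend[OF u])
  define y where "y t = (- t) *\<^sub>R u" for t :: real
  have y: "y t \<in> nW" if "\<bar>t\<bar> \<le> b" for t
  proof -
    have *: "(\<bar>t\<bar> / b) *\<^sub>R (b *\<^sub>R u) \<in> nW" by (rule nW_star[OF b(1)]) (use that b(2) in auto)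
    then have "\<bar>t\<bar> *\<^sub>R u \<in> nW" using b(2) by simp
    then show ?thesis using nW_neg[of "\<bar>t\<bar> *\<^sub>R u"] by (cases "t \<ge> 0") (auto simp: y_def)
  qed
  have sy: "smooth_on S y" for S
    unfolding y_def[abs_def]
    by (intro smooth_on_bounded_linear bounded_linear_scaleR_const[OF bounded_linear_minus[OF bounded_linear_ident]])
  have dy: "(y has_vector_derivative - u) (at t within S)" for t S
    unfolding y_def[abs_def] by (auto intro!: derivative_eq_intros)
  \<comment> \<open>The segment runs with velocity \<open>- u\<close>, which cancels the minus sign
    of the parallel equation.\<close>
  define A where "A t = \<Gamma> (y t) u" for t
  let ?S = "{- b<..<b}"
  have sA: "smooth_on ?S A"
    unfolding A_def
    by (intro smooth_on_blinfun_apply smooth_on_const smooth_on_compose[OF _ open_W sy smooth_\<Gamma>]) (auto intro!: y)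
  have cA: "continuous_on {- b..b} A"
    unfolding A_def
    by (intro continuous_intros continuous_on_compose2[OF smooth_on_continuous_on[OF smooth_\<Gamma>] smooth_on_continuous_on[OF sy]])
      (auto intro!: y)
  obtain c where c: "\<And>t. t \<in> {- b..b} \<Longrightarrow> norm (A t) \<le> c"
    using compact_imp_bounded[OF compact_continuous_image[OF cA compact_Icc]] unfolding bounded_iff by blast
  have "norm (A 0) \<le> c" using c[of 0] b(2) by simp
  then have c0: "c \<ge> 0" by (rule order.trans[OF norm_ge_zero])
  have bound: "norm (A t w) \<le> c * norm w" if "t \<in> {- b..b}" for t w
    using norm_blinfun c[OF that] by (meson mult_right_mono norm_ge_zero order.trans)
  have odd: "A (- t) = - A t" if "t \<in> {- b..b}" for t
    using \<Gamma>_odd[OF M y[of t]] that by (simp add: A_def y_def blinfun.minus_left abs_le_iff)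
  have m1: "- 1 \<in> {- b..b}" using b(2) by simp
  obtain f where f1: "f (- 1) = a" and df: "\<And>t. t \<in> {- b..b} \<Longrightarrow> (f has_vector_derivative A t (f t)) (at t within {- b..b})"
    using linear_ode_exists[OF cA m1, of a] by blast
  have df': "(f has_vector_derivative A t (f t)) (at t)" if "t \<in> ?S" for t
    using df[of t] that by (simp add: at_within_Icc_at)
  have sf: "smooth_on ?S f"
    by (rule smooth_on_linear_ode_solution[OF _ sA df']) auto
  have "f 1 - f (- 1) = 0"
  proof (rule gronwall_zero[where g="\<lambda>t. f t - f (- t)" and a="- 1" and b=1 and K=c and ?t0.0=0
        and g'="\<lambda>t. A t (f t) - A t (f (- t))"])
    fix t :: real assume t: "t \<in> {- 1..1}"
    then have tS: "t \<in> ?S" "- t \<in> ?S" "t \<in> {- b..b}" using b(2) by auto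
    have "((\<lambda>t. f (- t)) has_vector_derivative (- 1) *\<^sub>R A (- t) (f (- t))) (at t)"
      using vector_diff_chain_at[OF has_vector_derivative_minus[OF has_vector_derivative_id] df'[OF tS(2)]]
      by (simp add: o_def)
    then have "((\<lambda>t. f (- t)) has_vector_derivative A t (f (- t))) (at t)"
      by (simp add: odd[OF tS(3)] blinfun.minus_left)
    from has_vector_derivative_diff[OF df'[OF tS(1)] this]
    show "((\<lambda>t. f t - f (- t)) has_vector_derivative A t (f t) - A t (f (- t))) (at t within {- 1..1})"
      by (rule has_vector_derivative_at_within)
    show "norm (A t (f t) - A t (f (- t))) \<le> c * norm (f t - f (- t))"
      using bound[OF tS(3), of "f t - f (- t)"] by (simp add: blinfun.diff_right)
  qed (use c0 in auto)
  then have f2: "f 1 = a" using f1 by simp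
  have seg: "geodesic_segment M m V (n\<phi> u) = (\<lambda>t. n\<phi> (y t))"
    by (simp add: geodesic_segment_n\<phi>[OF u] y_def)
  have P: "parallel_along M ?S (\<lambda>t. n\<phi> (y t)) (\<lambda>t. push (y t) (f t))"
  proof (rule parallel_alongI[OF _ _ sy _ dy sf])
    show "(f has_vector_derivative - \<Gamma> (y s) (- u) (f s)) (at s)" if "s \<in> ?S" for s
      using df'[OF that] by (simp add: A_def blinfun.minus_left blinfun.minus_right)
  qed (auto intro!: y is_interval_oo)
  show ?thesis
    unfolding parallel_transport_def seg
  proof (rule the_equality)
    show "\<exists>J W. {- 1..1} \<subseteq> J \<and> parallel_along M J (\<lambda>t. n\<phi> (y t)) W \<and> W (- 1) = push u a \<and> W 1 = push (- u) a"
      using P b(2) by (intro exI[of _ ?S] exI[of _ "\<lambda>t. push (y t) (f t)"]) (auto simp: f1 f2 y_def)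
    fix w assume "\<exists>J W. {- 1..1} \<subseteq> J \<and> parallel_along M J (\<lambda>t. n\<phi> (y t)) W \<and> W (- 1) = push u a \<and> W 1 = w"
    then obtain J W where J: "{- 1..1} \<subseteq> J" and W: "parallel_along M J (\<lambda>t. n\<phi> (y t)) W" "W (- 1) = push u a" "W 1 = w"
      by (elim exE conjE)
    \<comment> \<open>A competing field may live on an interval that leaves the coordinate range;
      the intersection still contains the closed segment.\<close>
    define J' where "J' = J \<inter> ?S"
    have J': "open J'" "J' \<subseteq> J" "{- 1..1} \<subseteq> J'"
      using W(1) J b(2) by (auto simp: J'_def parallel_along_def smooth_curve_def)
    obtain h where h: "\<And>s. s \<in> J' \<Longrightarrow> W s = push (y s) (h s)"
      and dh: "\<And>s. s \<in> J' \<Longrightarrow> (h has_vector_derivative - \<Gamma> (y s) (- u) (h s)) (at s)"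
      by (rule parallel_alongD[OF W(1) J'(1,2) sy _ dy]) (auto simp: J'_def intro!: y)
    have m: "- 1 \<in> J'" "1 \<in> J'" using J'(3) by (auto simp: subset_iff)
    have h1: "h (- 1) = a" using h[OF m(1)] W(2) push_inject[OF u] by (simp add: y_def)
    have "h 1 - f 1 = 0"
    proof (rule gronwall_zero[where g="\<lambda>t. h t - f t" and a="- 1" and b=1 and K=c and ?t0.0="- 1"
          and g'="\<lambda>t. A t (h t) - A t (f t)"])
      fix t :: real assume t: "t \<in> {- 1..1}"
      then have tS: "t \<in> J'" "t \<in> ?S" "t \<in> {- b..b}" using J'(3) by (auto simp: J'_def)
      have "(h has_vector_derivative A t (h t)) (at t)"
        using dh[OF tS(1)] by (simp add: A_def blinfun.minus_left blinfun.minus_right)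
      from has_vector_derivative_diff[OF this df'[OF tS(2)]]
      show "((\<lambda>t. h t - f t) has_vector_derivative A t (h t) - A t (f t)) (at t within {- 1..1})"
        by (rule has_vector_derivative_at_within)
      show "norm (A t (h t) - A t (f t)) \<le> c * norm (h t - f t)"
        using bound[OF tS(3), of "h t - f t"] by (simp add: blinfun.diff_right)
    qed (use c0 h1 f1 in auto)
    then show "w = push (- u) a" using h[OF m(2)] W(3) f2 by (simp add: y_def)
  qed
qed

end

end


section \<open>Pole ladder\<close>

theorem theorem3:
  fixes M :: "('m::{t2_space,second_countable_topology}, 'c, 'e::euclidean_space) acs"
    and m p q :: 'm
    and Vm Vp Vq :: "('c, 'e) tvec set"
    and u :: "('c, 'e) tvec"
  defines "Um \<equiv> exp_map M m ` Vm"
    and "Up \<equiv> exp_map M p ` Vp"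
    and "Uq \<equiv> exp_map M q ` Vq"
    and "sm \<equiv> geodesic_symmetry M m Vm"
    and "sp \<equiv> geodesic_symmetry M p Vp"
    and "sq \<equiv> geodesic_symmetry M q Vq"
    and "logq \<equiv> log_map M q Vq"
    and "PT \<equiv> parallel_transport M (geodesic_segment M m Vm p) (- 1) 1"
  assumes "locally_symmetric M"
    and "symmetric_normal M m Vm"
    and "p \<in> Um" and "q = sm p"
    and "symmetric_normal M p Vp"
    and "symmetric_normal M q Vq"
    and "u \<in> tangent_space M p"
  shows "\<forall>\<^sub>F t in at_right (0::real).
    tscale t u \<in> exp_domain M p \<and>
    (let p' = exp_map M p (tscale t u) in
       p' \<in> Um \<and> sm p' \<in> Uq \<and> sq (sm p') \<in> Uq \<and>
       p' \<in> Up \<and> sp p' \<in> Um \<and> sm (sp p') \<in> Uq \<and>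
       logq (sq (sm p')) = PT (tscale t u) \<and>
       logq (sm (sp p')) = PT (tscale t u))"
proof -
  have M: "locally_symmetric M" and Nm: "symmetric_normal M m Vm" and p: "p \<in> Um" and q: "q = sm p"
    and Np: "symmetric_normal M p Vp" and Nq: "symmetric_normal M q Vq" and u: "u \<in> tangent_space M p"
    by fact+
  interpret acs_space M by unfold_locales (use M in \<open>simp add: locally_symmetric_def\<close>)
  obtain i where i: "i \<in> charts_at M m" using chart_exists by blast
  define W where "W = nW Vm i"
  define \<phi> where "\<phi> = n\<phi> m i"
  define \<psi> where "\<psi> = n\<psi> m Vm i"
  interpret P: param M W \<phi> \<psi> unfolding W_def \<phi>_def \<psi>_def by (rule normal_param[OF Nm i])
  have Um: "Um = \<phi> ` W" by (simp add: Um_def \<phi>_def W_def n\<phi>_image[OF Nm i])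
  have sm: "sm (\<phi> x) = \<phi> (- x)" if "x \<in> W" for x
    using geodesic_symmetry_n\<phi>[OF Nm i] that by (simp add: sm_def \<phi>_def W_def)
  obtain \<xi> where \<xi>: "\<xi> \<in> W" "p = \<phi> \<xi>" using p Um by blast
  have q\<xi>: "q = \<phi> (- \<xi>)" using q sm[OF \<xi>(1)] \<xi>(2) by simp
  obtain J \<gamma> where g: "geodesic M J \<gamma>" "0 \<in> J" "\<gamma> 0 = p" "velocity M \<gamma> 0 = u"
    and exp_p: "\<And>t. t \<in> J \<Longrightarrow> exp_map M p (tscale t u) = \<gamma> t"
    and dom_p: "\<And>t. t \<in> J \<Longrightarrow> tscale t u \<in> exp_domain M p"
    using symmetric_normal_geodesic[OF Np u] by metis
  have J: "open J" "continuous_on J \<gamma>"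
    using g(1) by (auto simp: geodesic_def smooth_curve_def smooth_into_def)
  have "open (J \<inter> \<gamma> -` Um)" "0 \<in> J \<inter> \<gamma> -` Um"
    using continuous_open_preimage[OF J(2,1) P.open_range] g p by (auto simp: Um)
  then obtain d where d: "d > 0" "ball 0 d \<subseteq> J \<inter> \<gamma> -` Um" using open_contains_ball by blast
  \<comment> \<open>Symmetric about 0, because the geodesic symmetry at \<open>p\<close> evaluates
    the geodesic at \<open>- t\<close>.\<close>
  define J' where "J' = {- d<..<d}"
  have J': "open J'" "is_interval J'" "J' \<subseteq> J" "\<And>s. s \<in> J' \<Longrightarrow> \<gamma> s \<in> \<phi> ` W" "0 \<in> J'" "\<And>s. s \<in> J' \<Longrightarrow> - s \<in> J'"
    using d by (auto simp: J'_def is_interval_oo Um ball_eq_greaterThanLessThan)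
  obtain y v where c: "P.geodesic_coords J' \<gamma> y v" using P.geodesicD[OF g(1) J'(1,3,4)] by metis
  note y = P.geodesic_coordsD(3)[OF c]
  have y0: "y 0 = \<xi>" using y[OF J'(5)] g(3) \<xi> P.\<psi>_\<phi> by metis
  have u_eq: "u = P.push \<xi> (v 0)" using P.geodesic_coordsD(6)[OF c J'(5)] g(4) y0 by simp
  define \<delta> where "\<delta> = (\<lambda>s. \<phi> (- y s))"
  \<comment> \<open>Image of \<open>u\<close> under the differential of the reflection; base point
    and vector both change sign in coordinates.\<close>
  define w where "w = P.push (- \<xi>) (- v 0)"
  note refl = geodesic_reflection[OF Nm i M J'(2), folded W_def \<phi>_def \<psi>_def, OF c, folded \<delta>_def]
  have g\<delta>: "geodesic M J' \<delta>" and v\<delta>: "velocity M \<delta> 0 = w" and \<delta>0: "\<delta> 0 = q"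
    using refl J'(5) by (simp_all add: w_def y0 \<delta>_def q\<xi>)
  have exp_q: "exp_map M q (tscale t w) = \<delta> t" if "t \<in> J'" for t
    using exp_map_ray(1)[OF g\<delta> J'(5) that] by (simp add: v\<delta> \<delta>0)
  have w: "w \<in> tangent_space M q" using geodesic_velocity_tangent[OF g\<delta> J'(5)] by (simp add: v\<delta> \<delta>0)
  obtain e1 where e1: "e1 > 0" "\<And>t. \<bar>t\<bar> < e1 \<Longrightarrow> tscale t u \<in> Vp" using symmetric_normal_tscale[OF Np u] by blast
  obtain e2 where e2: "e2 > 0" "\<And>t. \<bar>t\<bar> < e2 \<Longrightarrow> tscale t w \<in> Vq" using symmetric_normal_tscale[OF Nq w] by blast
  have logp: "log_map M p Vp (exp_map M p v) = v" if "v \<in> Vp" for v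
    unfolding log_map_def using Np that by (intro inv_into_f_f) (auto simp: symmetric_normal_def)
  have logq: "logq (exp_map M q v) = v" if "v \<in> Vq" for v
    unfolding logq_def log_map_def using Nq that by (intro inv_into_f_f) (auto simp: symmetric_normal_def)
  have neg: "tneg (tscale t v) = tscale (- t) v" for t and v :: "('c, 'e) tvec"
    by (simp add: tneg_def tscale_def)
  \<comment> \<open>Parallel transport keeps the coordinate vector, whereas the reflection negates
    it; this is the origin of the sign in \<open>- t\<close>.\<close>
  have PT: "PT (tscale t u) = tscale (- t) w" for t
  proof -
    have "- \<xi> \<in> W" using nW_neg[OF Nm i] \<xi>(1) by (simp add: W_def)
    moreover have "PT (P.push \<xi> (t *\<^sub>R v 0)) = P.push (- \<xi>) (t *\<^sub>R v 0)"
      using parallel_transport_reflection[OF Nm i M, folded W_def \<phi>_def \<psi>_def, OF \<xi>(1)] \<xi>(2)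
      by (simp add: PT_def)
    ultimately show ?thesis
      using P.push_scale[OF \<xi>(1), of t "v 0"] P.push_scale[of "- \<xi>" "- t" "- v 0"] by (simp add: u_eq w_def)
  qed
  show ?thesis
    unfolding eventually_at_right_field Let_def
  proof (intro exI[of _ "Min {d, e1, e2}"] conjI allI impI)
    show "0 < Min {d, e1, e2}" using d e1 e2 by simp
    fix t :: real assume t0: "0 < t" and "t < Min {d, e1, e2}"
    then have t: "t \<in> J'" "- t \<in> J'" "\<bar>t\<bar> < e1" "\<bar>- t\<bar> < e1" "\<bar>t\<bar> < e2" "\<bar>- t\<bar> < e2"
      using J'(6) by (auto simp: J'_def)
    have tJ: "t \<in> J" "- t \<in> J" using t J'(3) by auto
    let ?p' = "exp_map M p (tscale t u)"
    have p': "?p' = \<phi> (y t)" "y t \<in> W" using exp_p[OF tJ(1)] y[OF t(1)] by auto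
    have smp': "sm ?p' = exp_map M q (tscale t w)"
      using sm[OF p'(2)] exp_q[OF t(1)] by (simp add: p'(1) \<delta>_def)
    \<comment> \<open>Both versions reach the same point: here the geodesic is reflected at
      \<open>m\<close> and then reversed at \<open>q\<close>, while in \<open>smsp\<close> it is
      reversed at \<open>p\<close> and then reflected.\<close>
    have sqsm: "sq (sm ?p') = exp_map M q (tscale (- t) w)"
      unfolding smp' sq_def geodesic_symmetry_def using logq[OF e2(2)[OF t(5)]] by (simp add: logq_def neg)
    have spp': "sp ?p' = exp_map M p (tscale (- t) u)"
      unfolding sp_def geodesic_symmetry_def using logp[OF e1(2)[OF t(3)]] by (simp add: neg)
    have spy: "sp ?p' = \<phi> (y (- t))" "y (- t) \<in> W"
      unfolding spp' using exp_p[OF tJ(2)] y[OF t(2)] by auto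
    have smsp: "sm (sp ?p') = exp_map M q (tscale (- t) w)"
      using sm[OF spy(2)] exp_q[OF t(2)] by (simp add: spy(1) \<delta>_def)
    show "tscale t u \<in> exp_domain M p" by (rule dom_p[OF tJ(1)])
    show "?p' \<in> Um" unfolding Um using p' by blast
    show "sm ?p' \<in> Uq" unfolding smp' Uq_def by (rule imageI[OF e2(2)[OF t(5)]])
    show "sq (sm ?p') \<in> Uq" unfolding sqsm Uq_def by (rule imageI[OF e2(2)[OF t(6)]])
    show "?p' \<in> Up" unfolding Up_def by (rule imageI[OF e1(2)[OF t(3)]])
    show "sp ?p' \<in> Um" unfolding Um using spy by blast
    show "sm (sp ?p') \<in> Uq" unfolding smsp Uq_def by (rule imageI[OF e2(2)[OF t(6)]])
    show "logq (sq (sm ?p')) = PT (tscale t u)" unfolding sqsm PT by (rule logq[OF e2(2)[OF t(6)]])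
    show "logq (sm (sp ?p')) = PT (tscale t u)" unfolding smsp PT by (rule logq[OF e2(2)[OF t(6)]])
  qed
qed

end
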